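(* Let $\Lambda$ be a uniformly dense sequence in the open unit disk $\mathbb{D}$, and let $\varphi:(0,1)\to(0,1)$ be a nonincreasing function bounded above by some constant less than $1$. Assume that the closed pseudohyperbolic disks $D(\lambda,\varphi(|\lambda|))$, $\lambda\in\Lambda$, are pairwise disjoint, set $$\Omega(\Lambda,\varphi)=\mathbb{D}\setminus\bigcup_{\lambda\in\Lambda}D(\lambda,\varphi(|\lambda|)),$$ and assume that $0\in\Omega(\Lambda,\varphi)$. Then the exterior boundary $\partial\mathbb{D}$ of $\Omega(\Lambda,\varphi)$ has positive harmonic measure, i.e. $$\omega(0,\partial\mathbb{D},\Omega(\Lambda,\varphi))>0,$$ if and only if $$\int_0^1\frac{dt}{(1-t)\log(1/\varphi(t))}<\infty.$$
   Context: $\mathbb{D}=\{z\in\mathbb{C}:|z|<1\}$. The pseudohyperbolic distance between $z,\zeta\in\mathbb{D}$ is $\rho(z,\zeta)=\left|\frac{z-\zeta}{1-\zeta\bar z}\right|$. For $z\in\mathbb{D}$ and $0<r<1$, $D(z,r)=\{\zeta\in\mathbb{D}:\rho(z,\zeta)\le r\}$. A sequence $\Lambda$ of distinct points in $\mathbb{D}$ is called uniformly dense if (i) $\Lambda$ is separated, i.e. $\inf_{\lambda\ne\lambda'}\rho(\lambda,\lambda')>0$ (infimum over $\lambda,\lambda'\in\Lambda$), and (ii) there exists $r<1$ such that $\mathbb{D}=\bigcup_{\lambda\in\Lambda}D(\lambda,r)$. Harmonic measure: domains $\Omega$ of the form $\Omega=\mathbb{D}\setminus\bigcup_{\lambda\in\Lambda}D(\lambda,r_\lambda)$,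 where $\Lambda$ is a uniformly dense sequence and the radii $0<r_\lambda<1$ are such that the closed pseudohyperbolic disks $D(\lambda,r_\lambda)$, $\lambda\in\Lambda$, are pairwise disjoint, are regular for the Dirichlet problem, so every continuous function $f$ on $\partial\Omega$ has a unique continuous extension to $\overline{\Omega}$ that is harmonic in $\Omega$. For $z\in\Omega$, the value at $z$ of this extension equals $\int_{\partial\Omega} f\,d\omega_z$ for a unique Borel probability measure $\omega_z$ on $\partial\Omega$, the harmonic measure of $\Omega$ at $z$. For a Borel set $A\subset\partial\Omega$ one writes $\omega(z,A,\Omega)=\omega_z(A)$. *)

theory Defs
  imports "HOL-Probability.Probability"
begin

definition pseudohyp_dist :: "complex \<Rightarrow> complex \<Rightarrow> real" where
  "pseudohyp_dist z \<zeta> = cmod ((z - \<zeta>) / (1 - \<zeta> * cnj z))"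

definition pseudohyp_disk :: "complex \<Rightarrow> real \<Rightarrow> complex set" where
  "pseudohyp_disk z r = {\<zeta> \<in> ball 0 1. pseudohyp_dist z \<zeta> \<le> r}"

(* A sequence satisfying the covering condition is necessarily infinite, so indexing by nat
   is no restriction. *)
definition uniformly_dense :: "(nat \<Rightarrow> complex) \<Rightarrow> bool" where
  "uniformly_dense \<Lambda> \<longleftrightarrow>
     inj \<Lambda> \<and> range \<Lambda> \<subseteq> ball 0 1 \<and>
     (INF (m, n) \<in> {(m, n). m \<noteq> n}. pseudohyp_dist (\<Lambda> m) (\<Lambda> n)) > 0 \<and>
     (\<exists>r. 0 < r \<and> r < 1 \<and> ball 0 1 = (\<Union>n. pseudohyp_disk (\<Lambda> n) r))"

definition champagne_region :: "(nat \<Rightarrow> complex) \<Rightarrow> (real \<Rightarrow> real) \<Rightarrow> complex set" where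
  "champagne_region \<Lambda> \<phi> = ball 0 1 - (\<Union>n. pseudohyp_disk (\<Lambda> n) (\<phi> (cmod (\<Lambda> n))))"

(* Twice continuously differentiable with vanishing Laplacian: ux, uy are the first and
   uxx, uxy, uyx, uyy the second partial derivatives of u with respect to z = x + i y. *)
definition harmonic_on :: "(complex \<Rightarrow> real) \<Rightarrow> complex set \<Rightarrow> bool" where
  "harmonic_on u S \<longleftrightarrow> open S \<and>
     (\<exists>ux uy uxx uxy uyx uyy.
        (\<forall>z\<in>S. (u has_derivative (\<lambda>h. ux z * Re h + uy z * Im h)) (at z) \<and>
               (ux has_derivative (\<lambda>h. uxx z * Re h + uxy z * Im h)) (at z) \<and>
               (uy has_derivative (\<lambda>h. uyx z * Re h + uyy z * Im h)) (at z) \<and>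
               uxx z + uyy z = 0) \<and>
        continuous_on S uxx \<and> continuous_on S uxy \<and>
        continuous_on S uyx \<and> continuous_on S uyy)"

definition dirichlet_solution ::
    "complex set \<Rightarrow> (complex \<Rightarrow> real) \<Rightarrow> (complex \<Rightarrow> real) \<Rightarrow> bool" where
  "dirichlet_solution \<Omega> f u \<longleftrightarrow>
     continuous_on (closure \<Omega>) u \<and> harmonic_on u \<Omega> \<and> (\<forall>x\<in>frontier \<Omega>. u x = f x)"

(* On closure \<Omega> the solution u is unique by the maximum principle (\<Omega> bounded), so the
   existential quantifier refers to the value at z of the harmonic extension of f. *)
definition is_harmonic_measure :: "complex set \<Rightarrow> complex \<Rightarrow> complex measure \<Rightarrow> bool" where
  "is_harmonic_measure \<Omega> z M \<longleftrightarrow>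
     prob_space M \<and> sets M = sets (restrict_space borel (frontier \<Omega>)) \<and>
     (\<forall>f. continuous_on (frontier \<Omega>) f \<longrightarrow>
          (\<exists>u. dirichlet_solution \<Omega> f u \<and> u z = (\<integral>x. f x \<partial>M)))"

(* Meaningful for bounded domains that are regular for the Dirichlet problem and z \<in> \<Omega>;
   there the measure exists and is unique. *)
definition harmonic_measure :: "complex \<Rightarrow> complex set \<Rightarrow> complex set \<Rightarrow> real" where
  "harmonic_measure z A \<Omega> = measure (THE M. is_harmonic_measure \<Omega> z M) A"

end

theory Submission
  imports Defs "HOL-Complex_Analysis.Complex_Analysis"
begin

text \<open>The value at 0 of the solution with boundary values concentrating on the unit circle is the
  harmonic measure of the circle, so it suffices to estimate these solutions.

  If the integral diverges, write R(k) = 1 - q^k. Every point of modulus at most R(k) is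
  within a fixed pseudohyperbolic distance of some removed disk, and comparison with the logarithm of
  the distance to its centre shows that a solution vanishing on the disks loses a factor
  1 - c / ln (1 / \<phi>(R(k+1))) on passing from modulus R(k+1) to R(k). The product of
  these factors is 0.

  If the integral converges, the Green functions of the centres, normalised to be 1 on the removed circles,
  have a finite sum G at 0, because a separated sequence has O(q^(-k)) points of modulus between
  R(k) and R(k+1). Off the disks, 1 - G bounds the solutions from below. The tail of G is small at 0,
  so the minimum principle gives a point where G is less than 1, and Harnack's inequality transfers the lower
  bound to 0.\<close>

section \<open>Poisson integrals on disks\<close>

text \<open>\<open>harmonic_measure\<close> is a \<open>THE\<close>, so it says nothing until a
  measure is shown to exist and to be unique. Solvability of the Dirichlet problem, a representation
  theorem and uniqueness therefore precede every estimate. Harmonicity is handled as the Poisson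
  formula on disks (\<open>harm\<close>), which survives limits and yields Harnack's inequality at
  once; the twice differentiable notion enters only to identify solutions and to prove them unique.

  The loss factor comes from a logarithm that is 1 on a removed circle and 0 on a larger circle
  around it. Reaching that larger circle costs a bounded factor in 1 - |z|, and this factor is q. As
  \<phi> is monotone, the integral converges exactly when the sum of 1 / ln (1 / \<phi>(R(k))) over
  k >= 1 does, for any q in (0,1), so the two directions may use different q.

  In the convergent case G(0) is finite but may exceed 1, so 1 - G can be useless at 0 itself. Hence
  the search for a better point, and the need for \<Omega> to be connected.\<close>

definition uc :: "real \<Rightarrow> complex" where
  "uc t = exp (2 * of_real pi * \<i> * of_real t)"

lemma norm_uc [simp]: "cmod (uc t) = 1"
  unfolding uc_def by simp

lemma uc_nonzero [simp]: "uc t \<noteq> 0"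
  unfolding uc_def by simp

lemma uc_0 [simp]: "uc 0 = 1"
  unfolding uc_def by simp

lemma continuous_on_uc [continuous_intros]: "continuous_on S uc"
  unfolding uc_def by (intro continuous_intros)

lemma uc_sphere: "r \<ge> 0 \<Longrightarrow> w + of_real r * uc t \<in> sphere w r"
  by (simp add: dist_norm norm_mult)

lemma continuous_on_circle:
  fixes u :: "complex \<Rightarrow> 'a::topological_space"
  assumes "continuous_on (sphere w r) u" "0 \<le> r"
  shows "continuous_on A (\<lambda>t. u (w + of_real r * uc t))"
  by (rule continuous_on_compose2[OF assms(1)]) (use assms(2) uc_sphere in \<open>auto intro!: continuous_intros\<close>)

text \<open>With the parameter running over [0,1], dt is normalised arc length and \<open>uc\<close>
  agrees with the parametrisation of \<open>circlepath\<close>; no factor 1/(2 pi) ever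
  appears.\<close>

definition circ_mean :: "(complex \<Rightarrow> real) \<Rightarrow> complex \<Rightarrow> real \<Rightarrow> real" where
  "circ_mean u z r = integral {0..1} (\<lambda>t. u (z + of_real r * uc t))"

definition poisson_kernel :: "complex \<Rightarrow> complex \<Rightarrow> real" where
  "poisson_kernel \<zeta> e = (1 - (cmod \<zeta>)\<^sup>2) / (cmod (e - \<zeta>))\<^sup>2"

definition poisson :: "(complex \<Rightarrow> real) \<Rightarrow> complex \<Rightarrow> real \<Rightarrow> complex \<Rightarrow> real" where
  "poisson g w r z =
     integral {0..1} (\<lambda>t. g (w + of_real r * uc t) * poisson_kernel ((z - w) / of_real r) (uc t))"

lemma continuous_on_poisson_kernel [continuous_intros]:
  assumes "cmod \<zeta> < 1"
  shows "continuous_on A (\<lambda>t. poisson_kernel \<zeta> (uc t))"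
proof -
  have "cmod (uc t - \<zeta>) \<noteq> 0" for t
    using assms norm_uc[of t] by auto
  then show ?thesis
    unfolding poisson_kernel_def by (intro continuous_intros) auto
qed

lemma poisson_kernel_nonneg: "cmod \<zeta> \<le> 1 \<Longrightarrow> 0 \<le> poisson_kernel \<zeta> e"
  unfolding poisson_kernel_def by (simp add: power_le_one)

lemma poisson_kernel_0 [simp]: "cmod e = 1 \<Longrightarrow> poisson_kernel 0 e = 1"
  by (simp add: poisson_kernel_def)

text \<open>The Herglotz form of the kernel; it makes a Poisson integral the real part of a
  holomorphic function.\<close>

lemma poisson_kernel_Re:
  assumes "cmod e = 1"
  shows "poisson_kernel \<zeta> e = Re ((e + \<zeta>) / (e - \<zeta>))"
proof -
  have "(Re e)\<^sup>2 + (Im e)\<^sup>2 = 1"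
    using assms by (simp add: cmod_def)
  then have "(Re e + Re \<zeta>) * (Re e - Re \<zeta>) + (Im e + Im \<zeta>) * (Im e - Im \<zeta>) = 1 - ((Re \<zeta>)\<^sup>2 + (Im \<zeta>)\<^sup>2)"
    by (simp add: algebra_simps power2_eq_square)
  then show ?thesis
    by (simp add: poisson_kernel_def Re_divide cmod_power2)
qed

text \<open>Because e has modulus 1, 1 - cnj \<zeta> * e equals e * cnj (e - \<zeta>). The same
  identity later gives pseudohyperbolic distance 1 to every boundary point.\<close>

lemma norm_unit_diff:
  assumes "cmod e = 1"
  shows "cmod (1 - cnj \<zeta> * e) = cmod (e - \<zeta>)"
proof -
  have "e * cnj e = 1"
    using assms complex_norm_square[of e] by simp
  then have "1 - cnj \<zeta> * e = e * cnj (e - \<zeta>)"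
    by (simp add: algebra_simps)
  then show ?thesis
    using assms by (simp add: norm_mult del: complex_cnj_diff)
qed

lemma circlepath_uc: "circlepath w r t = w + of_real r * uc t"
  by (simp add: circlepath uc_def)

lemma vector_derivative_circlepath_uc:
  "t \<in> {0..1} \<Longrightarrow> vector_derivative (circlepath w r) (at t within {0..1}) = 2 * of_real pi * \<i> * of_real r * uc t"
  by (simp add: vector_derivative_circlepath01 uc_def)

text \<open>Cauchy's formula at the centre: on the circle du / (u - z) is 2 pi i dt, so the contour
  integral is a plain average.\<close>

lemma holomorphic_has_integral_circle:
  assumes "continuous_on (cball z r) h" "h holomorphic_on ball z r" "0 < r"
  shows "((\<lambda>t. h (z + of_real r * uc t)) has_integral h z) {0..1}"
proof -
  have "((\<lambda>u. h u / (u - z)) has_contour_integral (2 * of_real pi * \<i> * h z)) (circlepath z r)"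
    by (rule Cauchy_integral_circlepath) (use assms in auto)
  then have "((\<lambda>t. h (circlepath z r t) / (circlepath z r t - z) *
      vector_derivative (circlepath z r) (at t within {0..1})) has_integral 2 * of_real pi * \<i> * h z) {0..1}"
    by (simp add: has_contour_integral_def)
  then have "((\<lambda>t. 2 * of_real pi * \<i> * h (z + of_real r * uc t)) has_integral 2 * of_real pi * \<i> * h z) {0..1}"
    by (rule has_integral_eq[rotated]) (use assms(3) in \<open>simp add: vector_derivative_circlepath_uc circlepath_uc\<close>)
  from has_integral_mult_right[OF this, of "1 / (2 * of_real pi * \<i>)"] show ?thesis
    by simp
qed

lemma circ_mean_Re:
  assumes "continuous_on (cball z r) h" "h holomorphic_on ball z r" "0 < r"
  shows "circ_mean (\<lambda>x. Re (h x)) z r = Re (h z)"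
  using has_integral_linear[OF holomorphic_has_integral_circle[OF assms] bounded_linear_Re]
  by (simp add: circ_mean_def o_def integral_unique)

text \<open>As a function of e the Herglotz form has its pole inside the disk. On the circle the
  kernel is also the real part of \<open>h\<close>, which is holomorphic on the disk and continuous
  up to the circle, so its mean is its value 1 at the centre.\<close>

lemma integral_poisson_kernel:
  assumes "cmod \<zeta> < 1"
  shows "integral {0..1} (\<lambda>t. poisson_kernel \<zeta> (uc t)) = 1"
proof -
  define h where "h e = (1 + cnj \<zeta> * e) / (1 - cnj \<zeta> * e)" for e
  have nz: "1 - cnj \<zeta> * e \<noteq> 0" if "cmod e \<le> 1" for e
  proof
    assume "1 - cnj \<zeta> * e = 0"
    then have "cmod (cnj \<zeta> * e) = 1" by (metis eq_iff_diff_eq_0 norm_one)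
    moreover have "cmod \<zeta> * cmod e \<le> cmod \<zeta> * 1"
      using that by (intro mult_left_mono) auto
    ultimately show False using assms by (simp add: norm_mult)
  qed
  have "continuous_on (cball 0 1) h" "h holomorphic_on ball 0 1"
    unfolding h_def using nz by (auto intro!: continuous_intros holomorphic_intros)
  from circ_mean_Re[OF this] have *: "integral {0..1} (\<lambda>t. Re (h (uc t))) = 1"
    by (simp add: circ_mean_def h_def)
  have "Re (h e) = poisson_kernel \<zeta> e" if e: "cmod e = 1" for e
  proof -
    have "Re (h e) = (1 - (cmod (cnj \<zeta> * e))\<^sup>2) / (cmod (1 - cnj \<zeta> * e))\<^sup>2"
      unfolding h_def by (simp add: Re_divide cmod_power2) (simp add: algebra_simps power2_eq_square)
    also have "\<dots> = poisson_kernel \<zeta> e"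
      using norm_unit_diff[OF e] e by (simp add: poisson_kernel_def norm_mult)
    finally show ?thesis .
  qed
  then show ?thesis using * by simp
qed

lemma norm_scaled_less: "z \<in> ball w r \<Longrightarrow> cmod ((z - w) / of_real r) < 1"
  using le_less_trans[OF zero_le_dist, of w z r] by (simp add: norm_divide dist_norm norm_minus_commute)

lemma poisson_integrable:
  assumes "continuous_on (sphere w r) g" "z \<in> ball w r"
  shows "(\<lambda>t. g (w + of_real r * uc t) * poisson_kernel ((z - w) / of_real r) (uc t)) integrable_on {0..1}"
proof -
  have "r > 0" using assms(2) by (simp add: le_less_trans[OF zero_le_dist])
  then show ?thesis
  by (intro integrable_continuous_interval continuous_intros norm_scaled_less continuous_on_circle assms) auto
qed

lemma poisson_mono:
  assumes "continuous_on (sphere w r) f" "continuous_on (sphere w r) g" "z \<in> ball w r"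
    and "\<And>x. x \<in> sphere w r \<Longrightarrow> f x \<le> g x"
  shows "poisson f w r z \<le> poisson g w r z"
  unfolding poisson_def
proof (rule integral_le[OF poisson_integrable poisson_integrable])
  have "r > 0" using assms(3) by (simp add: le_less_trans[OF zero_le_dist])
  then show "\<And>t. t \<in> {0..1} \<Longrightarrow> f (w + of_real r * uc t) * poisson_kernel ((z - w) / of_real r) (uc t)
    \<le> g (w + of_real r * uc t) * poisson_kernel ((z - w) / of_real r) (uc t)"
    using norm_scaled_less[OF assms(3)] uc_sphere[of r w]
    by (intro mult_right_mono assms(4) poisson_kernel_nonneg) auto
qed (use assms in auto)

lemma poisson_add:
  assumes "continuous_on (sphere w r) f" "continuous_on (sphere w r) g" "z \<in> ball w r"
  shows "poisson (\<lambda>x. f x + g x) w r z = poisson f w r z + poisson g w r z"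
  unfolding poisson_def distrib_right
  by (rule integral_add[OF poisson_integrable poisson_integrable]) (use assms in auto)

lemma poisson_cmult: "poisson (\<lambda>x. c * f x) w r z = c * poisson f w r z"
  unfolding poisson_def by (simp add: mult.assoc)

lemma poisson_const:
  assumes "z \<in> ball w r"
  shows "poisson (\<lambda>x. c) w r z = c"
  unfolding poisson_def using integral_poisson_kernel[OF norm_scaled_less[OF assms]] by simp

lemma poisson_cong: "r \<ge> 0 \<Longrightarrow> (\<And>x. x \<in> sphere w r \<Longrightarrow> f x = g x) \<Longrightarrow> poisson f w r z = poisson g w r z"
  unfolding poisson_def by (intro integral_cong) (metis uc_sphere)

lemma poisson_diff_bound:
  assumes "continuous_on (sphere w r) f" "continuous_on (sphere w r) g" "z \<in> ball w r"
    and le: "\<And>x. x \<in> sphere w r \<Longrightarrow> \<bar>f x - g x\<bar> \<le> e"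
  shows "\<bar>poisson f w r z - poisson g w r z\<bar> \<le> e"
proof -
  have "poisson f w r z \<le> poisson (\<lambda>x. g x + e) w r z"
    by (rule poisson_mono) (use assms in \<open>force intro!: continuous_intros simp: abs_le_iff\<close>)+
  moreover have "poisson g w r z \<le> poisson (\<lambda>x. f x + e) w r z"
    by (rule poisson_mono) (use assms in \<open>force intro!: continuous_intros simp: abs_le_iff\<close>)+
  ultimately show ?thesis
    using assms by (simp add: poisson_add poisson_const)
qed

text \<open>Split (e + \<zeta>) / (e - \<zeta>) = 2 e / (e - \<zeta>) - 1. The first term leads to a
  Cauchy type integral, holomorphic although g is merely continuous; the second to the constant mean
  of g.\<close>

lemma poisson_holomorphic:
  assumes g: "continuous_on (sphere w r) g" and r: "0 < r"
  obtains h where "h holomorphic_on ball w r" "\<And>z. z \<in> ball w r \<Longrightarrow> poisson g w r z = Re (h z)"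
proof -
  define I where "I z = contour_integral (circlepath w r) (\<lambda>u. of_real (g u) / (u - z))" for z
  define h where "h z = I z / (of_real pi * \<i>) - of_real (circ_mean g w r)" for z
  have cg: "continuous_on (path_image (circlepath w r)) (\<lambda>u. complex_of_real (g u))"
    using g r by (auto intro!: continuous_intros)
  have int: "((\<lambda>u. of_real (g u) / (u - z)) has_contour_integral I z) (circlepath w r)" if "z \<in> ball w r" for z
    unfolding I_def
    by (intro has_contour_integral_integral contour_integrable_continuous_circlepath continuous_intros cg)
       (use r that in auto)
  have "I holomorphic_on ball w r"
    unfolding holomorphic_on_open[OF open_ball]
    using Cauchy_next_derivative_circlepath(2)[OF cg, of 1 I] int by fastforce
  then have 1: "h holomorphic_on ball w r"
    unfolding h_def by (intro holomorphic_intros) auto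
  have 2: "poisson g w r z = Re (h z)" if z: "z \<in> ball w r" for z
  proof -
    define \<zeta> where "\<zeta> = (z - w) / of_real r"
    have \<zeta>: "cmod \<zeta> < 1" unfolding \<zeta>_def by (rule norm_scaled_less[OF z])
    have z_eq: "z = w + of_real r * \<zeta>" using r by (simp add: \<zeta>_def)
    have nz: "uc t - \<zeta> \<noteq> 0" for t
      using \<zeta> norm_uc[of t] by auto
    have "((\<lambda>t. of_real (g (circlepath w r t)) / (circlepath w r t - z) *
      vector_derivative (circlepath w r) (at t within {0..1})) has_integral I z) {0..1}"
      using int[OF z] by (simp add: has_contour_integral_def)
    then have "((\<lambda>t. of_real (g (w + of_real r * uc t)) * (2 * of_real pi * \<i>) * (uc t / (uc t - \<zeta>))) has_integral I z) {0..1}"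
    proof (rule has_integral_eq[rotated])
      fix t :: real assume "t \<in> {0..1}"
      have "w + of_real r * uc t - z = of_real r * (uc t - \<zeta>)"
        by (simp add: z_eq algebra_simps)
      with \<open>t \<in> {0..1}\<close> nz[of t] r show "of_real (g (circlepath w r t)) / (circlepath w r t - z) *
      vector_derivative (circlepath w r) (at t within {0..1}) = of_real (g (w + of_real r * uc t)) * (2 * of_real pi * \<i>) * (uc t / (uc t - \<zeta>))"
        by (simp add: vector_derivative_circlepath_uc circlepath_uc)
    qed
    from has_integral_mult_right[OF this, of "1 / (of_real pi * \<i>)"]
    have a: "((\<lambda>t. of_real (g (w + of_real r * uc t)) * 2 * (uc t / (uc t - \<zeta>))) has_integral I z / (of_real pi * \<i>)) {0..1}"
      by (simp add: field_simps)
    have "((\<lambda>t. g (w + of_real r * uc t)) has_integral circ_mean g w r) {0..1}"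
      unfolding circ_mean_def
      by (intro integrable_integral integrable_continuous_interval continuous_on_circle g) (use r in auto)
    from has_integral_linear[OF this bounded_linear_of_real]
    have b: "((\<lambda>t. complex_of_real (g (w + of_real r * uc t))) has_integral of_real (circ_mean g w r)) {0..1}"
      by (simp add: o_def)
    have "((\<lambda>t. of_real (g (w + of_real r * uc t)) * ((uc t + \<zeta>) / (uc t - \<zeta>))) has_integral h z) {0..1}"
      unfolding h_def using has_integral_diff[OF a b] 
      by (rule has_integral_eq[rotated]) (use nz in \<open>simp add: field_simps\<close>)
    from has_integral_linear[OF this bounded_linear_Re]
    have "((\<lambda>t. g (w + of_real r * uc t) * Re ((uc t + \<zeta>) / (uc t - \<zeta>))) has_integral Re (h z)) {0..1}"
      by (simp add: o_def times_divide_eq_right[symmetric] del: times_divide_eq_right)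
    then show ?thesis
      by (simp add: poisson_def \<zeta>_def[symmetric] poisson_kernel_Re integral_unique)
  qed
  show ?thesis using that 1 2 by blast
qed

text \<open>The kernel is an approximate identity: as z tends to a boundary point x, its mass away
  from x is O(dist z x), because 1 - |\<zeta>|^2 is at most (2 / r) * dist z x while |e - \<zeta>|
  stays bounded below there.\<close>

lemma poisson_continuous_cball:
  assumes g: "continuous_on (sphere w r) g" and r: "0 < r"
  shows "continuous_on (cball w r) (\<lambda>z. if z \<in> ball w r then poisson g w r z else g z)"
    (is "continuous_on _ ?f")
proof (unfold continuous_on_iff, intro ballI allI impI)
  fix x e assume x: "x \<in> cball w r" and e: "(0::real) < e"
  obtain h where h: "h holomorphic_on ball w r" "\<And>z. z \<in> ball w r \<Longrightarrow> poisson g w r z = Re (h z)"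
    using poisson_holomorphic[OF g r] by blast
  show "\<exists>d>0. \<forall>x'\<in>cball w r. dist x' x < d \<longrightarrow> dist (?f x') (?f x) < e"
  proof (cases "x \<in> ball w r")
    case True
    have "continuous_on (ball w r) (\<lambda>z. Re (h z))"
      by (intro continuous_intros holomorphic_on_imp_continuous_on h)
    then have "isCont (\<lambda>z. Re (h z)) x"
      using True by (simp add: continuous_on_eq_continuous_at)
    then obtain d where d: "d > 0" "\<And>x'. dist x' x < d \<Longrightarrow> dist (Re (h x')) (Re (h x)) < e"
      using e unfolding continuous_at_eps_delta by blast
    obtain d' where d': "d' > 0" "ball x d' \<subseteq> ball w r"
      using True open_contains_ball open_ball by metis
    show ?thesis
    proof (intro exI conjI ballI impI)
      show "min d d' > 0" using d d' by simp
      fix x' assume "dist x' x < min d d'"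
      then have "x' \<in> ball w r" "dist x' x < d" using d' by (auto simp: dist_commute subset_eq)
      then show "dist (?f x') (?f x) < e" using True d(2) h(2) by simp
    qed
  next
    case False
    with x have xs: "x \<in> sphere w r" by auto
    have "bounded (g ` sphere w r)"
      by (intro compact_imp_bounded compact_continuous_image g) auto
    then obtain M where M: "M > 0" "\<And>y. y \<in> sphere w r \<Longrightarrow> \<bar>g y\<bar> \<le> M"
      unfolding bounded_pos by auto
    obtain d where d: "d > 0" "\<And>y. y \<in> sphere w r \<Longrightarrow> dist y x < d \<Longrightarrow> dist (g y) (g x) < e / 2"
      using g xs e unfolding continuous_on_iff by (meson half_gt_zero)
    \<comment> \<open>Product of the oscillation bound 2 * M, the inverse square of the lower bound
      d / (2 * r) for |e - \<zeta>|, and the factor 2 / r from \<open>ker\<close>.\<close>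
    define C where "C = 2 * M * (2 * r / d)\<^sup>2 * (2 / r)"
    have C: "C > 0" unfolding C_def using M d r by simp
    define \<eta> where "\<eta> = min (d / 2) (e / (2 * C))"
    have \<eta>: "\<eta> > 0" unfolding \<eta>_def using C d e by simp
    have main: "dist (poisson g w r z) (g x) < e" if z: "z \<in> ball w r" "dist z x < \<eta>" for z
    proof -
      define \<zeta> where "\<zeta> = (z - w) / of_real r"
      have \<zeta>: "cmod \<zeta> < 1" unfolding \<zeta>_def by (rule norm_scaled_less[OF z(1)])
      have z_eq: "z = w + of_real r * \<zeta>" using r by (simp add: \<zeta>_def)
      have int1: "(\<lambda>t. poisson_kernel \<zeta> (uc t)) integrable_on {0..1}"
        by (intro integrable_continuous_interval continuous_intros \<zeta>)
      have ker: "1 - (cmod \<zeta>)\<^sup>2 \<le> 2 / r * dist z x"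
      proof -
        have "r = cmod (x - w)" using xs by (simp add: dist_norm norm_minus_commute)
        also have "\<dots> \<le> cmod (x - z) + cmod (z - w)" 
          using norm_triangle_ineq[of "x - z" "z - w"] by simp
        finally have "(r - cmod (z - w)) / r \<le> dist z x / r"
          using r by (intro divide_right_mono) (auto simp: dist_norm norm_minus_commute)
        moreover have "cmod \<zeta> = cmod (z - w) / r"
          unfolding \<zeta>_def norm_divide using r by simp
        ultimately have "1 - cmod \<zeta> \<le> dist z x / r"
          using r by (simp add: diff_divide_distrib)
        moreover have "1 - (cmod \<zeta>)\<^sup>2 \<le> 2 * (1 - cmod \<zeta>)"
          using sum_power2_ge_zero[of "1 - cmod \<zeta>" 0] by (simp add: power2_eq_square algebra_simps)
        ultimately show ?thesis by simp
      qed
      have pt: "\<bar>(g (w + of_real r * uc t) - g x) * poisson_kernel \<zeta> (uc t)\<bar> \<le> e / 2 * poisson_kernel \<zeta> (uc t) + C * dist z x" for t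
      proof (cases "dist (w + of_real r * uc t) x < d")
        case True
        then have "\<bar>g (w + of_real r * uc t) - g x\<bar> \<le> e / 2"
          using d(2)[OF uc_sphere] r by (force simp: dist_real_def)
        then have "\<bar>g (w + of_real r * uc t) - g x\<bar> * poisson_kernel \<zeta> (uc t) \<le> e / 2 * poisson_kernel \<zeta> (uc t)"
          using \<zeta> by (intro mult_right_mono poisson_kernel_nonneg) auto
        moreover have "0 \<le> C * dist z x" using C by simp
        ultimately show ?thesis using \<zeta> by (simp add: abs_mult poisson_kernel_nonneg)
      next
        case False
        have "d \<le> dist (w + of_real r * uc t) z + dist z x"
          using False dist_triangle[of "w + of_real r * uc t" x z] by linarith
        then have "d / 2 \<le> cmod (of_real r * (uc t - \<zeta>))"
          using z(2) by (simp add: \<eta>_def dist_norm z_eq algebra_simps)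
        then have "d / (2 * r) \<le> cmod (uc t - \<zeta>)"
          using r by (simp only: norm_mult norm_of_real abs_of_pos[OF r]) (simp add: field_simps)
        then have "(d / (2 * r))\<^sup>2 \<le> (cmod (uc t - \<zeta>))\<^sup>2"
          using d r by (intro power_mono) auto
        then have "poisson_kernel \<zeta> (uc t) \<le> (2 / r * dist z x) / (d / (2 * r))\<^sup>2"
          unfolding poisson_kernel_def using ker d r \<zeta>
          by (intro frac_le) (auto simp: power_le_one)
        moreover have "\<bar>g (w + of_real r * uc t) - g x\<bar> \<le> 2 * M"
          using M(2)[OF uc_sphere, of t] M(2)[OF xs] r by linarith
        ultimately have "\<bar>g (w + of_real r * uc t) - g x\<bar> * poisson_kernel \<zeta> (uc t) \<le> 2 * M * ((2 / r * dist z x) / (d / (2 * r))\<^sup>2)"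
          using M \<zeta> by (intro mult_mono poisson_kernel_nonneg) auto
        also have "\<dots> = C * dist z x"
          unfolding C_def using r d by (simp add: power_divide field_simps)
        finally have "\<bar>g (w + of_real r * uc t) - g x\<bar> * poisson_kernel \<zeta> (uc t) \<le> C * dist z x" .
        moreover have "0 \<le> e / 2 * poisson_kernel \<zeta> (uc t)" using e \<zeta> by (simp add: poisson_kernel_nonneg)
        ultimately show ?thesis using \<zeta> by (simp add: abs_mult poisson_kernel_nonneg)
      qed
      have "poisson g w r z - g x = integral {0..1} (\<lambda>t. (g (w + of_real r * uc t) - g x) * poisson_kernel \<zeta> (uc t))"
      proof -
        have "integral {0..1} (\<lambda>t. (g (w + of_real r * uc t) - g x) * poisson_kernel \<zeta> (uc t)) =
          integral {0..1} (\<lambda>t. g (w + of_real r * uc t) * poisson_kernel \<zeta> (uc t)) - integral {0..1} (\<lambda>t. g x * poisson_kernel \<zeta> (uc t))"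
          unfolding left_diff_distrib
          using poisson_integrable[OF g z(1)] int1 by (intro integral_diff integrable_on_mult_right) (auto simp: \<zeta>_def)
        then show ?thesis using integral_poisson_kernel[OF \<zeta>] by (simp add: poisson_def \<zeta>_def)
      qed
      also have "\<bar>\<dots>\<bar> \<le> integral {0..1} (\<lambda>t. e / 2 * poisson_kernel \<zeta> (uc t) + C * dist z x)"
        unfolding real_norm_def[symmetric]
      proof (rule integral_norm_bound_integral)
        show "(\<lambda>t. (g (w + of_real r * uc t) - g x) * poisson_kernel \<zeta> (uc t)) integrable_on {0..1}"
          by (intro integrable_continuous_interval continuous_intros \<zeta> continuous_on_circle g less_imp_le[OF r])
        show "(\<lambda>t. e / 2 * poisson_kernel \<zeta> (uc t) + C * dist z x) integrable_on {0..1}"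
          by (intro integrable_continuous_interval continuous_intros \<zeta>)
      qed (use pt in auto)
      also have "\<dots> = e / 2 + C * dist z x"
        using integral_poisson_kernel[OF \<zeta>] int1 by (subst integral_add) (auto intro: integrable_on_mult_right)
      also have "\<dots> < e"
      proof -
        have "C * dist z x < C * (e / (2 * C))"
          using z(2) C by (intro mult_strict_left_mono) (auto simp: \<eta>_def)
        then show ?thesis using C by simp
      qed
      finally show ?thesis by (simp add: dist_real_def)
    qed
    show ?thesis
    proof (intro exI conjI ballI impI)
      show "\<eta> > 0" by fact
      fix x' assume x': "x' \<in> cball w r" "dist x' x < \<eta>"
      show "dist (?f x') (?f x) < e"
      proof (cases "x' \<in> ball w r")
        case True then show ?thesis using main x' False by simp
      next
        case F: False
        then have "x' \<in> sphere w r" "dist x' x < d" using x' d(1) by (auto simp: \<eta>_def)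
        then show ?thesis using d(2)[of x'] F False e by simp
      qed
    qed
  qed
qed

section \<open>Mean values and harmonic functions\<close>

lemma circ_mean_integrable:
  "continuous_on (sphere z r) u \<Longrightarrow> 0 \<le> r \<Longrightarrow> (\<lambda>t. u (z + of_real r * uc t)) integrable_on {0..1}"
  for u :: "complex \<Rightarrow> real"
  by (intro integrable_continuous_interval continuous_on_circle)

lemma poisson_center: "0 < r \<Longrightarrow> poisson g w r w = circ_mean g w r"
  by (simp add: poisson_def circ_mean_def)

definition submean :: "(complex \<Rightarrow> real) \<Rightarrow> complex set \<Rightarrow> bool" where
  "submean u S \<longleftrightarrow> (\<forall>z\<in>S. \<exists>e>0. \<forall>r. 0 < r \<and> r < e \<longrightarrow> u z \<le> circ_mean u z r)"

text \<open>The Poisson formula on all closed disks inside S, rather than derivatives: it passes to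
  uniform limits, contains the mean value property as the case z = w, and gives Harnack's inequality
  by bounding the kernel.\<close>

definition harm :: "(complex \<Rightarrow> real) \<Rightarrow> complex set \<Rightarrow> bool" where
  "harm u S \<longleftrightarrow> continuous_on S u \<and>
     (\<forall>w r. 0 < r \<and> cball w r \<subseteq> S \<longrightarrow> (\<forall>z\<in>ball w r. u z = poisson u w r z))"

lemma sphere_subset_cball: "sphere z r \<subseteq> cball z r" for z :: complex
  by auto

lemma submean_subset: "submean u S \<Longrightarrow> T \<subseteq> S \<Longrightarrow> submean u T"
  unfolding submean_def by blast

text \<open>The set K of maximum points is compact. At its point z of largest real part, the mean
  inequality on a small circle can only be an equality, so z + r is a maximum point as well; but it
  lies further to the right.\<close>

lemma submean_max_principle:
  assumes S: "open S" "bounded S" and cont: "continuous_on (closure S) u" and sub: "submean u S"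
    and bd: "\<And>x. x \<in> frontier S \<Longrightarrow> u x \<le> M" and x: "x \<in> closure S"
  shows "u x \<le> M"
proof (rule ccontr)
  assume gt: "\<not> u x \<le> M"
  have comp: "compact (closure S)" using S by simp
  have "\<exists>m\<in>closure S. \<forall>y\<in>closure S. u y \<le> u m"
    using x by (intro continuous_attains_sup[OF comp _ cont]) auto
  then obtain m where m: "m \<in> closure S" "\<And>y. y \<in> closure S \<Longrightarrow> u y \<le> u m" by blast
  define K where "K = {y \<in> closure S. u y = u m}"
  have "closed K" unfolding K_def by (rule continuous_closed_preimage_constant[OF cont closed_closure])
  then have "compact (closure S \<inter> K)" using comp by (rule compact_Int_closed[rotated])
  moreover have "closure S \<inter> K = K" by (auto simp: K_def)
  ultimately have "compact K" by simp
  moreover have "K \<noteq> {}" using m(1) by (auto simp: K_def)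
  moreover have "continuous_on K Re" by (intro continuous_intros)
  ultimately have "\<exists>z\<in>K. \<forall>y\<in>K. Re y \<le> Re z" by (rule continuous_attains_sup)
  then obtain z where z: "z \<in> K" "\<And>y. y \<in> K \<Longrightarrow> Re y \<le> Re z" by blast
  have zc: "z \<in> closure S" and zm: "u z = u m" using z(1) by (simp_all add: K_def)
  have "u z > M" using zm m(2)[OF x] gt by linarith
  then have "z \<notin> frontier S" using bd[of z] by linarith
  then have "z \<in> S" using zc S(1) by (simp add: frontier_def interior_open)
  obtain e where e: "e > 0" "\<And>r. 0 < r \<Longrightarrow> r < e \<Longrightarrow> u z \<le> circ_mean u z r"
    using sub \<open>z \<in> S\<close> unfolding submean_def by blast
  obtain d where d: "d > 0" "cball z d \<subseteq> S"
    using S(1) \<open>z \<in> S\<close> open_contains_cball_eq by blast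
  define r where "r = min (e / 2) d"
  have r: "0 < r" "r < e" "r \<le> d" using d e by (auto simp: r_def)
  have "sphere z r \<subseteq> cball z d" using r by auto
  then have sph: "sphere z r \<subseteq> closure S"
    using d(2) closure_subset[of S] by (meson order_trans)
  have cu: "continuous_on (sphere z r) u" by (rule continuous_on_subset[OF cont sph])
  let ?f = "\<lambda>t. u m - u (z + of_real r * uc t)"
  have cf: "continuous_on {0..1} ?f"
    by (intro continuous_intros continuous_on_circle cu) (use r in auto)
  have nn: "?f t \<ge> 0" for t
    using m(2)[OF subsetD[OF sph uc_sphere[of r z t]]] r by simp
  have "integral {0..1} ?f = u m - circ_mean u z r"
    using circ_mean_integrable[OF cu] r by (subst integral_diff) (auto simp: circ_mean_def)
  also have "\<dots> \<le> 0" using e(2)[OF r(1,2)] zm by simp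
  finally have "integral {0..1} ?f = 0"
    using integral_nonneg[OF integrable_continuous_interval[OF cf] nn] by linarith
  \<comment> \<open>A continuous nonnegative function with integral 0 vanishes on [0,1]; t = 0 is
    the rightmost point of the circle.\<close>
  then have "?f 0 = 0"
    using integral_eq_0_iff[OF cf _ nn] by (meson atLeastAtMost_iff order_refl zero_less_one zero_le_one)
  then have "z + of_real r \<in> K"
    using subsetD[OF sph uc_sphere[of r z 0]] r by (simp add: K_def)
  from z(2)[OF this] show False using r(1) by simp
qed

text \<open>The Poisson integral p of u has the exact mean value property inside the disk and agrees
  with u on the circle, so the maximum principle applies to u - p.\<close>

lemma submean_le_poisson:
  assumes u: "continuous_on (cball w r) u" "submean u (ball w r)" and z: "z \<in> ball w r"
  shows "u z \<le> poisson u w r z"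
proof -
  have r: "r > 0" using le_less_trans[OF zero_le_dist, of w z r] z by simp
  have cs: "continuous_on (sphere w r) u"
    by (rule continuous_on_subset[OF u(1)]) auto
  define p where "p z = (if z \<in> ball w r then poisson u w r z else u z)" for z
  have cp: "continuous_on (cball w r) p"
    unfolding p_def by (rule poisson_continuous_cball[OF cs r])
  obtain h where h: "h holomorphic_on ball w r" "\<And>z. z \<in> ball w r \<Longrightarrow> poisson u w r z = Re (h z)"
    using poisson_holomorphic[OF cs r] by blast
  have "submean (\<lambda>z. u z - p z) (ball w r)"
    unfolding submean_def
  proof
    fix y assume y: "y \<in> ball w r"
    obtain e where e: "e > 0" "\<And>r. 0 < r \<Longrightarrow> r < e \<Longrightarrow> u y \<le> circ_mean u y r"
      using u(2) y unfolding submean_def by blast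
    obtain d where d: "d > 0" "cball y d \<subseteq> ball w r"
      using y open_contains_cball open_ball by blast
    show "\<exists>e>0. \<forall>s. 0 < s \<and> s < e \<longrightarrow> u y - p y \<le> circ_mean (\<lambda>z. u z - p z) y s"
    proof (intro exI conjI allI impI)
      show "min d e > 0" using d e by simp
      fix s assume s: "0 < s \<and> s < min d e"
      have sub: "cball y s \<subseteq> ball w r" using d s by (meson less_imp_le min_less_iff_conj order_trans subset_cball)
      have "p y = Re (h y)" using y h by (simp add: p_def)
      also have "\<dots> = circ_mean (\<lambda>x. Re (h x)) y s"
        using s sub by (intro circ_mean_Re[symmetric] holomorphic_on_imp_continuous_on)
          (auto intro: holomorphic_on_subset[OF h(1)] simp: subset_eq)
      also have "\<dots> = circ_mean p y s"
      proof -
        have "y + of_real s * uc t \<in> ball w r" for t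
          using uc_sphere[of s y t] s sub sphere_subset_cball by fastforce
        then show ?thesis unfolding circ_mean_def p_def by (simp add: h(2))
      qed
      finally have *: "p y = circ_mean p y s" .
      have "sphere y s \<subseteq> cball w r"
        using sub sphere_subset_cball[of y s] ball_subset_cball[of w r] by (meson order_trans)
      then have cys: "continuous_on (sphere y s) u" "continuous_on (sphere y s) p"
        using continuous_on_subset u(1) cp by blast+
      have "circ_mean (\<lambda>z. u z - p z) y s = circ_mean u y s - circ_mean p y s"
        unfolding circ_mean_def using cys s by (intro integral_diff circ_mean_integrable) auto
      then show "u y - p y \<le> circ_mean (\<lambda>z. u z - p z) y s"
        using * e(2)[of s] s by simp
    qed
  qed
  then have "u z - p z \<le> 0"
    by (rule submean_max_principle[rotated 3])
       (use r z u(1) cp in \<open>auto intro!: continuous_intros simp: p_def\<close>)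
  then show ?thesis using z by (simp add: p_def)
qed

section \<open>Stability of harmonic functions under algebraic operations, localisation and
  limits\<close>

lemma poisson_minus: "poisson (\<lambda>x. - f x) w r z = - poisson f w r z"
  using poisson_cmult[of "-1" f w r z] by simp

lemma circ_mean_minus: "circ_mean (\<lambda>x. - f x) w r = - circ_mean f w r"
  unfolding circ_mean_def by simp

text \<open>Comparing u and -u with their Poisson integrals traps u between two equal bounds, so
  mean inequalities on small circles imply the Poisson formula on every closed disk in S.\<close>

lemma harmI:
  assumes "continuous_on S u" "submean u S" "submean (\<lambda>x. - u x) S"
  shows "harm u S"
  unfolding harm_def
proof (intro conjI allI impI ballI)
  fix w r z assume *: "0 < r \<and> cball w r \<subseteq> S" "z \<in> ball w r"
  have sub: "ball w r \<subseteq> S" using * ball_subset_cball by blast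
  have c: "continuous_on (cball w r) u" using * assms(1) continuous_on_subset by blast
  show "u z = poisson u w r z"
    using submean_le_poisson[OF c submean_subset[OF assms(2) sub] *(2)]
      submean_le_poisson[OF continuous_on_minus[OF c] submean_subset[OF assms(3) sub] *(2)]
    by (simp add: poisson_minus)
qed fact

lemma harm_poisson_eq:
  "harm u S \<Longrightarrow> cball w r \<subseteq> S \<Longrightarrow> 0 < r \<Longrightarrow> z \<in> ball w r \<Longrightarrow> u z = poisson u w r z"
  unfolding harm_def by blast

lemma harm_circ_mean:
  assumes "harm u S" "cball z r \<subseteq> S" "0 < r"
  shows "circ_mean u z r = u z"
  using harm_poisson_eq[OF assms, of z] poisson_center[of r u z] assms(3) by simp

lemma harm_submean:
  assumes "harm u S" "open S"
  shows "submean u S" "submean (\<lambda>x. - u x) S"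
proof -
  have ex: "\<exists>e>0. \<forall>r. 0 < r \<and> r < e \<longrightarrow> circ_mean u z r = u z" if "z \<in> S" for z
  proof -
    obtain e where e: "e > 0" "cball z e \<subseteq> S" using assms(2) \<open>z \<in> S\<close> open_contains_cball by blast
    have "circ_mean u z r = u z" if "0 < r" "r < e" for r
      using e that by (intro harm_circ_mean[OF assms(1)]) (auto simp: subset_eq)
    then show ?thesis using e(1) by blast
  qed
  show "submean u S"
    unfolding submean_def
  proof
    fix z assume "z \<in> S"
    from ex[OF this] obtain e where "e > 0" "\<forall>r. 0 < r \<and> r < e \<longrightarrow> circ_mean u z r = u z" by blast
    then show "\<exists>e>0. \<forall>r. 0 < r \<and> r < e \<longrightarrow> u z \<le> circ_mean u z r" by (intro exI[of _ e]) simp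
  qed
  show "submean (\<lambda>x. - u x) S"
    unfolding submean_def
  proof
    fix z assume "z \<in> S"
    from ex[OF this] obtain e where "e > 0" "\<forall>r. 0 < r \<and> r < e \<longrightarrow> circ_mean u z r = u z" by blast
    then show "\<exists>e>0. \<forall>r. 0 < r \<and> r < e \<longrightarrow> - u z \<le> circ_mean (\<lambda>x. - u x) z r" 
      by (intro exI[of _ e]) (simp add: circ_mean_minus)
  qed
qed

lemma harm_subset: "harm u S \<Longrightarrow> T \<subseteq> S \<Longrightarrow> harm u T"
  unfolding harm_def using continuous_on_subset by blast

lemma harm_continuous: "harm u S \<Longrightarrow> continuous_on S u"
  by (simp add: harm_def)

lemma harm_const: "harm (\<lambda>x. c) S"
  unfolding harm_def by (simp add: poisson_const)

lemma harm_add: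
  assumes u: "harm u S" and v: "harm v S"
  shows "harm (\<lambda>x. u x + v x) S"
  unfolding harm_def
proof (intro conjI allI impI ballI)
  show "continuous_on S (\<lambda>x. u x + v x)"
    using u v by (intro continuous_intros harm_continuous)
  fix w r z assume *: "0 < r \<and> cball w r \<subseteq> S" "z \<in> ball w r"
  then have "sphere w r \<subseteq> S" using sphere_subset_cball[of w r] by blast
  then have "continuous_on (sphere w r) u" "continuous_on (sphere w r) v"
    using u v harm_continuous continuous_on_subset by blast+
  then have "poisson (\<lambda>x. u x + v x) w r z = poisson u w r z + poisson v w r z"
    using *(2) by (rule poisson_add)
  then show "u z + v z = poisson (\<lambda>x. u x + v x) w r z"
    using harm_poisson_eq[OF u, of w r z] harm_poisson_eq[OF v, of w r z] * by simp
qed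

lemma harm_cmult:
  assumes "harm u S"
  shows "harm (\<lambda>x. c * u x) S"
  unfolding harm_def
proof (intro conjI allI impI ballI)
  show "continuous_on S (\<lambda>x. c * u x)"
    using assms by (intro continuous_intros harm_continuous)
  show "c * u z = poisson (\<lambda>x. c * u x) w r z" if "0 < r \<and> cball w r \<subseteq> S" "z \<in> ball w r" for w r z
    using that harm_poisson_eq[OF assms, of w r z] unfolding poisson_cmult by simp
qed

lemma harm_minus: "harm u S \<Longrightarrow> harm (\<lambda>x. - u x) S"
  using harm_cmult[of u S "-1"] by simp

lemma harm_diff: "harm u S \<Longrightarrow> harm v S \<Longrightarrow> harm (\<lambda>x. u x - v x) S"
  using harm_add[OF _ harm_minus, of u S v] by simp

lemma harm_sum: "finite I \<Longrightarrow> (\<And>i. i \<in> I \<Longrightarrow> harm (f i) S) \<Longrightarrow> harm (\<lambda>x. \<Sum>i\<in>I. f i x) S"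
  by (induction I rule: finite_induct) (simp_all add: harm_const harm_add)

lemma harm_cong:
  assumes "harm u S" "\<And>x. x \<in> S \<Longrightarrow> v x = u x"
  shows "harm v S"
  unfolding harm_def
proof (intro conjI allI impI ballI)
  show "continuous_on S v"
    by (rule continuous_on_eq[OF harm_continuous[OF assms(1)]]) (simp add: assms(2))
  fix w r z assume *: "0 < r \<and> cball w r \<subseteq> S" "z \<in> ball w r"
  then have "poisson v w r z = poisson u w r z"
    using sphere_subset_cball[of w r] by (intro poisson_cong assms(2)) auto
  moreover have "z \<in> S" using * ball_subset_cball[of w r] by blast
  ultimately show "v z = poisson v w r z"
    using harm_poisson_eq[OF assms(1), of w r z] assms(2)[of z] * by simp
qed

text \<open>\<open>harm\<close> speaks of disks of any size and is not visibly local;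
  \<open>submean\<close> is, so the proof passes through \<open>harmI\<close>.\<close>

lemma harm_localI:
  assumes "\<And>z. z \<in> S \<Longrightarrow> \<exists>e>0. harm u (ball z e)"
  shows "harm u S"
proof (rule harmI)
  show "continuous_on S u"
    unfolding continuous_on_eq_continuous_within
  proof
    fix z assume "z \<in> S"
    then obtain e where "e > 0" "harm u (ball z e)" using assms by blast
    then have "isCont u z" 
      using continuous_on_eq_continuous_at[of "ball z e" u] by (auto dest: harm_continuous)
    then show "continuous (at z within S) u" by (rule continuous_at_imp_continuous_at_within)
  qed
  have "\<exists>e>0. submean u (ball z e) \<and> submean (\<lambda>x. - u x) (ball z e)" if "z \<in> S" for z
    using assms[OF that] harm_submean[OF _ open_ball] by blast
  then show "submean u S" "submean (\<lambda>x. - u x) S"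
    unfolding submean_def by (meson centre_in_ball)+
qed

text \<open>An error of at most e in the boundary values changes a Poisson integral by at most e, so
  both sides of the formula converge.\<close>

lemma harm_uniform_limit:
  assumes f: "\<And>n. harm (f n) S" and lim: "uniform_limit S f u sequentially"
  shows "harm u S"
  unfolding harm_def
proof (intro conjI allI impI ballI)
  show cont: "continuous_on S u"
    by (rule uniform_limit_theorem[OF _ lim]) (use f harm_continuous in auto)
  fix w r z assume *: "0 < r \<and> cball w r \<subseteq> S" "z \<in> ball w r"
  then have sub: "sphere w r \<subseteq> S" "z \<in> S" using sphere_subset_cball[of w r] ball_subset_cball[of w r] by auto
  have "\<bar>u z - poisson u w r z\<bar> \<le> 0 + e" if "e > 0" for e
  proof -
    have "\<forall>\<^sub>F n in sequentially. \<forall>x\<in>S. dist (f n x) (u x) < e / 2"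
      using uniform_limitD[OF lim, of "e / 2"] that by simp
    then obtain n where n: "\<And>x. x \<in> S \<Longrightarrow> \<bar>f n x - u x\<bar> < e / 2"
      unfolding eventually_sequentially dist_real_def by blast
    have "\<bar>poisson (f n) w r z - poisson u w r z\<bar> \<le> e / 2"
    proof (rule poisson_diff_bound)
      show "continuous_on (sphere w r) (f n)" "continuous_on (sphere w r) u"
        using continuous_on_subset[OF cont sub(1)] continuous_on_subset[OF harm_continuous[OF f] sub(1)] by auto
      show "\<bar>f n x - u x\<bar> \<le> e / 2" if "x \<in> sphere w r" for x
        using n[OF subsetD[OF sub(1) that]] by simp
    qed fact
    moreover have "f n z = poisson (f n) w r z"
      using f[of n] * unfolding harm_def by blast
    ultimately show ?thesis using n[OF sub(2)] by linarith
  qed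
  then have "\<bar>u z - poisson u w r z\<bar> \<le> 0" by (rule field_le_epsilon)
  then show "u z = poisson u w r z" by simp
qed

lemma harm_Re:
  assumes "h holomorphic_on S" "open S"
  shows "harm (\<lambda>z. Re (h z)) S"
  unfolding harm_def
proof (intro conjI allI impI ballI)
  show c: "continuous_on S (\<lambda>z. Re (h z))"
    by (intro continuous_intros holomorphic_on_imp_continuous_on assms)
  have m: "submean (\<lambda>z. a * Re (h z)) S" for a
    unfolding submean_def
  proof
    fix z assume "z \<in> S"
    then obtain e where e: "e > 0" "cball z e \<subseteq> S" using assms(2) open_contains_cball by blast
    have "circ_mean (\<lambda>z. a * Re (h z)) z r = a * Re (h z)" if "0 < r" "r < e" for r
    proof -
      have "cball z r \<subseteq> S" "ball z r \<subseteq> S" using e that by (auto simp: subset_eq)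
      then have "circ_mean (\<lambda>x. Re (of_real a * h x)) z r = Re (of_real a * h z)"
        using that by (intro circ_mean_Re holomorphic_on_imp_continuous_on holomorphic_intros
            holomorphic_on_subset[OF assms(1)])
      then show ?thesis by simp
    qed
    then show "\<exists>e>0. \<forall>r. 0 < r \<and> r < e \<longrightarrow> a * Re (h z) \<le> circ_mean (\<lambda>z. a * Re (h z)) z r"
      using e(1) by (intro exI[of _ e]) simp
  qed
  have "harm (\<lambda>z. Re (h z)) S"
    by (rule harmI[OF c]) (use m[of 1] m[of "-1"] in simp_all)
  then show "Re (h z) = poisson (\<lambda>z. Re (h z)) w r z" if "0 < r \<and> cball w r \<subseteq> S" "z \<in> ball w r" for w r z
    using that unfolding harm_def by blast
qed

lemma harm_poisson:
  assumes "continuous_on (sphere w r) g" "0 < r"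
  shows "harm (poisson g w r) (ball w r)"
proof -
  obtain h where "h holomorphic_on ball w r" "\<And>z. z \<in> ball w r \<Longrightarrow> poisson g w r z = Re (h z)"
    using poisson_holomorphic[OF assms] by blast
  then show ?thesis using harm_cong[OF harm_Re[OF _ open_ball]] by blast
qed

text \<open>On a ball, which is contractible, h = exp g with g holomorphic, and ln |h| is Re
  g.\<close>

lemma harm_ln_norm:
  assumes "h holomorphic_on S" "open S" "\<And>z. z \<in> S \<Longrightarrow> h z \<noteq> 0"
  shows "harm (\<lambda>z. ln (cmod (h z))) S"
proof (rule harm_localI)
  fix z assume "z \<in> S"
  then obtain e where e: "e > 0" "ball z e \<subseteq> S" using assms(2) open_contains_ball by blast
  have h: "h holomorphic_on ball z e" using e assms(1) holomorphic_on_subset by blast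
  have nz: "h w \<noteq> 0" if "w \<in> ball z e" for w using e assms(3) that by blast
  have "\<exists>g. g holomorphic_on ball z e \<and> (\<forall>w\<in>ball z e. h w = exp (g w))"
  proof (rule contractible_imp_holomorphic_log[OF h convex_imp_contractible[OF convex_ball]])
    show "h w \<noteq> 0" if "w \<in> ball z e" for w using nz that .
  qed blast
  then obtain g where g: "g holomorphic_on ball z e" "\<And>w. w \<in> ball z e \<Longrightarrow> h w = exp (g w)" by blast
  have "harm (\<lambda>z. ln (cmod (h z))) (ball z e)"
    by (rule harm_cong[OF harm_Re[OF g(1) open_ball]]) (simp add: g(2))
  then show "\<exists>e>0. harm (\<lambda>z. ln (cmod (h z))) (ball z e)" using e by blast
qed

text \<open>For |\<zeta>| <= 1/2 the kernel lies between (1 - a) / (1 + a) and its reciprocal with a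
  = 1/2, that is, between 1/3 and 3.\<close>

lemma harnack_half:
  assumes "harm u S" "cball z r \<subseteq> S" "0 < r" and nn: "\<And>x. x \<in> S \<Longrightarrow> 0 \<le> u x" and w: "cmod (w - z) \<le> r / 2"
  shows "u w \<le> 3 * u z" "u z \<le> 3 * u w"
proof -
  define \<zeta> where "\<zeta> = (w - z) / of_real r"
  have "cmod \<zeta> = cmod (w - z) / r" unfolding \<zeta>_def norm_divide using assms(3) by simp
  then have \<zeta>: "cmod \<zeta> \<le> 1 / 2" using w assms(3) by (simp add: divide_le_eq)
  have wb: "w \<in> ball z r" using w assms(3) by (simp add: dist_norm norm_minus_commute)
  have cu: "continuous_on (sphere z r) u"
    using assms(1,2) sphere_subset_cball harm_continuous continuous_on_subset by blast
  have uw: "u w = poisson u z r w" and uz: "u z = circ_mean u z r"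
    using harm_poisson_eq[OF assms(1-3) wb] harm_circ_mean[OF assms(1-3)] by simp_all
  have nn': "0 \<le> u (z + of_real r * uc t)" for t
    using assms(2,3) uc_sphere[of r z t] sphere_subset_cball[of z r] by (intro nn) auto
  have ker: "1 / 3 \<le> poisson_kernel \<zeta> (uc t)" "poisson_kernel \<zeta> (uc t) \<le> 3" for t
  proof -
    let ?a = "cmod \<zeta>" and ?b = "cmod (uc t - \<zeta>)"
    have b: "1 - ?a \<le> ?b" "?b \<le> 1 + ?a"
      using norm_triangle_ineq2[of "uc t" \<zeta>] norm_triangle_ineq4[of "uc t" \<zeta>] by auto
    have "?b\<^sup>2 \<le> (1 + ?a)\<^sup>2" "(1 - ?a)\<^sup>2 \<le> ?b\<^sup>2"
      using b \<zeta> by (auto intro!: power_mono)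
    moreover have e1: "3 * (1 - ?a)\<^sup>2 - (1 - ?a\<^sup>2) = 4 * ((1 - ?a) * (1 / 2 - ?a))"
      and e2: "3 * (1 - ?a\<^sup>2) - (1 + ?a)\<^sup>2 = 4 * ((1 + ?a) * (1 / 2 - ?a))"
      by (simp_all add: power2_eq_square field_simps)
    moreover have "(1 + ?a) * (1 / 2 - ?a) \<ge> 0" "(1 - ?a) * (1 / 2 - ?a) \<ge> 0"
      using \<zeta> by auto
    ultimately have "?b\<^sup>2 \<le> 3 * (1 - ?a\<^sup>2)" "1 - ?a\<^sup>2 \<le> 3 * ?b\<^sup>2"
      using e1 e2 by linarith+
    moreover have "?b\<^sup>2 > 0" using b \<zeta> by (intro zero_less_power) linarith
    ultimately show "1 / 3 \<le> poisson_kernel \<zeta> (uc t)" "poisson_kernel \<zeta> (uc t) \<le> 3"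
      unfolding poisson_kernel_def by (simp_all add: le_divide_eq divide_le_eq)
  qed
  have int: "(\<lambda>t. u (z + of_real r * uc t) * poisson_kernel \<zeta> (uc t)) integrable_on {0..1}"
    unfolding \<zeta>_def by (rule poisson_integrable[OF cu wb])
  have int2: "(\<lambda>t. c * u (z + of_real r * uc t)) integrable_on {0..1}" for c
    by (intro integrable_on_mult_right circ_mean_integrable cu) (use assms(3) in auto)
  have "u w \<le> integral {0..1} (\<lambda>t. 3 * u (z + of_real r * uc t))"
    unfolding uw poisson_def \<zeta>_def[symmetric]
    by (rule integral_le[OF int int2]) (subst mult.commute, intro mult_right_mono ker nn')
  also have "\<dots> = 3 * u z" unfolding uz circ_mean_def by simp
  finally show "u w \<le> 3 * u z" .
  have "integral {0..1} (\<lambda>t. 1 / 3 * u (z + of_real r * uc t)) \<le> u w"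
    unfolding uw poisson_def \<zeta>_def[symmetric]
    by (rule integral_le[OF int2 int], subst (2) mult.commute) (intro mult_right_mono ker nn')
  also have "integral {0..1} (\<lambda>t. 1 / 3 * u (z + of_real r * uc t)) = 1 / 3 * u z" unfolding uz circ_mean_def by simp
  finally show "u z \<le> 3 * u w" by simp
qed

section \<open>Comparison with twice differentiable harmonic functions, and uniqueness of
  solutions\<close>

lemma harmonic_onI:
  assumes "open S"
    and "\<forall>z\<in>S. (u has_derivative (\<lambda>h. ux z * Re h + uy z * Im h)) (at z) \<and>
               (ux has_derivative (\<lambda>h. uxx z * Re h + uxy z * Im h)) (at z) \<and>
               (uy has_derivative (\<lambda>h. uyx z * Re h + uyy z * Im h)) (at z) \<and>
               uxx z + uyy z = 0"
    and "continuous_on S uxx" "continuous_on S uxy" "continuous_on S uyx" "continuous_on S uyy"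
  shows "harmonic_on u S"
  unfolding harmonic_on_def
  by (rule conjI[OF assms(1)], rule exI[of _ ux], rule exI[of _ uy], rule exI[of _ uxx],
      rule exI[of _ uxy], rule exI[of _ uyx], rule exI[of _ uyy], intro conjI assms(3-6) assms(2))

text \<open>Locally u = Re H, but the local H need not fit together. Their derivatives do, since H'
  = u_x - i u_y is determined by u. This gives a holomorphic g on all of S, and every partial
  derivative is read off from g and g'.\<close>

lemma harm_imp_harmonic_on:
  assumes u: "harm u S" and S: "open S"
  shows "harmonic_on u S"
proof -
  have "\<forall>z\<in>S. \<exists>p. 0 < fst p \<and> ball z (fst p) \<subseteq> S \<and> snd p holomorphic_on ball z (fst p) \<and>
    (\<forall>w\<in>ball z (fst p). u w = Re (snd p w))"
  proof
    fix z assume "z \<in> S"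
    then obtain r where r: "r > 0" "cball z r \<subseteq> S" using S open_contains_cball by blast
    have "sphere z r \<subseteq> S" and b: "ball z r \<subseteq> S" using r ball_subset_cball sphere_subset_cball by blast+
    then have "continuous_on (sphere z r) u"
      using continuous_on_subset[OF harm_continuous[OF u]] by blast
    then obtain h where h: "h holomorphic_on ball z r" "\<And>w. w \<in> ball z r \<Longrightarrow> poisson u z r w = Re (h w)"
      using poisson_holomorphic r(1) by blast
    have "u w = Re (h w)" if "w \<in> ball z r" for w
      using harm_poisson_eq[OF u r(2,1) that] h(2)[OF that] by simp
    then show "\<exists>p. 0 < fst p \<and> ball z (fst p) \<subseteq> S \<and> snd p holomorphic_on ball z (fst p) \<and>
      (\<forall>w\<in>ball z (fst p). u w = Re (snd p w))"
      using r(1) b h(1) by (intro exI[of _ "(r, h)"]) simp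
  qed
  from bchoice[OF this] obtain p where p: "\<forall>z\<in>S. 0 < fst (p z) \<and> ball z (fst (p z)) \<subseteq> S \<and>
    snd (p z) holomorphic_on ball z (fst (p z)) \<and> (\<forall>w\<in>ball z (fst (p z)). u w = Re (snd (p z) w))" ..
  define R H where "R z = fst (p z)" and "H z = snd (p z)" for z
  have RH: "0 < R z" "ball z (R z) \<subseteq> S" "H z holomorphic_on ball z (R z)"
      "\<And>w. w \<in> ball z (R z) \<Longrightarrow> u w = Re (H z w)" if "z \<in> S" for z
    using p that unfolding R_def H_def by blast+
  define g where "g z = deriv (H z) z" for z
  have du: "(u has_derivative (\<lambda>h. Re (deriv (H z) w * h))) (at w)" if "z \<in> S" "w \<in> ball z (R z)" for z w
  proof -
    have "(H z has_field_derivative deriv (H z) w) (at w)"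
      using RH(3) that holomorphic_derivI open_ball by blast
    then have "((\<lambda>w. Re (H z w)) has_derivative (\<lambda>h. Re (deriv (H z) w * h))) (at w)"
      unfolding has_field_derivative_def by (intro derivative_intros)
    then show ?thesis
      by (rule has_derivative_transform_within_open[OF _ open_ball that(2)]) (use RH(4) that in auto)
  qed
  \<comment> \<open>Both numbers encode the real derivative of u at w, which is unique; evaluating
    it at 1 and \<i> recovers them.\<close>
  have g_eq: "g w = deriv (H z) w" if "z \<in> S" "w \<in> ball z (R z)" for z w
  proof -
    have "w \<in> S" using that RH(2) by blast
    then have "w \<in> ball w (R w)" using RH(1) by simp
    have "(\<lambda>h. Re (deriv (H w) w * h)) = (\<lambda>h. Re (deriv (H z) w * h))"
      by (rule has_derivative_unique[OF du[OF \<open>w \<in> S\<close> \<open>w \<in> ball w (R w)\<close>] du[OF that]])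
    from fun_cong[OF this, of 1] fun_cong[OF this, of \<i>] show ?thesis
      by (simp add: g_def complex_eq_iff)
  qed
  have "g holomorphic_on S"
    unfolding holomorphic_on_open[OF S]
  proof
    fix z assume z: "z \<in> S"
    have "deriv (H z) holomorphic_on ball z (R z)"
      by (intro holomorphic_deriv RH(3) z open_ball)
    then have "(deriv (H z) has_field_derivative deriv (deriv (H z)) z) (at z)"
      using RH(1)[OF z] by (intro holomorphic_derivI[OF _ open_ball]) auto
    then have "(g has_field_derivative deriv (deriv (H z)) z) (at z)"
      by (rule has_field_derivative_transform_within_open[where S = "ball z (R z)"])
        (use g_eq[OF z] RH(1)[OF z] in auto)
    then show "\<exists>f'. (g has_field_derivative f') (at z)" by blast
  qed
  note g = this
  then have dg: "(g has_derivative (\<lambda>h. deriv g z * h)) (at z)" if "z \<in> S" for z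
    using holomorphic_derivI[OF g S that] by (simp add: has_field_derivative_def)
  have cg: "continuous_on S (deriv g)"
    using holomorphic_deriv[OF g S] holomorphic_on_imp_continuous_on by blast
  have "(u has_derivative (\<lambda>h. Re (g z) * Re h + (- Im (g z)) * Im h)) (at z)
     \<and> ((\<lambda>z. Re (g z)) has_derivative (\<lambda>h. Re (deriv g z) * Re h + (- Im (deriv g z)) * Im h)) (at z)
     \<and> ((\<lambda>z. - Im (g z)) has_derivative (\<lambda>h. (- Im (deriv g z)) * Re h + (- Re (deriv g z)) * Im h)) (at z)
     \<and> Re (deriv g z) + - Re (deriv g z) = 0" if z: "z \<in> S" for z
  proof (intro conjI)
    show "(u has_derivative (\<lambda>h. Re (g z) * Re h + (- Im (g z)) * Im h)) (at z)"
      using du[OF z, of z] RH(1)[OF z] by (simp add: g_def)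
    have "((\<lambda>z. Re (g z)) has_derivative (\<lambda>h. Re (deriv g z * h))) (at z)"
      by (intro derivative_intros dg z)
    then show "((\<lambda>z. Re (g z)) has_derivative (\<lambda>h. Re (deriv g z) * Re h + (- Im (deriv g z)) * Im h)) (at z)"
      by simp
    have "((\<lambda>z. - Im (g z)) has_derivative (\<lambda>h. - Im (deriv g z * h))) (at z)"
      by (intro derivative_intros dg z)
    then show "((\<lambda>z. - Im (g z)) has_derivative (\<lambda>h. (- Im (deriv g z)) * Re h + (- Re (deriv g z)) * Im h)) (at z)"
      by (simp add: algebra_simps)
  qed simp
  then show ?thesis
    by (intro harmonic_onI[of S u "\<lambda>z. Re (g z)" "\<lambda>z. - Im (g z)" "\<lambda>z. Re (deriv g z)" "\<lambda>z. - Im (deriv g z)"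
        "\<lambda>z. - Im (deriv g z)" "\<lambda>z. - Re (deriv g z)"] ballI S continuous_intros cg)
qed

text \<open>f1 vanishes at 0. If c were positive, f1 would be positive just to the right of 0, and
  the mean value theorem would make f exceed f 0 there.\<close>

lemma second_derivative_local_max:
  fixes f f1 :: "real \<Rightarrow> real"
  assumes "0 < d" and f: "\<And>t. \<bar>t\<bar> < d \<Longrightarrow> (f has_real_derivative f1 t) (at t)"
    and f1: "(f1 has_real_derivative c) (at 0)" and max: "\<And>t. \<bar>t\<bar> < d \<Longrightarrow> f t \<le> f 0"
  shows "c \<le> 0"
proof (rule ccontr)
  assume "\<not> c \<le> 0"
  have 0: "f1 0 = 0"
    by (rule DERIV_local_max[OF f[of 0] \<open>0 < d\<close>]) (use max \<open>0 < d\<close> in auto)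
  obtain e where e: "e > 0" "\<And>h. 0 < h \<Longrightarrow> h < e \<Longrightarrow> f1 0 < f1 (0 + h)"
    using DERIV_pos_inc_right[OF f1] \<open>\<not> c \<le> 0\<close> by auto
  define t where "t = min d e / 2"
  have t: "0 < t" "t < d" "t < e" using e \<open>0 < d\<close> by (auto simp: t_def)
  have "\<exists>s>0. s < t \<and> f t - f 0 = (t - 0) * f1 s"
    by (rule MVT2[OF t(1)]) (use f t in auto)
  then obtain s where s: "0 < s" "s < t" "f t - f 0 = (t - 0) * f1 s" by blast
  then have "f t - f 0 > 0" using e(2)[of s] 0 t by simp
  then show False using max[of t] t by simp
qed

lemma harmonic_onE:
  assumes "harmonic_on u S"
  obtains ux uy uxx uxy uyx uyy where "open S"
      "\<And>z. z \<in> S \<Longrightarrow> (u has_derivative (\<lambda>h. ux z * Re h + uy z * Im h)) (at z)"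
      "\<And>z. z \<in> S \<Longrightarrow> (ux has_derivative (\<lambda>h. uxx z * Re h + uxy z * Im h)) (at z)"
      "\<And>z. z \<in> S \<Longrightarrow> (uy has_derivative (\<lambda>h. uyx z * Re h + uyy z * Im h)) (at z)"
      "\<And>z. z \<in> S \<Longrightarrow> uxx z + uyy z = 0" "continuous_on S uxx" "continuous_on S uxy"
      "continuous_on S uyx" "continuous_on S uyy"
proof -
  from assms have "open S" by (simp add: harmonic_on_def)
  from assms obtain ux uy uxx uxy uyx uyy where
    1: "\<forall>z\<in>S. (u has_derivative (\<lambda>h. ux z * Re h + uy z * Im h)) (at z) \<and>
               (ux has_derivative (\<lambda>h. uxx z * Re h + uxy z * Im h)) (at z) \<and>
               (uy has_derivative (\<lambda>h. uyx z * Re h + uyy z * Im h)) (at z) \<and>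
               uxx z + uyy z = 0" and
    2: "continuous_on S uxx" "continuous_on S uxy" "continuous_on S uyx" "continuous_on S uyy"
    unfolding harmonic_on_def by (elim conjE exE)
  show ?thesis by (rule that[OF \<open>open S\<close> _ _ _ _ 2]) (use 1 in auto)
qed

text \<open>\<open>harmonic_on\<close> comes without a mean value property, so the proof goes
  through the Laplacian: adding \<epsilon> |y|^2 makes it 4 \<epsilon> > 0, which an interior
  maximum forbids. Its use is the uniqueness of \<open>dirichlet_solution\<close>.\<close>

lemma harmonic_on_max_principle:
  assumes S: "bounded S" and cont: "continuous_on (closure S) u" and harmonic: "harmonic_on u S"
    and bd: "\<And>x. x \<in> frontier S \<Longrightarrow> u x \<le> M" and x: "x \<in> closure S"
  shows "u x \<le> M"
proof (rule ccontr)
  assume gt: "\<not> u x \<le> M"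
  obtain ux uy uxx uxy uyx uyy where "open S" and d:
      "\<And>z. z \<in> S \<Longrightarrow> (u has_derivative (\<lambda>h. ux z * Re h + uy z * Im h)) (at z)"
      "\<And>z. z \<in> S \<Longrightarrow> (ux has_derivative (\<lambda>h. uxx z * Re h + uxy z * Im h)) (at z)"
      "\<And>z. z \<in> S \<Longrightarrow> (uy has_derivative (\<lambda>h. uyx z * Re h + uyy z * Im h)) (at z)"
      "\<And>z. z \<in> S \<Longrightarrow> uxx z + uyy z = 0"
    by (rule harmonic_onE[OF harmonic]) (rule that; assumption)
  have comp: "compact (closure S)" using S by simp
  obtain B where B: "B > 0" "\<And>y. y \<in> closure S \<Longrightarrow> cmod y \<le> B"
    using compact_imp_bounded[OF comp] unfolding bounded_pos by blast
  \<comment> \<open>With |y| <= B on the closure, the added term is at most (u x - M) / 2, so on the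
    frontier v still lies below u x.\<close>
  define \<epsilon> where "\<epsilon> = (u x - M) / (2 * B\<^sup>2)"
  have \<epsilon>: "\<epsilon> > 0" unfolding \<epsilon>_def using gt B by simp
  define v where "v y = u y + \<epsilon> * ((Re y)\<^sup>2 + (Im y)\<^sup>2)" for y
  have "continuous_on (closure S) v" unfolding v_def by (intro continuous_intros cont)
  then have "\<exists>m\<in>closure S. \<forall>y\<in>closure S. v y \<le> v m"
    using x by (intro continuous_attains_sup[OF comp]) auto
  then obtain m where m: "m \<in> closure S" "\<And>y. y \<in> closure S \<Longrightarrow> v y \<le> v m" by blast
  have "v y < u x" if "y \<in> frontier S" for y
  proof -
    have "y \<in> closure S" using that by (simp add: frontier_def)
    then have "(cmod y)\<^sup>2 \<le> B\<^sup>2" using B by (intro power_mono) auto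
    then have "\<epsilon> * ((Re y)\<^sup>2 + (Im y)\<^sup>2) \<le> \<epsilon> * B\<^sup>2"
      using \<epsilon> unfolding cmod_power2 by (intro mult_left_mono) auto
    also have "\<dots> = (u x - M) / 2" unfolding \<epsilon>_def using B by simp
    finally show ?thesis using bd[OF that] gt by (simp add: v_def field_simps)
  qed
  moreover have "u x \<le> v m"
  proof -
    have "0 \<le> \<epsilon> * ((Re x)\<^sup>2 + (Im x)\<^sup>2)" using \<epsilon> by simp
    then have "u x \<le> v x" unfolding v_def by linarith
    then show ?thesis using m(2)[OF x] by linarith
  qed
  ultimately have "m \<notin> frontier S" using leD by blast
  then have mS: "m \<in> S" using m(1) \<open>open S\<close> by (simp add: frontier_def interior_open)
  obtain e where e: "e > 0" "ball m e \<subseteq> S" using \<open>open S\<close> mS open_contains_ball by blast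
  have max: "v (m + of_real t * a) \<le> v m" and inS: "m + of_real t * a \<in> S" if "\<bar>t\<bar> < e" "cmod a = 1" for t a
  proof -
    have "m + of_real t * a \<in> ball m e" using that by (simp add: dist_norm norm_mult)
    then show "m + of_real t * a \<in> S" using e by blast
    then show "v (m + of_real t * a) \<le> v m" using m(2) closure_subset[of S] by blast
  qed
  have line: "((\<lambda>t. m + of_real t * a) has_derivative (\<lambda>h. of_real h * a)) (at t)" for t a
    by (auto intro!: derivative_eq_intros)
  have a: "uxx m + 2 * \<epsilon> \<le> 0"
  proof (rule second_derivative_local_max[OF e(1)])
    show "((\<lambda>t. v (m + of_real t * 1)) has_real_derivative (ux (m + of_real t * 1) + 2 * \<epsilon> * (Re m + t))) (at t)" if "\<bar>t\<bar> < e" for t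
    proof -
      have "((\<lambda>t. u (m + of_real t * 1)) has_derivative (\<lambda>h. ux (m + of_real t * 1) * Re (of_real h * 1) + uy (m + of_real t * 1) * Im (of_real h * 1))) (at t)"
        by (rule has_derivative_compose[OF line d(1)], rule inS) (use that in auto)
      then have "((\<lambda>t. u (m + of_real t * 1)) has_real_derivative ux (m + of_real t * 1)) (at t)"
        unfolding has_field_derivative_def by (rule has_derivative_eq_rhs) auto
      moreover have "((\<lambda>t. \<epsilon> * ((Re (m + of_real t * 1))\<^sup>2 + (Im (m + of_real t * 1))\<^sup>2)) has_real_derivative 2 * \<epsilon> * (Re m + t)) (at t)"
        by (auto intro!: derivative_eq_intros)
      ultimately show ?thesis unfolding v_def by (rule DERIV_add)
    qed
    have "((\<lambda>t. ux (m + of_real t * 1)) has_derivative (\<lambda>h. uxx (m + of_real 0 * 1) * Re (of_real h * 1) + uxy (m + of_real 0 * 1) * Im (of_real h * 1))) (at 0)"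
      by (rule has_derivative_compose[OF line d(2)], rule inS) (use e in auto)
    then have "((\<lambda>t. ux (m + of_real t * 1)) has_real_derivative uxx m) (at 0)"
      unfolding has_field_derivative_def by (rule has_derivative_eq_rhs) auto
    then show "((\<lambda>t. ux (m + of_real t * 1) + 2 * \<epsilon> * (Re m + t)) has_real_derivative (uxx m + 2 * \<epsilon>)) (at 0)"
      by (auto intro!: derivative_eq_intros)
    show "v (m + of_real t * 1) \<le> v (m + of_real 0 * 1)" if "\<bar>t\<bar> < e" for t
      using max[OF that, of 1] by simp
  qed
  have b: "uyy m + 2 * \<epsilon> \<le> 0"
  proof (rule second_derivative_local_max[OF e(1)])
    show "((\<lambda>t. v (m + of_real t * \<i>)) has_real_derivative (uy (m + of_real t * \<i>) + 2 * \<epsilon> * (Im m + t))) (at t)" if "\<bar>t\<bar> < e" for t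
    proof -
      have "((\<lambda>t. u (m + of_real t * \<i>)) has_derivative (\<lambda>h. ux (m + of_real t * \<i>) * Re (of_real h * \<i>) + uy (m + of_real t * \<i>) * Im (of_real h * \<i>))) (at t)"
        by (rule has_derivative_compose[OF line d(1)], rule inS) (use that in auto)
      then have "((\<lambda>t. u (m + of_real t * \<i>)) has_real_derivative uy (m + of_real t * \<i>)) (at t)"
        unfolding has_field_derivative_def by (rule has_derivative_eq_rhs) auto
      moreover have "((\<lambda>t. \<epsilon> * ((Re (m + of_real t * \<i>))\<^sup>2 + (Im (m + of_real t * \<i>))\<^sup>2)) has_real_derivative 2 * \<epsilon> * (Im m + t)) (at t)"
        by (auto intro!: derivative_eq_intros)
      ultimately show ?thesis unfolding v_def by (rule DERIV_add)
    qed
    have "((\<lambda>t. uy (m + of_real t * \<i>)) has_derivative (\<lambda>h. uyx (m + of_real 0 * \<i>) * Re (of_real h * \<i>) + uyy (m + of_real 0 * \<i>) * Im (of_real h * \<i>))) (at 0)"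
      by (rule has_derivative_compose[OF line d(3)], rule inS) (use e in auto)
    then have "((\<lambda>t. uy (m + of_real t * \<i>)) has_real_derivative uyy m) (at 0)"
      unfolding has_field_derivative_def by (rule has_derivative_eq_rhs) auto
    then show "((\<lambda>t. uy (m + of_real t * \<i>) + 2 * \<epsilon> * (Im m + t)) has_real_derivative (uyy m + 2 * \<epsilon>)) (at 0)"
      by (auto intro!: derivative_eq_intros)
    show "v (m + of_real t * \<i>) \<le> v (m + of_real 0 * \<i>)" if "\<bar>t\<bar> < e" for t
      using max[OF that, of \<i>] by simp
  qed
  show False using a b d(4)[OF mS] \<epsilon> by simp
qed

lemma harmonic_on_diff:
  assumes "harmonic_on u S" "harmonic_on v S"
  shows "harmonic_on (\<lambda>x. u x - v x) S"
proof -
  obtain ux uy uxx uxy uyx uyy where "open S" and d: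
      "\<And>z. z \<in> S \<Longrightarrow> (u has_derivative (\<lambda>h. ux z * Re h + uy z * Im h)) (at z)"
      "\<And>z. z \<in> S \<Longrightarrow> (ux has_derivative (\<lambda>h. uxx z * Re h + uxy z * Im h)) (at z)"
      "\<And>z. z \<in> S \<Longrightarrow> (uy has_derivative (\<lambda>h. uyx z * Re h + uyy z * Im h)) (at z)"
      "\<And>z. z \<in> S \<Longrightarrow> uxx z + uyy z = 0" "continuous_on S uxx" "continuous_on S uxy"
      "continuous_on S uyx" "continuous_on S uyy"
    by (rule harmonic_onE[OF assms(1)]) (rule that; assumption)
  obtain vx vy vxx vxy vyx vyy where "open S" and e:
      "\<And>z. z \<in> S \<Longrightarrow> (v has_derivative (\<lambda>h. vx z * Re h + vy z * Im h)) (at z)"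
      "\<And>z. z \<in> S \<Longrightarrow> (vx has_derivative (\<lambda>h. vxx z * Re h + vxy z * Im h)) (at z)"
      "\<And>z. z \<in> S \<Longrightarrow> (vy has_derivative (\<lambda>h. vyx z * Re h + vyy z * Im h)) (at z)"
      "\<And>z. z \<in> S \<Longrightarrow> vxx z + vyy z = 0" "continuous_on S vxx" "continuous_on S vxy"
      "continuous_on S vyx" "continuous_on S vyy"
    by (rule harmonic_onE[OF assms(2)]) (rule that; assumption)
  have eq: "(\<lambda>h. a * Re h + b * Im h - (c * Re h + k * Im h)) = (\<lambda>h. (a - c) * Re h + (b - k) * Im h)" for a b c k
    by (simp add: algebra_simps)
  have "((\<lambda>x. u x - v x) has_derivative (\<lambda>h. (ux z - vx z) * Re h + (uy z - vy z) * Im h)) (at z)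
    \<and> ((\<lambda>x. ux x - vx x) has_derivative (\<lambda>h. (uxx z - vxx z) * Re h + (uxy z - vxy z) * Im h)) (at z)
    \<and> ((\<lambda>x. uy x - vy x) has_derivative (\<lambda>h. (uyx z - vyx z) * Re h + (uyy z - vyy z) * Im h)) (at z)
    \<and> (uxx z - vxx z) + (uyy z - vyy z) = 0" if z: "z \<in> S" for z
    using has_derivative_diff[OF d(1)[OF z] e(1)[OF z], unfolded eq]
      has_derivative_diff[OF d(2)[OF z] e(2)[OF z], unfolded eq]
      has_derivative_diff[OF d(3)[OF z] e(3)[OF z], unfolded eq] d(4)[OF z] e(4)[OF z]
    by (intro conjI) (assumption | linarith)+
  then show ?thesis
    by (intro harmonic_onI[of S "\<lambda>x. u x - v x" "\<lambda>z. ux z - vx z" "\<lambda>z. uy z - vy z" "\<lambda>z. uxx z - vxx z"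
        "\<lambda>z. uxy z - vxy z" "\<lambda>z. uyx z - vyx z" "\<lambda>z. uyy z - vyy z"] ballI \<open>open S\<close> continuous_intros d e)
qed

lemma dirichlet_solution_unique:
  assumes "bounded S" "dirichlet_solution S f u" "dirichlet_solution S f v" "x \<in> closure S"
  shows "u x = v x"
proof -
  have "a x - b x \<le> 0" if "dirichlet_solution S f a" "dirichlet_solution S f b" for a b
  proof (rule harmonic_on_max_principle[OF assms(1) _ _ _ assms(4)])
    show "continuous_on (closure S) (\<lambda>x. a x - b x)" "harmonic_on (\<lambda>x. a x - b x) S"
      using that by (auto simp: dirichlet_solution_def intro!: continuous_intros harmonic_on_diff)
    show "a y - b y \<le> 0" if y: "y \<in> frontier S" for y
      using \<open>dirichlet_solution S f a\<close> \<open>dirichlet_solution S f b\<close> y unfolding dirichlet_solution_def by simp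
  qed
  from this[OF assms(2,3)] this[OF assms(3,2)] show ?thesis by simp
qed

section \<open>Sweeping out and the Dirichlet problem\<close>

definition pext :: "(complex \<Rightarrow> real) \<Rightarrow> complex \<Rightarrow> real \<Rightarrow> complex \<Rightarrow> real" where
  "pext g w r z = (if z \<in> ball w r then poisson g w r z else g z)"

lemma pext_continuous:
  assumes "continuous_on UNIV g" "0 < r"
  shows "continuous_on UNIV (pext g w r)"
proof -
  have "continuous_on (cball w r) (pext g w r)"
    using poisson_continuous_cball[of w r g] continuous_on_subset[OF assms(1)] assms(2)
    unfolding pext_def by blast
  moreover have "continuous_on (- ball w r) (pext g w r)"
    by (rule continuous_on_eq[OF continuous_on_subset[OF assms(1)]]) (auto simp: pext_def)
  ultimately have "continuous_on (cball w r \<union> - ball w r) (pext g w r)"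
    by (intro continuous_on_closed_Un) auto
  moreover have "cball w r \<union> - ball w r = UNIV" using ball_subset_cball[of w r] by blast
  ultimately show ?thesis by simp
qed

lemma circ_mean_mono:
  assumes "continuous_on UNIV f" "continuous_on UNIV g" "0 \<le> r" "\<And>x. f x \<le> g x"
  shows "circ_mean f z r \<le> circ_mean g z r"
  unfolding circ_mean_def using assms
  by (intro integral_le circ_mean_integrable continuous_on_subset[OF assms(1)] continuous_on_subset[OF assms(2)]) auto

text \<open>Outside the open disk the value is unchanged while circle means can only grow; inside,
  the function is harmonic. Points of the circle itself fall under the first case.\<close>

lemma pext_submean:
  assumes g: "continuous_on UNIV g" "submean g S" and S: "open S" "cball w r \<subseteq> S" "0 < r"
  shows "g z \<le> pext g w r z" "submean (pext g w r) S"
proof -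
  have cg: "continuous_on A g" for A by (rule continuous_on_subset[OF g(1)]) auto
  have b: "ball w r \<subseteq> S" using S ball_subset_cball by blast
  show le: "g z \<le> pext g w r z" for z
    unfolding pext_def using submean_le_poisson[OF cg submean_subset[OF g(2) b]] by auto
  show "submean (pext g w r) S"
    unfolding submean_def
  proof
    fix z assume z: "z \<in> S"
    show "\<exists>e>0. \<forall>s. 0 < s \<and> s < e \<longrightarrow> pext g w r z \<le> circ_mean (pext g w r) z s"
    proof (cases "z \<in> ball w r")
      case True
      then obtain d where d: "d > 0" "cball z d \<subseteq> ball w r" using open_contains_cball open_ball by blast
      have "pext g w r z \<le> circ_mean (pext g w r) z s" if s: "0 < s" "s < d" for s
      proof -
        have sub: "cball z s \<subseteq> ball w r" using d s by (meson less_imp_le order_trans subset_cball)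
        then have "circ_mean (poisson g w r) z s = poisson g w r z"
          using harm_circ_mean[OF harm_poisson[OF cg S(3)]] s by blast
        moreover have "z + of_real s * uc t \<in> ball w r" for t
          using uc_sphere[of s z t] s sub sphere_subset_cball by fastforce
        then have "circ_mean (poisson g w r) z s = circ_mean (pext g w r) z s"
          unfolding circ_mean_def pext_def by simp
        ultimately show ?thesis using True by (simp add: pext_def)
      qed
      then show ?thesis using d(1) by blast
    next
      case False
      obtain e where e: "e > 0" "\<And>s. 0 < s \<Longrightarrow> s < e \<Longrightarrow> g z \<le> circ_mean g z s"
        using g(2) z unfolding submean_def by blast
      have "pext g w r z \<le> circ_mean (pext g w r) z s" if s: "0 < s" "s < e" for s
      proof -
        have "pext g w r z = g z" using False by (simp add: pext_def)
        then show ?thesis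
          using e(2)[OF s] circ_mean_mono[OF g(1) pext_continuous[OF g(1) S(3)] less_imp_le[OF s(1)] le, of z]
          by linarith
      qed
      then show ?thesis using e(1) by blast
    qed
  qed
qed

lemma submean_add:
  assumes "open S" "continuous_on S u" "continuous_on S v" "submean u S" "submean v S"
  shows "submean (\<lambda>x. u x + v x) S"
  unfolding submean_def
proof
  fix z assume z: "z \<in> S"
  obtain a where a: "a > 0" "\<And>r. 0 < r \<Longrightarrow> r < a \<Longrightarrow> u z \<le> circ_mean u z r"
    using assms(4) z unfolding submean_def by blast
  obtain b where b: "b > 0" "\<And>r. 0 < r \<Longrightarrow> r < b \<Longrightarrow> v z \<le> circ_mean v z r"
    using assms(5) z unfolding submean_def by blast
  obtain d where d: "d > 0" "cball z d \<subseteq> S" using assms(1) z open_contains_cball by blast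
  show "\<exists>e>0. \<forall>r. 0 < r \<and> r < e \<longrightarrow> u z + v z \<le> circ_mean (\<lambda>x. u x + v x) z r"
  proof (intro exI conjI allI impI)
    show "min d (min a b) > 0" using a b d by simp
    fix r assume r: "0 < r \<and> r < min d (min a b)"
    then have "sphere z r \<subseteq> S" using d by (auto simp: subset_eq)
    then have "circ_mean (\<lambda>x. u x + v x) z r = circ_mean u z r + circ_mean v z r"
      unfolding circ_mean_def using r assms(2,3)
      by (intro integral_add circ_mean_integrable) (auto intro: continuous_on_subset)
    then show "u z + v z \<le> circ_mean (\<lambda>x. u x + v x) z r"
      using a(2)[of r] b(2)[of r] r by simp
  qed
qed

lemma submean_cmult: "submean u S \<Longrightarrow> 0 \<le> c \<Longrightarrow> submean (\<lambda>x. c * u x) S"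
  unfolding submean_def circ_mean_def by (fastforce intro: mult_left_mono)

text \<open>A superharmonic function vanishing only at p, demanded on the whole closure and not just
  near p. Such global barriers exist for champagne regions, where every frontier point lies on the
  unit circle or on a removed circle.\<close>

definition barrier :: "complex set \<Rightarrow> complex \<Rightarrow> (complex \<Rightarrow> real) \<Rightarrow> bool" where
  "barrier S p b \<longleftrightarrow> continuous_on (closure S) b \<and> submean (\<lambda>x. - b x) S \<and> b p = 0 \<and>
     (\<forall>x\<in>closure S. x \<noteq> p \<longrightarrow> 0 < b x)"

text \<open>Counterpart of \<open>dirichlet_solution\<close> with \<open>harm\<close> in place of
  \<open>harmonic_on\<close>; the estimates are all made for it.\<close>

definition harm_extension :: "complex set \<Rightarrow> (complex \<Rightarrow> real) \<Rightarrow> (complex \<Rightarrow> real) \<Rightarrow> bool" where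
  "harm_extension S f u \<longleftrightarrow> continuous_on (closure S) u \<and> harm u S \<and> (\<forall>x\<in>frontier S. u x = f x)"

lemma harm_extension_le:
  assumes u: "harm_extension S f u" and S: "open S" "bounded S"
    and le: "\<And>x. x \<in> frontier S \<Longrightarrow> f x \<le> M" and x: "x \<in> closure S"
  shows "u x \<le> M"
proof (rule submean_max_principle[OF S _ _ _ x])
  show "continuous_on (closure S) u" "submean u S"
    using u harm_submean(1)[OF _ S(1)] by (simp_all add: harm_extension_def)
  show "u y \<le> M" if "y \<in> frontier S" for y
    using u le[OF that] that by (simp add: harm_extension_def)
qed

lemma harm_extension_add:
  "harm_extension S f u \<Longrightarrow> harm_extension S g v \<Longrightarrow> harm_extension S (\<lambda>x. f x + g x) (\<lambda>x. u x + v x)"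
  unfolding harm_extension_def by (auto intro: continuous_intros harm_add)

lemma harm_extension_cmult:
  "harm_extension S f u \<Longrightarrow> harm_extension S (\<lambda>x. c * f x) (\<lambda>x. c * u x)"
  unfolding harm_extension_def by (auto intro: continuous_intros harm_cmult)

lemma harm_extension_diff:
  "harm_extension S f u \<Longrightarrow> harm_extension S g v \<Longrightarrow> harm_extension S (\<lambda>x. f x - g x) (\<lambda>x. u x - v x)"
  unfolding harm_extension_def by (auto intro: continuous_intros harm_diff)

text \<open>Balls of radius R z / 4 cover S, countably many suffice, and pairing their index with a
  second natural number makes each of them recur infinitely often. The factor 1/4 leaves room for
  Harnack's inequality.\<close>

lemma ball_sequence_infinitely_often:
  fixes S :: "complex set"
  assumes "open S" "S \<noteq> {}"
  obtains c :: "nat \<Rightarrow> complex" and \<rho> :: "nat \<Rightarrow> real"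
  where "\<And>n. 0 < \<rho> n" "\<And>n. cball (c n) (\<rho> n) \<subseteq> S"
    "\<And>z. z \<in> S \<Longrightarrow> \<exists>w r f. strict_mono f \<and> (\<forall>k::nat. c (f k) = w \<and> \<rho> (f k) = r) \<and> z \<in> ball w (r / 4)"
proof -
  have "\<exists>r>0. cball z r \<subseteq> S" if "z \<in> S" for z
    using assms(1) that open_contains_cball by blast
  then obtain R where R: "\<And>z. z \<in> S \<Longrightarrow> 0 < R z" "\<And>z. z \<in> S \<Longrightarrow> cball z (R z) \<subseteq> S" by metis
  obtain F' where F': "F' \<subseteq> (\<lambda>z. ball z (R z / 4)) ` S" "countable F'" "\<Union>F' = \<Union>((\<lambda>z. ball z (R z / 4)) ` S)"
    using Lindelof[of "(\<lambda>z. ball z (R z / 4)) ` S"] by auto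
  have "\<exists>Z. countable Z \<and> Z \<subseteq> S \<and> F' = (\<lambda>z. ball z (R z / 4)) ` Z"
    by (rule countable_subset_image[THEN iffD1]) (intro conjI F'(1,2))
  then obtain Z where Z: "countable Z" "Z \<subseteq> S" "F' = (\<lambda>z. ball z (R z / 4)) ` Z" by blast
  have cover: "S \<subseteq> (\<Union>z\<in>Z. ball z (R z / 4))"
  proof
    fix z assume "z \<in> S"
    then have "z \<in> \<Union>F'" unfolding F'(3) using R by force
    then show "z \<in> (\<Union>z\<in>Z. ball z (R z / 4))" using Z by blast
  qed
  then have "Z \<noteq> {}" using assms(2) by blast
  define c where "c n = from_nat_into Z (fst (prod_decode n))" for n
  have cS: "c n \<in> S" for n
    unfolding c_def using from_nat_into[OF \<open>Z \<noteq> {}\<close>] Z by blast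
  show ?thesis
  proof (rule that[of "\<lambda>n. R (c n)" c])
    show "0 < R (c n)" "cball (c n) (R (c n)) \<subseteq> S" for n
      using R cS by auto
    fix z assume "z \<in> S"
    then obtain w where w: "w \<in> Z" "z \<in> ball w (R w / 4)" using cover by blast
    define i where "i = to_nat_on Z w"
    have "strict_mono (\<lambda>k. prod_encode (i, k))"
      by (rule strict_mono_Suc_iff[THEN iffD2]) (simp add: prod_encode_def)
    moreover have "c (prod_encode (i, k)) = w" for k
      unfolding c_def i_def using from_nat_into_to_nat_on[OF Z(1) w(1)] by simp
    ultimately show "\<exists>w r f. strict_mono f \<and> (\<forall>k::nat. c (f k) = w \<and> R (c (f k)) = r) \<and> z \<in> ball w (r / 4)"
      using w(2) by (intro exI[of _ w] exI[of _ "R w"] exI[of _ "\<lambda>k. prod_encode (i, k)"]) simp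
  qed
qed

text \<open>Poincare's sweeping-out: a subharmonic function is replaced by its Poisson integral in each
  of countably many disks, every disk being visited infinitely often.\<close>

lemma harm_extension_submean:
  assumes S: "open S" "bounded S" "S \<noteq> {}"
    and bar: "\<And>p. p \<in> frontier S \<Longrightarrow> \<exists>b. barrier S p b"
    and F: "continuous_on UNIV F" "submean F S"
  shows "\<exists>u. harm_extension S F u"
proof -
  obtain c :: "nat \<Rightarrow> complex" and \<rho> :: "nat \<Rightarrow> real"
  where c: "\<And>n. 0 < \<rho> n" "\<And>n. cball (c n) (\<rho> n) \<subseteq> S"
    "\<And>z. z \<in> S \<Longrightarrow> \<exists>w r f. strict_mono f \<and> (\<forall>k::nat. c (f k) = w \<and> \<rho> (f k) = r) \<and> z \<in> ball w (r / 4)"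
    by (rule ball_sequence_infinitely_often[OF S(1,3)]) (rule that; assumption)
  define v where "v = rec_nat F (\<lambda>n g. pext g (c n) (\<rho> n))"
  have v0: "v 0 = F" and vS: "v (Suc n) = pext (v n) (c n) (\<rho> n)" for n
    by (simp_all add: v_def)
  have inv: "continuous_on UNIV (v n) \<and> submean (v n) S \<and> (\<forall>x. x \<notin> S \<longrightarrow> v n x = F x)" for n
  proof (induction n)
    case 0 show ?case using F by (simp add: v0)
  next
    case (Suc n)
    then have IH: "continuous_on UNIV (v n)" "submean (v n) S" "\<And>x. x \<notin> S \<Longrightarrow> v n x = F x" by auto
    have "v (Suc n) x = F x" if "x \<notin> S" for x
    proof -
      have "x \<notin> ball (c n) (\<rho> n)" using that c(2)[of n] ball_subset_cball[of "c n" "\<rho> n"] by blast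
      then show ?thesis using IH(3)[OF that] by (simp add: vS pext_def)
    qed
    moreover have "continuous_on UNIV (v (Suc n))"
      unfolding vS by (rule pext_continuous[OF IH(1) c(1)])
    moreover have "submean (v (Suc n)) S"
      unfolding vS by (rule pext_submean(2)[OF IH(1,2) S(1) c(2) c(1)])
    ultimately show ?case by blast
  qed
  then have cv: "continuous_on A (v n)" for n A by (meson continuous_on_subset subset_UNIV)
  have v_Suc: "v n x \<le> v (Suc n) x" for n x
    unfolding vS by (rule pext_submean(1)[OF _ _ S(1) c(2) c(1)]) (use inv in auto)
  have v_mono: "v m x \<le> v n x" if "m \<le> n" for m n x
    using lift_Suc_mono_le[of "\<lambda>n. v n x"] v_Suc that by blast
  \<comment> \<open>A bound on the frontier by a constant plus a multiple of a superharmonic b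
    persists inside, at every stage of the sweeping; with b a barrier this controls the limit near
    the frontier.\<close>
  have vle: "v n x \<le> M + K * b x"
    if "K \<ge> 0" "continuous_on (closure S) b" "submean (\<lambda>x. - b x) S" "\<And>x. x \<in> frontier S \<Longrightarrow> F x \<le> M + K * b x" "x \<in> closure S"
    for n x M K b
  proof -
    have "v n x + K * (- b x) \<le> M"
    proof (rule submean_max_principle[OF S(1,2) _ _ _ that(5)])
      show "continuous_on (closure S) (\<lambda>x. v n x + K * (- b x))"
        by (intro continuous_intros cv that)
      show "submean (\<lambda>x. v n x + K * (- b x)) S"
        using that(2) closure_subset[of S] inv
        by (intro submean_add submean_cmult that S(1) cv continuous_intros) (auto intro: continuous_on_subset)
      fix y assume y: "y \<in> frontier S"
      then have "y \<notin> S" using S(1) by (simp add: frontier_def interior_open)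
      then show "v n y + K * (- b y) \<le> M" using inv[of n] that(4)[OF y] by simp
    qed
    then show ?thesis by simp
  qed
  have "compact (frontier S)" using S(2) by (rule compact_frontier_bounded)
  then have "bounded (F ` frontier S)"
    by (intro compact_imp_bounded compact_continuous_image continuous_on_subset[OF F(1)]) auto
  then obtain M where M: "M > 0" "\<And>x. x \<in> frontier S \<Longrightarrow> \<bar>F x\<bar> \<le> M"
    unfolding bounded_pos by auto
  have vM: "v n x \<le> M" if "x \<in> closure S" for n x
  proof -
    have "submean (\<lambda>x. - 0) S"
      using harm_submean(2)[OF harm_const[of 0] S(1)] .
    then show ?thesis
      using vle[of 0 "\<lambda>_. 0" M x n] M(2) that by (simp add: abs_le_iff)
  qed
  define u where "u x = lim (\<lambda>n. v n x)" for x
  have lim: "(\<lambda>n. v n x) \<longlonglongrightarrow> u x" if "x \<in> closure S" for x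
  proof -
    have inc: "incseq (\<lambda>n. v n x)" using v_mono by (simp add: incseq_def)
    have "\<forall>n. v n x \<le> M" using vM[OF that] by blast
    then obtain L where "(\<lambda>n. v n x) \<longlonglongrightarrow> L"
      using incseq_convergent[OF inc] by blast
    then show ?thesis unfolding u_def by (simp add: limI)
  qed
  have v_le_u: "v n x \<le> u x" if "x \<in> closure S" for n x
    by (rule incseq_le[OF _ lim[OF that]]) (simp add: incseq_def v_mono)
  have uF: "u x = F x" if "x \<in> closure S" "x \<notin> S" for x
  proof -
    have "(\<lambda>n. v n x) = (\<lambda>n. F x)" using inv that by blast
    then show ?thesis using lim[OF that(1)] LIMSEQ_unique tendsto_const by metis
  qed
  have harm_u: "harm u S"
  proof (rule harm_localI)
    fix z assume "z \<in> S"
    then obtain w r f where f: "strict_mono f" "\<And>k::nat. c (f k) = w" "\<And>k. \<rho> (f k) = r" "z \<in> ball w (r / 4)"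
      using c(3) by metis
    have r: "r > 0" and sub: "cball w r \<subseteq> S" using c(1,2)[of "f 0"] f by auto
    have subc: "x \<in> closure S" if "x \<in> ball w r" for x
      using that sub ball_subset_cball[of w r] closure_subset[of S] by blast
    \<comment> \<open>The subsequence taken just after each visit to the same disk: its members are
      harmonic on that disk and increase.\<close>
    define g where "g k = v (Suc (f k))" for k
    have hg: "harm (g k) (ball w r)" for k
      by (rule harm_cong[OF harm_poisson[of w r "v (f k)", OF cv r]]) (simp add: g_def vS f pext_def)
    have mono_g: "g k x \<le> g l x" if "k \<le> l" for k l x
      unfolding g_def using that f(1) by (intro v_mono) (simp add: strict_mono_less_eq)
    have lim_g: "(\<lambda>k. g k x) \<longlonglongrightarrow> u x" if "x \<in> ball w r" for x
    proof -
      have "strict_mono (\<lambda>k. Suc (f k))" using f(1) by (simp add: strict_mono_def)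
      from LIMSEQ_subseq_LIMSEQ[OF lim[OF subc[OF that]] this] show ?thesis
        by (simp add: o_def g_def)
    qed
    have sub4: "ball w (r / 4) \<subseteq> ball w r" and wb: "w \<in> ball w r" using r by auto
    \<comment> \<open>Harnack's inequality on the ball of radius r / 2, applied to the nonnegative g
      l - g k, turns convergence at w into uniform convergence on the quarter ball.\<close>
    have est: "u x - g k x \<le> 3 * (u w - g k w)" if "x \<in> ball w (r / 4)" for x k
    proof (rule LIMSEQ_le)
      show "(\<lambda>l. g l x - g k x) \<longlonglongrightarrow> u x - g k x" "(\<lambda>l. 3 * (g l w - g k w)) \<longlonglongrightarrow> 3 * (u w - g k w)"
        using that sub4 wb by (intro tendsto_intros lim_g; blast)+
      have "g l x - g k x \<le> 3 * (g l w - g k w)" if "l \<ge> k" for l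
        using \<open>x \<in> ball w (r / 4)\<close> r mono_g[OF that]
        by (intro harnack_half(1)[OF harm_diff[OF hg hg, of l k], of w "r / 2"])
           (auto simp: dist_norm norm_minus_commute)
      then show "\<exists>N. \<forall>l\<ge>N. g l x - g k x \<le> 3 * (g l w - g k w)" by blast
    qed
    have "uniform_limit (ball w (r / 4)) g u sequentially"
    proof (rule uniform_limitI)
      fix e :: real assume e: "e > 0"
      have "\<forall>\<^sub>F k in sequentially. dist (g k w) (u w) < e / 3"
        using tendstoD[OF lim_g[OF wb], of "e / 3"] e by simp
      then show "\<forall>\<^sub>F k in sequentially. \<forall>x\<in>ball w (r / 4). dist (g k x) (u x) < e"
      proof eventually_elim
        case (elim k)
        show ?case
        proof
          fix x assume x: "x \<in> ball w (r / 4)"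
          then have "g k x \<le> u x" unfolding g_def using sub4 subc by (intro v_le_u) blast
          then show "dist (g k x) (u x) < e" using est[OF x, of k] elim by (auto simp: dist_real_def)
        qed
      qed
    qed
    then have h: "harm u (ball w (r / 4))"
      by (rule harm_uniform_limit[rotated]) (rule harm_subset[OF hg sub4])
    obtain e where "e > 0" "ball z e \<subseteq> ball w (r / 4)"
      using f(4) open_contains_ball open_ball by blast
    then show "\<exists>e>0. harm u (ball z e)" using harm_subset[OF h] by blast
  qed
  have "continuous_on (closure S) u"
    unfolding continuous_on_eq_continuous_within
  proof
    fix p assume p: "p \<in> closure S"
    show "continuous (at p within closure S) u"
    proof (cases "p \<in> S")
      case True
      then have "isCont u p"
        using harm_continuous[OF harm_u] continuous_on_eq_continuous_at[OF S(1)] by blast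
      then show ?thesis by (rule continuous_at_imp_continuous_at_within)
    next
      case False
      then have pf: "p \<in> frontier S" using p S(1) by (simp add: frontier_def interior_open)
      then obtain b where b: "continuous_on (closure S) b" "submean (\<lambda>x. - b x) S" "b p = 0"
          "\<And>x. x \<in> closure S \<Longrightarrow> x \<noteq> p \<Longrightarrow> 0 < b x"
        using bar unfolding barrier_def by blast
      have "(u \<longlongrightarrow> F p) (at p within closure S)"
        unfolding tendsto_iff
      proof (intro allI impI)
        fix e :: real assume e: "e > 0"
        have "isCont F p" using F(1) continuous_on_eq_continuous_at[OF open_UNIV] by blast
        then obtain d where d: "d > 0" "\<And>x. dist x p < d \<Longrightarrow> dist (F x) (F p) < e / 2"
          unfolding continuous_at_eps_delta using e half_gt_zero by blast
        let ?C = "frontier S - ball p d"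
        have "compact ?C" using \<open>compact (frontier S)\<close> by (simp add: compact_diff)
        have fc: "frontier S \<subseteq> closure S" by (simp add: frontier_def)
        have "\<exists>\<beta>>0. \<forall>x\<in>?C. \<beta> \<le> b x"
        proof (cases "?C = {}")
          case False
          then obtain y where y: "y \<in> ?C" "\<And>x. x \<in> ?C \<Longrightarrow> b y \<le> b x"
            using continuous_attains_inf[OF \<open>compact ?C\<close> False continuous_on_subset[OF b(1)]] fc by blast
          have "b y > 0" using y(1) d(1) fc by (intro b(4)) auto
          then show ?thesis using y(2) by blast
        qed (auto intro: exI[of _ 1])
        then obtain \<beta> where \<beta>: "\<beta> > 0" "\<And>x. x \<in> ?C \<Longrightarrow> \<beta> \<le> b x" by blast
        \<comment> \<open>Chosen so that K * \<beta> = 2 * M, which bounds F y - F p for frontier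
          points y away from p.\<close>
        define K where "K = 2 * M / \<beta>"
        have K: "K \<ge> 0" unfolding K_def using M \<beta> by simp
        have up: "u x \<le> F p + e / 2 + K * b x" if "x \<in> closure S" for x
        proof (rule LIMSEQ_le_const2[OF lim[OF that]], intro exI allI impI, rule vle[OF K b(1,2) _ that])
          fix y assume y: "y \<in> frontier S"
          have b0: "0 \<le> b y" using b(3,4) fc y by (cases "y = p") (auto intro: less_imp_le)
          show "F y \<le> F p + e / 2 + K * b y"
          proof (cases "y \<in> ball p d")
            case True
            then have "dist y p < d" by (simp add: dist_commute)
            from d(2)[OF this] have "\<bar>F y - F p\<bar> < e / 2" by (simp only: dist_real_def)
            then have "F y \<le> F p + e / 2" by linarith
            then show ?thesis using K b0 mult_nonneg_nonneg[OF K b0] by linarith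
          next
            case False
            then have "K * \<beta> \<le> K * b y" using \<beta> y K by (intro mult_left_mono) auto
            then have "2 * M \<le> K * b y" using \<beta> by (simp add: K_def)
            then show ?thesis using M(2)[OF y] M(2)[OF pf] e by linarith
          qed
        qed
        have "((\<lambda>x. F p + e / 2 + K * b x) \<longlongrightarrow> F p + e / 2 + K * b p) (at p within closure S)"
          using b(1) p by (intro tendsto_intros) (simp add: continuous_on_def)
        then have e1: "\<forall>\<^sub>F x in at p within closure S. F p + e / 2 + K * b x < F p + e"
          by (rule order_tendstoD) (use b(3) e in simp)
        have e2: "\<forall>\<^sub>F x in at p within closure S. x \<in> closure S \<and> dist x p < d"
          unfolding eventually_at using d(1) by blast
        show "\<forall>\<^sub>F x in at p within closure S. dist (u x) (F p) < e"
          using e1 e2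
        proof eventually_elim
          case (elim x)
          \<comment> \<open>The lower bound at the frontier costs nothing: the sweeping starts at F
            and only increases.\<close>
          have "F x \<le> u x" using v_le_u[of x 0] elim by (simp add: v0)
          then show ?case using up[of x] d(2)[of x] elim unfolding dist_real_def by linarith
        qed
      qed
      then show ?thesis using uF[OF p False] by (simp add: continuous_within)
    qed
  qed
  then show ?thesis
    unfolding harm_extension_def using harm_u uF S(1)
    by (intro exI[of _ u]) (auto simp: frontier_def interior_open)
qed

section \<open>Polynomial and then arbitrary continuous boundary values\<close>

lemma circ_mean_add:
  assumes "continuous_on UNIV f" "continuous_on UNIV g" "0 \<le> r"
  shows "circ_mean (\<lambda>x. f x + g x) z r = circ_mean f z r + circ_mean g z r"
  unfolding circ_mean_def
  by (intro integral_add circ_mean_integrable assms(3) continuous_on_subset[OF assms(1)] continuous_on_subset[OF assms(2)]) auto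

lemma circ_mean_cmult: "circ_mean (\<lambda>x. c * f x) z r = c * circ_mean f z r"
  unfolding circ_mean_def by simp

lemma circ_mean_const: "circ_mean (\<lambda>x. c) z r = c"
  unfolding circ_mean_def by simp

lemma circ_mean_bound:
  assumes "continuous_on UNIV f" "0 \<le> r" "\<And>x. x \<in> sphere z r \<Longrightarrow> \<bar>f x\<bar> \<le> B"
  shows "\<bar>circ_mean f z r\<bar> \<le> B"
proof -
  have "norm (integral {0..1} (\<lambda>t. f (z + of_real r * uc t))) \<le> B * (1 - 0)"
    by (rule integral_bound) (use assms uc_sphere in \<open>auto intro!: continuous_on_circle continuous_on_subset[OF assms(1)]\<close>)
  then show ?thesis by (simp add: circ_mean_def)
qed

text \<open>A real-linear functional on the plane is Re (a * x) for some a, hence the real part of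
  an entire function.\<close>

lemma circ_mean_linear:
  fixes f :: "complex \<Rightarrow> real"
  assumes "bounded_linear f" "0 < r"
  shows "circ_mean f z r = f z"
proof -
  interpret bounded_linear f by fact
  define a where "a = of_real (f 1) - \<i> * of_real (f \<i>)"
  have "f x = Re (a * x)" for x
  proof -
    have "x = Re x *\<^sub>R 1 + Im x *\<^sub>R \<i>" by (simp add: complex_eq_iff)
    then have "f x = f (Re x *\<^sub>R 1 + Im x *\<^sub>R \<i>)" by (rule arg_cong)
    then show ?thesis by (simp only: add scaleR) (simp add: a_def algebra_simps)
  qed
  then have "f = (\<lambda>x. Re (a * x))" by blast
  then show ?thesis
    using circ_mean_Re[of z r "\<lambda>x. a * x"] assms(2) by (auto intro!: continuous_intros holomorphic_intros)
qed

text \<open>On the circle of radius r about z, |y|^2 coincides with an affine function of y, whose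
  mean is its value at the centre.\<close>

lemma circ_mean_norm_square:
  assumes "0 < r"
  shows "circ_mean (\<lambda>y. (cmod y)\<^sup>2) z r = (cmod z)\<^sup>2 + r\<^sup>2"
proof -
  have "circ_mean (\<lambda>x. Re (2 * cnj z * x)) z r = Re (2 * cnj z * z)"
    using assms by (intro circ_mean_Re continuous_intros holomorphic_intros)
  moreover have "Re (2 * cnj z * z) = 2 * (cmod z)\<^sup>2"
    unfolding cmod_power2 by (simp add: power2_eq_square)
  moreover have "circ_mean (\<lambda>y. (cmod y)\<^sup>2) z r = circ_mean (\<lambda>x. Re (2 * cnj z * x) + (r\<^sup>2 - (cmod z)\<^sup>2)) z r"
    unfolding circ_mean_def
  proof (rule integral_cong)
    fix t :: real
    define e where "e = of_real r * uc t"
    have "cmod e = r" using assms by (simp add: e_def norm_mult)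
    then have "(Re e)\<^sup>2 + (Im e)\<^sup>2 = r\<^sup>2"
      using cmod_power2[of e] by simp
    then have "(cmod (z + e))\<^sup>2 = Re (2 * cnj z * (z + e)) + (r\<^sup>2 - (cmod z)\<^sup>2)"
      unfolding cmod_power2 by (simp add: power2_eq_square algebra_simps)
    then show "(cmod (z + of_real r * uc t))\<^sup>2 = Re (2 * cnj z * (z + of_real r * uc t)) + (r\<^sup>2 - (cmod z)\<^sup>2)"
      by (simp only: e_def)
  qed
  moreover have "\<dots> = circ_mean (\<lambda>x. Re (2 * cnj z * x)) z r + (r\<^sup>2 - (cmod z)\<^sup>2)"
    using assms by (subst circ_mean_add) (auto intro!: continuous_intros simp: circ_mean_const)
  ultimately show ?thesis by simp
qed

text \<open>A mean value error of order r^2 takes the place of a bound on the Laplacian. The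
  Lipschitz and size bounds are carried along because the error of a product needs all
  three.\<close>

lemma real_polynomial_circ_mean:
  fixes F :: "complex \<Rightarrow> real"
  assumes "real_polynomial_function F"
  shows "\<exists>K L M. 0 \<le> K \<and> 0 \<le> L \<and> 0 \<le> M \<and> (\<forall>z r. cmod z \<le> B \<and> 0 < r \<and> r < 1 \<longrightarrow>
    \<bar>circ_mean F z r - F z\<bar> \<le> K * r\<^sup>2 \<and> (\<forall>y. y \<in> sphere z r \<longrightarrow> \<bar>F y - F z\<bar> \<le> L * r) \<and> \<bar>F z\<bar> \<le> M)"
  using assms
proof (induction F rule: real_polynomial_function.induct)
  case (linear f)
  then interpret bounded_linear f .
  obtain L where L: "L > 0" "\<And>x. norm (f x) \<le> norm x * L" using pos_bounded by blast
  have "\<bar>f z\<bar> \<le> L * \<bar>B\<bar>" if "cmod z \<le> B" for z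
  proof -
    have "L * cmod z \<le> L * \<bar>B\<bar>" using that L(1) by (intro mult_left_mono) auto
    then show ?thesis using L(2)[of z] by (simp add: mult.commute)
  qed
  note bd = this
  have lip: "\<bar>f y - f z\<bar> \<le> L * r" if "y \<in> sphere z r" for y z r
    using L(2)[of "y - z"] that by (simp add: diff dist_norm norm_minus_commute mult.commute)
  have *: "\<bar>circ_mean f z r - f z\<bar> \<le> 0 * r\<^sup>2 \<and> (\<forall>y. y \<in> sphere z r \<longrightarrow> \<bar>f y - f z\<bar> \<le> L * r) \<and> \<bar>f z\<bar> \<le> L * \<bar>B\<bar>"
    if "cmod z \<le> B" "0 < r" "r < 1" for z r
    using circ_mean_linear[OF bounded_linear_axioms that(2), of z] bd[OF that(1)]
    by (intro conjI allI impI lip) simp_all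
  have nn: "0 \<le> (0::real)" "0 \<le> L" "0 \<le> L * \<bar>B\<bar>" using L(1) by simp_all
  show ?case
    by (rule exI[of _ 0], rule exI[of _ L], rule exI[of _ "L * \<bar>B\<bar>"], rule conjI, rule nn(1), rule conjI, rule nn(2),
      rule conjI, rule nn(3), rule allI, rule allI, rule impI, rule *) simp_all
next
  case (const c)
  show ?case by (rule exI[of _ 0], rule exI[of _ 0], rule exI[of _ "\<bar>c\<bar>"]) (auto simp: circ_mean_const)
next
  case (add f g)
  from add.IH(1) obtain K L M where f: "0 \<le> K" "0 \<le> L" "0 \<le> M" "\<And>z r. cmod z \<le> B \<Longrightarrow> 0 < r \<Longrightarrow> r < 1 \<Longrightarrow>
    \<bar>circ_mean f z r - f z\<bar> \<le> K * r\<^sup>2 \<and> (\<forall>y. y \<in> sphere z r \<longrightarrow> \<bar>f y - f z\<bar> \<le> L * r) \<and> \<bar>f z\<bar> \<le> M" by metis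
  from add.IH(2) obtain K' L' M' where g: "0 \<le> K'" "0 \<le> L'" "0 \<le> M'" "\<And>z r. cmod z \<le> B \<Longrightarrow> 0 < r \<Longrightarrow> r < 1 \<Longrightarrow>
    \<bar>circ_mean g z r - g z\<bar> \<le> K' * r\<^sup>2 \<and> (\<forall>y. y \<in> sphere z r \<longrightarrow> \<bar>g y - g z\<bar> \<le> L' * r) \<and> \<bar>g z\<bar> \<le> M'" by metis
  have c: "continuous_on UNIV f" "continuous_on UNIV g"
    using add(1,2) by (auto intro!: continuous_on_polymonial_function simp: real_polynomial_function_eq)
  have "\<bar>circ_mean (\<lambda>x. f x + g x) z r - (f z + g z)\<bar> \<le> (K + K') * r\<^sup>2 \<and>
    (\<forall>y. y \<in> sphere z r \<longrightarrow> \<bar>f y + g y - (f z + g z)\<bar> \<le> (L + L') * r) \<and> \<bar>f z + g z\<bar> \<le> M + M'"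
    if z: "cmod z \<le> B" "0 < r" "r < 1" for z r
  proof (intro conjI allI impI)
    show "\<bar>circ_mean (\<lambda>x. f x + g x) z r - (f z + g z)\<bar> \<le> (K + K') * r\<^sup>2"
      using f(4)[OF z] g(4)[OF z] circ_mean_add[OF c less_imp_le[OF z(2)], of z] unfolding distrib_right by linarith
    show "\<bar>f y + g y - (f z + g z)\<bar> \<le> (L + L') * r" if "y \<in> sphere z r" for y
    proof -
      have "\<bar>f y - f z\<bar> \<le> L * r" "\<bar>g y - g z\<bar> \<le> L' * r" using f(4)[OF z] g(4)[OF z] that by blast+
      then show ?thesis unfolding distrib_right by linarith
    qed
    show "\<bar>f z + g z\<bar> \<le> M + M'" using f(4)[OF z] g(4)[OF z] by linarith
  qed
  note * = this
  have nn: "0 \<le> K + K'" "0 \<le> L + L'" "0 \<le> M + M'" using f(1-3) g(1-3) by simp_all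
  show ?case
    by (rule exI[of _ "K + K'"], rule exI[of _ "L + L'"], rule exI[of _ "M + M'"], rule conjI, rule nn(1), rule conjI, rule nn(2), rule conjI, rule nn(3), rule allI, rule allI, rule impI, rule *) simp_all
next
  case (mult f g)
  from mult.IH(1) obtain K L M where f: "0 \<le> K" "0 \<le> L" "0 \<le> M" "\<And>z r. cmod z \<le> B \<Longrightarrow> 0 < r \<Longrightarrow> r < 1 \<Longrightarrow>
    \<bar>circ_mean f z r - f z\<bar> \<le> K * r\<^sup>2 \<and> (\<forall>y. y \<in> sphere z r \<longrightarrow> \<bar>f y - f z\<bar> \<le> L * r) \<and> \<bar>f z\<bar> \<le> M" by metis
  from mult.IH(2) obtain K' L' M' where g: "0 \<le> K'" "0 \<le> L'" "0 \<le> M'" "\<And>z r. cmod z \<le> B \<Longrightarrow> 0 < r \<Longrightarrow> r < 1 \<Longrightarrow>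
    \<bar>circ_mean g z r - g z\<bar> \<le> K' * r\<^sup>2 \<and> (\<forall>y. y \<in> sphere z r \<longrightarrow> \<bar>g y - g z\<bar> \<le> L' * r) \<and> \<bar>g z\<bar> \<le> M'" by metis
  have c: "continuous_on UNIV f" "continuous_on UNIV g"
    using mult(1,2) by (auto intro!: continuous_on_polymonial_function simp: real_polynomial_function_eq)
  \<comment> \<open>Both constants come from f g - f(z) g(z) = (f - f(z)) (g - g(z)) + f(z) (g -
    g(z)) + g(z) (f - f(z)); in the Lipschitz bound r^2 is weakened to r, as r < 1.\<close>
  define K2 L2 where "K2 = L * L' + M * K' + M' * K" and "L2 = L * L' + M * L' + M' * L"
  have "\<bar>circ_mean (\<lambda>x. f x * g x) z r - f z * g z\<bar> \<le> K2 * r\<^sup>2 \<and>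
    (\<forall>y. y \<in> sphere z r \<longrightarrow> \<bar>f y * g y - f z * g z\<bar> \<le> L2 * r) \<and> \<bar>f z * g z\<bar> \<le> M * M'"
    if z: "cmod z \<le> B" "0 < r" "r < 1" for z r
  proof (intro conjI allI impI)
    have fz: "\<bar>f z\<bar> \<le> M" "\<bar>g z\<bar> \<le> M'" using f(4)[OF z] g(4)[OF z] by auto
    then show "\<bar>f z * g z\<bar> \<le> M * M'" unfolding abs_mult using f(3) by (intro mult_mono) auto
    have prod: "\<bar>(f y - f z) * (g y - g z)\<bar> \<le> L * L' * r\<^sup>2" if "y \<in> sphere z r" for y
    proof -
      have "\<bar>f y - f z\<bar> \<le> L * r" "\<bar>g y - g z\<bar> \<le> L' * r" using f(4)[OF z] g(4)[OF z] that by blast+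
      then have "\<bar>f y - f z\<bar> * \<bar>g y - g z\<bar> \<le> (L * r) * (L' * r)"
        using f(2) z(2) by (intro mult_mono) auto
      then show ?thesis by (simp add: abs_mult power2_eq_square mult_ac)
    qed
    have dec: "f y * g y = (f y - f z) * (g y - g z) + (f z * g y + (g z * f y + - (f z * g z)))" for y
      by (simp add: algebra_simps)
    have r0: "0 \<le> r" using z by simp
    have "circ_mean (\<lambda>y. f y * g y) z r =
        circ_mean (\<lambda>y. (f y - f z) * (g y - g z) + (f z * g y + (g z * f y + - (f z * g z)))) z r"
      by (rule arg_cong[where f = "\<lambda>h. circ_mean h z r"], rule ext, rule dec)
    also have "\<dots> = circ_mean (\<lambda>y. (f y - f z) * (g y - g z)) z r + (f z * circ_mean g z r + (g z * circ_mean f z r + - (f z * g z)))"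
      by (subst circ_mean_add, (intro continuous_intros c r0)+, subst circ_mean_add, (intro continuous_intros c r0)+,
        subst circ_mean_add, (intro continuous_intros c r0)+) (simp only: circ_mean_cmult circ_mean_const)
    finally have "circ_mean (\<lambda>y. f y * g y) z r = circ_mean (\<lambda>y. (f y - f z) * (g y - g z)) z r
        + (f z * circ_mean g z r + (g z * circ_mean f z r + - (f z * g z)))" .
    then have "circ_mean (\<lambda>y. f y * g y) z r - f z * g z = circ_mean (\<lambda>y. (f y - f z) * (g y - g z)) z r
        + (f z * (circ_mean g z r - g z) + g z * (circ_mean f z r - f z))"
      by (simp add: algebra_simps)
    moreover have "\<bar>circ_mean (\<lambda>y. (f y - f z) * (g y - g z)) z r\<bar> \<le> L * L' * r\<^sup>2"
      by (intro circ_mean_bound prod continuous_intros c r0)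
    moreover have "\<bar>f z * (circ_mean g z r - g z)\<bar> \<le> M * (K' * r\<^sup>2)"
      unfolding abs_mult using fz g(4)[OF z] f(3) by (intro mult_mono) auto
    moreover have "\<bar>g z * (circ_mean f z r - f z)\<bar> \<le> M' * (K * r\<^sup>2)"
      unfolding abs_mult using fz f(4)[OF z] g(3) by (intro mult_mono) auto
    moreover have "K2 * r\<^sup>2 = L * L' * r\<^sup>2 + (M * (K' * r\<^sup>2) + M' * (K * r\<^sup>2))"
      by (simp add: K2_def algebra_simps)
    ultimately show "\<bar>circ_mean (\<lambda>x. f x * g x) z r - f z * g z\<bar> \<le> K2 * r\<^sup>2" by linarith
    show "\<bar>f y * g y - f z * g z\<bar> \<le> L2 * r" if y: "y \<in> sphere z r" for y
    proof -
      have b: "\<bar>f y - f z\<bar> \<le> L * r" "\<bar>g y - g z\<bar> \<le> L' * r" using f(4)[OF z] g(4)[OF z] y by blast+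
      have "r\<^sup>2 \<le> r" using z by (simp add: power2_eq_square mult_le_one mult_left_le_one_le)
      then have "L * L' * r\<^sup>2 \<le> L * L' * r" using f(2) g(2) by (intro mult_left_mono) auto
      moreover have "\<bar>f z * (g y - g z)\<bar> \<le> M * (L' * r)"
        unfolding abs_mult using fz b f(3) by (intro mult_mono) auto
      moreover have "\<bar>g z * (f y - f z)\<bar> \<le> M' * (L * r)"
        unfolding abs_mult using fz b g(3) by (intro mult_mono) auto
      moreover have "f y * g y - f z * g z = (f y - f z) * (g y - g z) + (f z * (g y - g z) + g z * (f y - f z))"
        by (simp add: algebra_simps)
      moreover have "L2 * r = L * L' * r + (M * (L' * r) + M' * (L * r))"
        by (simp add: L2_def algebra_simps)
      ultimately show ?thesis using prod[OF y] by linarith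
    qed
  qed
  note * = this
  have nn: "0 \<le> K2" "0 \<le> L2" "0 \<le> M * M'"
    unfolding K2_def L2_def using f(1-3) g(1-3) by auto
  show ?case
    by (rule exI[of _ K2], rule exI[of _ L2], rule exI[of _ "M * M'"], rule conjI, rule nn(1), rule conjI, rule nn(2), rule conjI, rule nn(3), rule allI, rule allI, rule impI, rule *) simp_all
qed

text \<open>The circle mean of K |y|^2 exceeds its central value by exactly K r^2, which absorbs the
  mean value error of F. So F is the difference of the subharmonic functions F + K |y|^2 and K
  |y|^2.\<close>

lemma harm_extension_polynomial:
  assumes S: "open S" "bounded S" "S \<noteq> {}"
    and bar: "\<And>p. p \<in> frontier S \<Longrightarrow> \<exists>b. barrier S p b"
    and F: "real_polynomial_function F"
  shows "\<exists>u. harm_extension S F u"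
proof -
  obtain B where B: "\<And>x. x \<in> S \<Longrightarrow> cmod x \<le> B" using S(2) unfolding bounded_iff by blast
  obtain K L M where K: "0 \<le> K" "\<And>z r. cmod z \<le> B \<Longrightarrow> 0 < r \<Longrightarrow> r < 1 \<Longrightarrow> \<bar>circ_mean F z r - F z\<bar> \<le> K * r\<^sup>2"
    using real_polynomial_circ_mean[OF F, of B] by metis
  have cF: "continuous_on UNIV F"
    using F by (auto intro!: continuous_on_polymonial_function simp: real_polynomial_function_eq)
  let ?q = "\<lambda>y. K * (cmod y)\<^sup>2"
  have cq: "continuous_on UNIV ?q" by (intro continuous_intros)
  have 1: "submean ?q S"
    unfolding submean_def circ_mean_cmult using K(1)
    by (intro ballI exI[of _ 1]) (auto simp: circ_mean_norm_square intro!: mult_left_mono)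
  have 2: "submean (\<lambda>y. F y + ?q y) S"
    unfolding submean_def
  proof (intro ballI exI[of _ 1] conjI allI impI)
    fix z r :: _ assume z: "z \<in> S" and r: "0 < r \<and> r < (1::real)"
    have "circ_mean (\<lambda>y. F y + ?q y) z r = circ_mean F z r + K * ((cmod z)\<^sup>2 + r\<^sup>2)"
      using r by (subst circ_mean_add[OF cF cq]) (simp_all add: circ_mean_cmult circ_mean_norm_square)
    moreover have "\<bar>circ_mean F z r - F z\<bar> \<le> K * r\<^sup>2" using K(2)[OF B[OF z]] r by blast
    ultimately show "F z + K * (cmod z)\<^sup>2 \<le> circ_mean (\<lambda>y. F y + ?q y) z r"
      unfolding distrib_left by linarith
  qed simp
  have c2: "continuous_on UNIV (\<lambda>y. F y + ?q y)" by (intro continuous_intros cF)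
  obtain u v where "harm_extension S ?q u" "harm_extension S (\<lambda>y. F y + ?q y) v"
    using harm_extension_submean[OF S bar cq 1] harm_extension_submean[OF S bar c2 2] by blast
  from harm_extension_diff[OF this(2,1)] show ?thesis by auto
qed

text \<open>Polynomials approximate f uniformly on the frontier (Stone-Weierstrass), and the maximum
  principle carries the uniform Cauchy property of their extensions to the closure.\<close>

theorem harm_extension_exists:
  assumes S: "open S" "bounded S" "S \<noteq> {}"
    and bar: "\<And>p. p \<in> frontier S \<Longrightarrow> \<exists>b. barrier S p b"
    and f: "continuous_on (frontier S) f"
  shows "\<exists>u. harm_extension S f u"
proof -
  have comp: "compact (frontier S)" using S(2) by (rule compact_frontier_bounded)
  have "\<exists>g. real_polynomial_function g \<and> (\<forall>x\<in>frontier S. \<bar>f x - g x\<bar> < inverse (real (Suc n)))" for n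
  proof -
    have "0 < inverse (real (Suc n))" by simp
    from Stone_Weierstrass_real_polynomial_function[OF comp f this] show ?thesis by metis
  qed
  then obtain g where g: "\<And>n. real_polynomial_function (g n)" "\<And>n x. x \<in> frontier S \<Longrightarrow> \<bar>f x - g n x\<bar> < inverse (real (Suc n))"
    by metis
  have "\<exists>u. harm_extension S (g n) u" for n
    using harm_extension_polynomial[OF S bar g(1)] by blast
  then obtain v where v: "\<And>n. harm_extension S (g n) (v n)" by metis
  have est: "v m x - v n x \<le> inverse (real (Suc m)) + inverse (real (Suc n))" if "x \<in> closure S" for m n x
  proof (rule harm_extension_le[OF harm_extension_diff[OF v v] S(1,2) _ that])
    show "g m y - g n y \<le> inverse (real (Suc m)) + inverse (real (Suc n))" if "y \<in> frontier S" for y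
      using g(2)[OF that, of m] g(2)[OF that, of n] by linarith
  qed
  have "\<exists>u. \<forall>e>0. \<exists>N. \<forall>n x. N \<le> n \<and> x \<in> closure S \<longrightarrow> dist (v n x) (u x) < e"
    unfolding uniformly_convergent_eq_cauchy
  proof (intro allI impI)
    fix e :: real assume "e > 0"
    then obtain N where N: "inverse (real (Suc N)) < e / 2" using reals_Archimedean[of "e / 2"] by auto
    have "inverse (real (Suc n)) \<le> inverse (real (Suc N))" if "N \<le> n" for n
      using that by (intro le_imp_inverse_le) auto
    then have "dist (v m x) (v n x) < e" if "N \<le> m" "N \<le> n" "x \<in> closure S" for m n x
      using est[OF that(3), of m n] est[OF that(3), of n m] N that(1,2) unfolding dist_real_def
      by (smt (verit) field_sum_of_halves)
    then show "\<exists>N. \<forall>m n x. N \<le> m \<and> N \<le> n \<and> x \<in> closure S \<longrightarrow> dist (v m x) (v n x) < e" by blast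
  qed
  then obtain u where u: "\<And>e. e > 0 \<Longrightarrow> \<exists>N. \<forall>n x. N \<le> n \<and> x \<in> closure S \<longrightarrow> dist (v n x) (u x) < e" by blast
  have lim: "uniform_limit (closure S) v u sequentially"
    unfolding uniform_limit_sequentially_iff using u by blast
  have vv: "continuous_on (closure S) (v n)" "harm (v n) S" "\<And>x. x \<in> frontier S \<Longrightarrow> v n x = g n x" for n
    using v[of n] by (auto simp: harm_extension_def)
  have "continuous_on (closure S) u"
    by (rule uniform_limit_theorem[OF _ lim]) (use vv in auto)
  moreover have "harm u S"
    by (rule harm_uniform_limit[OF vv(2) uniform_limit_on_subset[OF lim closure_subset]])
  moreover have "u x = f x" if x: "x \<in> frontier S" for x
  proof -
    have "x \<in> closure S" using x by (simp add: frontier_def)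
    then have "(\<lambda>n. v n x) \<longlonglongrightarrow> u x" by (rule tendsto_uniform_limitI[OF lim])
    moreover have "(\<lambda>n. v n x) \<longlonglongrightarrow> f x"
    proof (rule Lim_null[THEN iffD2], rule Lim_null_comparison[OF _ LIMSEQ_inverse_real_of_nat])
      show "\<forall>\<^sub>F n in sequentially. norm (v n x - f x) \<le> inverse (real (Suc n))"
        using g(2)[OF x] vv(3)[OF x] by (intro always_eventually allI) (simp add: abs_minus_commute less_imp_le)
    qed
    ultimately show ?thesis by (rule LIMSEQ_unique)
  qed
  ultimately show ?thesis unfolding harm_extension_def by blast
qed

section \<open>Representation of positive functionals\<close>

text \<open>Even and 2-periodic, 0 on [0, 1/3] and 1 on [2/3, 1]. A clipped cosine replaces the
  usual piecewise linear function, so that continuity and periodicity are immediate.\<close>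

definition hat :: "real \<Rightarrow> real" where
  "hat s = max 0 (min 1 (1 / 2 - cos (pi * s)))"

lemma hat_bounds: "0 \<le> hat s" "hat s \<le> 1"
  by (auto simp: hat_def)

lemma continuous_on_hat [continuous_intros]: "continuous_on A f \<Longrightarrow> continuous_on A (\<lambda>x. hat (f x))"
  for f :: "real \<Rightarrow> real"
  unfolding hat_def by (intro continuous_intros continuous_on_cos)

lemma hat_periodic: "hat (2 * real N + s) = hat s"
proof -
  have "cos (pi * (2 * real N + s)) = cos (pi * s)"
    using cos_2npi[of N] sin_2npi[of N] by (simp add: distrib_left cos_add mult_ac)
  then show ?thesis by (simp add: hat_def)
qed

lemma hat_low: "0 \<le> s \<Longrightarrow> s \<le> 1 / 3 \<Longrightarrow> hat s = 0"
proof -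
  assume s: "0 \<le> s" "s \<le> 1 / 3"
  have "pi * s \<le> pi * (1 / 3)" using s by (intro mult_left_mono) auto
  then have "cos (pi / 3) \<le> cos (pi * s)" using s by (intro cos_monotone_0_pi_le) auto
  then show ?thesis by (simp add: hat_def cos_60)
qed

lemma hat_high: "2 / 3 \<le> s \<Longrightarrow> s \<le> 1 \<Longrightarrow> hat s = 1"
proof -
  assume s: "2 / 3 \<le> s" "s \<le> 1"
  have "pi * (1 - s) \<le> pi * (1 / 3)" using s by (intro mult_left_mono) auto
  then have "cos (pi / 3) \<le> cos (pi * (1 - s))" using s by (intro cos_monotone_0_pi_le) auto
  moreover have "cos (pi * (1 - s)) = - cos (pi * s)"
    by (simp add: right_diff_distrib)
  ultimately show ?thesis by (simp add: hat_def cos_60)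
qed

definition schoenberg :: "nat \<Rightarrow> real \<Rightarrow> real" where
  "schoenberg j t = (\<Sum>n. hat (3 ^ (2 * n + j) * t) / 2 ^ Suc n)"

lemma summable_half_Suc: "summable (\<lambda>n. 1 / 2 ^ Suc n :: real)"
  using summable_mult[OF summable_geometric[of "1/2::real"], of "1/2"] by (simp add: power_divide)

lemma continuous_on_schoenberg: "continuous_on UNIV (schoenberg j)"
proof -
  have "uniform_limit UNIV (\<lambda>n t. \<Sum>i<n. hat (3 ^ (2 * i + j) * t) / 2 ^ Suc i) (schoenberg j) sequentially"
    unfolding schoenberg_def
    by (rule Weierstrass_m_test[OF _ summable_half_Suc]) (simp add: hat_bounds divide_right_mono)
  then show ?thesis
  proof (rule uniform_limit_theorem[rotated])
    show "\<forall>\<^sub>F n in sequentially. continuous_on UNIV (\<lambda>t. \<Sum>i<n. hat (3 ^ (2 * i + j) * t) / 2 ^ Suc i)"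
      by (intro always_eventually allI continuous_intros) auto
  qed simp
qed

text \<open>Schoenberg's curve: if the ternary expansion of t has the digits 2 a(0), 2 a(1), ... then the
  coordinate functions read off the binary expansions with digits a(j), a(2 + j), ...\<close>

lemma schoenberg_digits:
  assumes a: "\<And>k. a k = 0 \<or> a k = (1::nat)"
  obtains t where "0 \<le> t" "t \<le> 1" "\<And>j. schoenberg j t = (\<Sum>n. real (a (2 * n + j)) / 2 ^ Suc n)"
proof -
  \<comment> \<open>\<open>T m\<close> is the ternary number whose digits are those of
    \<open>T 0\<close> shifted by m places. The digits being 0 or 2, 3 ^ m * T 0 and T m differ by
    an even integer, a period of \<open>hat\<close>.\<close>
  define T where "T m = (\<Sum>k. 2 * real (a (k + m)) / 3 ^ Suc k)" for m
  have a1: "real (a k) \<le> 1" for k using a[of k] by auto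
  have g: "(\<lambda>k. 2 / 3 ^ Suc k :: real) sums 1"
    using sums_mult[OF geometric_sums[of "1/3::real"], of "2/3"] by (simp add: power_divide)
  have sm: "summable (\<lambda>k. 2 * real (a (k + m)) / 3 ^ Suc k)" for m
    by (rule summable_comparison_test'[OF sums_summable[OF g], of 0]) (use a1 in \<open>simp add: divide_right_mono\<close>)
  have T0: "0 \<le> T m" for m
    unfolding T_def by (intro suminf_nonneg sm) simp
  have T1: "T m \<le> 1" for m
    unfolding T_def using sums_unique[OF g] suminf_le[OF _ sm sums_summable[OF g], of m] a1 by (simp add: divide_right_mono)
  have TS: "3 * T m = 2 * real (a m) + T (Suc m)" for m
  proof -
    have "T m = 2 * real (a m) / 3 + (\<Sum>k. 2 * real (a (Suc k + m)) / 3 ^ Suc (Suc k))"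
      unfolding T_def using suminf_split_head[OF sm[of m]] by simp
    also have "(\<Sum>k. 2 * real (a (Suc k + m)) / 3 ^ Suc (Suc k)) = (\<Sum>k. (1 / 3) * (2 * real (a (k + Suc m)) / 3 ^ Suc k))"
      by (intro suminf_cong) simp
    also have "\<dots> = 1 / 3 * T (Suc m)"
      unfolding T_def by (rule suminf_mult[OF sm])
    finally show ?thesis by simp
  qed
  have "\<exists>N. 3 ^ m * T 0 = 2 * real N + T m" for m
  proof (induction m)
    case 0 show ?case by (intro exI[of _ 0]) simp
  next
    case (Suc m)
    then obtain N where N: "3 ^ m * T 0 = 2 * real N + T m" by blast
    have "3 ^ Suc m * T 0 = 6 * real N + 3 * T m" using N by simp
    also have "\<dots> = 2 * real (3 * N + a m) + T (Suc m)" unfolding TS by simp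
    finally show ?case by blast
  qed
  then have hat_eq: "hat (3 ^ m * T 0) = hat (T m)" for m
    using hat_periodic by metis
  \<comment> \<open>Leading digit 0 puts \<open>T m\<close> in [0, 1/3], leading digit 2 puts it in
    [2/3, 1].\<close>
  have hat_a: "hat (T m) = real (a m)" for m
    using a[of m] TS[of m] T0[of "Suc m"] T1[of "Suc m"] hat_low[of "T m"] hat_high[of "T m"] by auto
  show ?thesis
    by (rule that[of "T 0", OF T0 T1]) (simp add: schoenberg_def hat_eq hat_a)
qed

lemma binary_expansion:
  assumes "0 \<le> x" "x < (1::real)"
  obtains b :: "nat \<Rightarrow> nat" where "\<And>n. b n = 0 \<or> b n = 1" "(\<lambda>n. real (b n) / 2 ^ Suc n) sums x"
proof -
  define F where "F n = \<lfloor>2 ^ n * x\<rfloor>" for n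
  define b where "b n = nat (F (Suc n) - 2 * F n)" for n
  have F: "F (Suc n) - 2 * F n = 0 \<or> F (Suc n) - 2 * F n = 1" for n
  proof -
    have "2 ^ Suc n * x = 2 * (2 ^ n * x)" by simp
    then show ?thesis unfolding F_def by linarith
  qed
  have b01: "b n = 0 \<or> b n = 1" and b_real: "real (b n) = of_int (F (Suc n)) - 2 * of_int (F n)" for n
    using F[of n] by (auto simp: b_def)
  have part: "(\<Sum>i<n. real (b i) / 2 ^ Suc i) = of_int (F n) / 2 ^ n" for n
  proof (induction n)
    case 0
    have "F 0 = 0" unfolding F_def using assms by (simp add: floor_eq_iff)
    then show ?case by simp
  next
    case (Suc n)
    then show ?case by (simp add: b_real field_simps)
  qed
  have lim: "(\<lambda>n. of_int (F n) / 2 ^ n) \<longlonglongrightarrow> x"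
  proof (rule Lim_null[THEN iffD2], rule Lim_null_comparison)
    have "norm (of_int (F n) / 2 ^ n - x) \<le> (1 / 2) ^ n" for n
    proof -
      have "\<bar>of_int (F n) - 2 ^ n * x\<bar> \<le> 1" unfolding F_def by linarith
      moreover have "of_int (F n) / 2 ^ n - x = (of_int (F n) - 2 ^ n * x) / 2 ^ n" by (simp add: field_simps)
      ultimately show ?thesis by (simp add: power_divide divide_right_mono)
    qed
    then show "\<forall>\<^sub>F n in sequentially. norm (of_int (F n) / 2 ^ n - x) \<le> (1 / 2) ^ n" by simp
    show "(\<lambda>n. (1 / 2) ^ n :: real) \<longlonglongrightarrow> 0" by (rule LIMSEQ_power_zero) simp
  qed
  show ?thesis
    by (rule that[of b, OF b01]) (use part lim in \<open>simp add: sums_def\<close>)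
qed

text \<open>Two binary expansions are interleaved, even places for the real part and odd ones for
  the imaginary part. The strict bound cmod z < B puts both rescaled coordinates into [0, 1), as the
  expansion requires.\<close>

lemma space_filling_curve:
  fixes K :: "complex set"
  assumes "bounded K"
  obtains p :: "real \<Rightarrow> complex" where "continuous_on UNIV p" "\<And>z. z \<in> K \<Longrightarrow> \<exists>t. 0 \<le> t \<and> t \<le> 1 \<and> p t = z"
proof -
  obtain B where B: "B > 0" "\<And>z. z \<in> K \<Longrightarrow> cmod z < B"
    using assms bounded_pos_less by metis
  define p where "p t = Complex (2 * B * schoenberg 0 t - B) (2 * B * schoenberg 1 t - B)" for t
  have "continuous_on UNIV p"
    unfolding p_def Complex_eq
    by (intro continuous_intros continuous_on_compose2[OF continuous_on_schoenberg]) auto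
  moreover have "\<exists>t. 0 \<le> t \<and> t \<le> 1 \<and> p t = z" if z: "z \<in> K" for z
  proof -
    have "\<bar>Re z\<bar> < B" "\<bar>Im z\<bar> < B" using B(2)[OF z] abs_Re_le_cmod[of z] abs_Im_le_cmod[of z] by linarith+
    then have r: "0 \<le> (Re z + B) / (2 * B)" "(Re z + B) / (2 * B) < 1" "0 \<le> (Im z + B) / (2 * B)" "(Im z + B) / (2 * B) < 1"
      using B(1) by (auto simp: field_simps)
    obtain b :: "nat \<Rightarrow> nat" where b: "\<And>n. b n = 0 \<or> b n = 1" "(\<lambda>n. real (b n) / 2 ^ Suc n) sums ((Re z + B) / (2 * B))"
      using binary_expansion[OF r(1,2)] by blast
    obtain c :: "nat \<Rightarrow> nat" where c: "\<And>n. c n = 0 \<or> c n = 1" "(\<lambda>n. real (c n) / 2 ^ Suc n) sums ((Im z + B) / (2 * B))"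
      using binary_expansion[OF r(3,4)] by blast
    define a where "a k = (if even k then b (k div 2) else c (k div 2))" for k
    have "a k = 0 \<or> a k = 1" for k using b(1) c(1) by (simp add: a_def)
    then obtain t where t01: "0 \<le> t" "t \<le> 1" and t: "\<And>j. schoenberg j t = (\<Sum>n. real (a (2 * n + j)) / 2 ^ Suc n)"
      using schoenberg_digits by blast
    have "schoenberg 0 t = (Re z + B) / (2 * B)" "schoenberg 1 t = (Im z + B) / (2 * B)"
      using sums_unique[OF b(2)] sums_unique[OF c(2)] by (simp_all add: t a_def)
    then have "p t = z" using B(1) by (simp add: p_def complex_eq_iff)
    then show ?thesis using t01 by blast
  qed
  ultimately show ?thesis by (rule that)
qed

text \<open>The functional acts on total functions; \<open>mono\<close> compares them on K alone and
  so also says that, for functions continuous on K, values off K have no influence.\<close>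

locale positive_functional =
  fixes K :: "complex set" and L :: "(complex \<Rightarrow> real) \<Rightarrow> real"
  assumes compact: "compact K"
    and add: "\<And>f g. continuous_on K f \<Longrightarrow> continuous_on K g \<Longrightarrow> L (\<lambda>x. f x + g x) = L f + L g"
    and cmult: "\<And>c f. continuous_on K f \<Longrightarrow> L (\<lambda>x. c * f x) = c * L f"
    and mono: "\<And>f g. continuous_on K f \<Longrightarrow> continuous_on K g \<Longrightarrow> (\<And>x. x \<in> K \<Longrightarrow> f x \<le> g x) \<Longrightarrow> L f \<le> L g"
    and one: "L (\<lambda>x. 1) = 1"
begin

lemma const: "L (\<lambda>x. c) = c"
  using cmult[of "\<lambda>x. 1" c] one by simp

lemma sum:
  "finite Z \<Longrightarrow> (\<And>z. z \<in> Z \<Longrightarrow> continuous_on K (f z)) \<Longrightarrow> L (\<lambda>x. \<Sum>z\<in>Z. c z * f z x) = (\<Sum>z\<in>Z. c z * L (f z))"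
proof (induction Z rule: finite_induct)
  case empty show ?case using const[of 0] by simp
next
  case (insert a Z)
  have "L (\<lambda>x. c a * f a x + (\<Sum>z\<in>Z. c z * f z x)) = L (\<lambda>x. c a * f a x) + L (\<lambda>x. \<Sum>z\<in>Z. c z * f z x)"
    using insert.prems by (intro add continuous_intros) auto
  then show ?case using insert cmult[of "f a" "c a"] by simp
qed

text \<open>The functional applied to a partition of unity subordinate to balls of radius e gives
  nonnegative weights of sum 1. The error is the oscillation of f at scale e, since f x - f z only
  counts where x is within e of z.\<close>

lemma finite_approximation:
  assumes e: "0 < e"
  obtains Z w where "finite Z" "Z \<subseteq> K" "\<And>z. z \<in> Z \<Longrightarrow> 0 \<le> w z" "sum w Z = 1"
    "\<And>f \<eta>. continuous_on K f \<Longrightarrow> (\<And>x y. x \<in> K \<Longrightarrow> y \<in> K \<Longrightarrow> dist x y < e \<Longrightarrow> \<bar>f x - f y\<bar> \<le> \<eta>) \<Longrightarrow>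
      \<bar>L f - (\<Sum>z\<in>Z. w z * f z)\<bar> \<le> \<eta>"
proof -
  obtain Z where Z: "finite Z" "Z \<subseteq> K" "K \<subseteq> (\<Union>z\<in>Z. ball z e)"
    using compact e compact_imp_seq_compact seq_compact_imp_totally_bounded by metis
  define \<psi> where "\<psi> z x = max 0 (e - dist x z)" for z x :: complex
  define \<phi> where "\<phi> z x = \<psi> z x / (\<Sum>y\<in>Z. \<psi> y x)" for z x
  have \<psi>: "0 \<le> \<psi> z x" for z x by (simp add: \<psi>_def)
  have c\<psi>: "continuous_on K (\<psi> z)" for z unfolding \<psi>_def by (intro continuous_intros)
  have pos: "0 < (\<Sum>y\<in>Z. \<psi> y x)" if x: "x \<in> K" for x
  proof -
    obtain y where "y \<in> Z" "dist y x < e" using Z(3) x by auto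
    then have "0 < \<psi> y x" "y \<in> Z" by (simp_all add: \<psi>_def dist_commute)
    then show ?thesis using Z(1) \<psi> by (intro sum_pos2[of Z y]) auto
  qed
  have c\<phi>: "continuous_on K (\<phi> z)" for z
    unfolding \<phi>_def using pos by (intro continuous_intros c\<psi>) force
  have \<phi>0: "0 \<le> \<phi> z x" if "x \<in> K" for z x
    unfolding \<phi>_def using \<psi> pos[OF that] by simp
  have \<phi>1: "(\<Sum>z\<in>Z. \<phi> z x) = 1" if "x \<in> K" for x
    unfolding \<phi>_def using pos[OF that] by (simp flip: sum_divide_distrib)
  define w where "w z = L (\<phi> z)" for z
  have w0: "0 \<le> w z" for z
    unfolding w_def using mono[of "\<lambda>x. 0" "\<phi> z"] const[of 0] \<phi>0 c\<phi> by simp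
  have "L (\<lambda>x. \<Sum>z\<in>Z. 1 * \<phi> z x) = (\<Sum>z\<in>Z. 1 * L (\<phi> z))"
    by (rule sum[OF Z(1) c\<phi>])
  moreover have "L (\<lambda>x. \<Sum>z\<in>Z. 1 * \<phi> z x) = L (\<lambda>x. 1)"
    using \<phi>1 by (intro antisym mono continuous_intros c\<phi>) auto
  ultimately have w1: "sum w Z = 1" by (simp add: w_def one)
  have est: "\<bar>L f - (\<Sum>z\<in>Z. w z * f z)\<bar> \<le> \<eta>"
    if f: "continuous_on K f" and osc: "\<And>x y. x \<in> K \<Longrightarrow> y \<in> K \<Longrightarrow> dist x y < e \<Longrightarrow> \<bar>f x - f y\<bar> \<le> \<eta>" for f \<eta>
  proof -
    let ?g = "\<lambda>x. \<Sum>z\<in>Z. f z * \<phi> z x"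
    have cg: "continuous_on K ?g" by (intro continuous_intros c\<phi>)
    have Lg: "L ?g = (\<Sum>z\<in>Z. w z * f z)"
      using sum[OF Z(1) c\<phi>, of f] by (simp add: w_def mult.commute)
    have pt: "\<bar>f x - ?g x\<bar> \<le> \<eta>" if x: "x \<in> K" for x
    proof -
      have "f x - ?g x = (\<Sum>z\<in>Z. (f x - f z) * \<phi> z x)"
        using \<phi>1[OF x] by (simp add: left_diff_distrib sum_subtractf flip: sum_distrib_left)
      also have "\<bar>\<dots>\<bar> \<le> (\<Sum>z\<in>Z. \<bar>(f x - f z) * \<phi> z x\<bar>)" by (rule sum_abs)
      also have "\<dots> \<le> (\<Sum>z\<in>Z. \<eta> * \<phi> z x)"
      proof (rule sum_mono)
        fix z assume z: "z \<in> Z"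
        show "\<bar>(f x - f z) * \<phi> z x\<bar> \<le> \<eta> * \<phi> z x"
        proof (cases "dist x z < e")
          case True
          then have "\<bar>f x - f z\<bar> \<le> \<eta>" using osc x z Z(2) by blast
          then show ?thesis using \<phi>0[OF x, of z] by (simp add: abs_mult mult_right_mono)
        next
          case False
          then have "\<phi> z x = 0" by (simp add: \<phi>_def \<psi>_def)
          then show ?thesis by simp
        qed
      qed
      also have "\<dots> = \<eta>" using \<phi>1[OF x] by (simp flip: sum_distrib_left)
      finally show ?thesis .
    qed
    have "L f \<le> L (\<lambda>x. ?g x + \<eta>)"
    proof (rule mono[OF f])
      show "continuous_on K (\<lambda>x. ?g x + \<eta>)" by (intro continuous_intros cg)
      show "f x \<le> ?g x + \<eta>" if "x \<in> K" for x using pt[OF that] by linarith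
    qed
    moreover have "L ?g \<le> L (\<lambda>x. f x + \<eta>)"
    proof (rule mono[OF cg])
      show "continuous_on K (\<lambda>x. f x + \<eta>)" by (intro continuous_intros f)
      show "?g x \<le> f x + \<eta>" if "x \<in> K" for x using pt[OF that] by linarith
    qed
    moreover have "L (\<lambda>x. ?g x + \<eta>) = L ?g + \<eta>" "L (\<lambda>x. f x + \<eta>) = L f + \<eta>"
      using add[OF cg continuous_on_const] add[OF f continuous_on_const] const by simp_all
    ultimately show ?thesis using Lg by linarith
  qed
  show ?thesis by (rule that[OF Z(1,2) w0 w1 est])
qed

text \<open>Riesz representation: finitely supported approximations of the functional are lifted to the
  real line along a space filling curve, where Helly's selection theorem applies.\<close>

theorem representation:
  obtains M where "prob_space M" "sets M = sets (restrict_space borel K)"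
    "\<And>f. continuous_on K f \<Longrightarrow> L f = (\<integral>x. f x \<partial>M)"
proof -
  have closed: "closed K" using compact by (rule compact_imp_closed)
  have nonempty: "K \<noteq> {}"
  proof
    assume "K = {}"
    then have "L (\<lambda>x. 1) \<le> L (\<lambda>x. 0)" by (intro mono) auto
    then show False using const[of 0] const[of 1] by simp
  qed
  have L_cong: "L f = L g" if "continuous_on K f" "continuous_on K g" "\<And>x. x \<in> K \<Longrightarrow> f x = g x" for f g
    by (rule antisym) (rule mono; use that in simp)+
  obtain p :: "real \<Rightarrow> complex" where p: "continuous_on UNIV p" "\<And>z. z \<in> K \<Longrightarrow> \<exists>t. 0 \<le> t \<and> t \<le> 1 \<and> p t = z"
    using space_filling_curve[OF compact_imp_bounded[OF compact]] by blast
  have pm [measurable]: "p \<in> borel_measurable borel"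
    using p(1) by (rule borel_measurable_continuous_onI)
  \<comment> \<open>A right inverse of the curve on K, without any regularity: it is used on
    finitely many points for each n, and every subset of those is measurable for
    \<open>point_measure\<close>.\<close>
  obtain \<tau> where \<tau>: "\<And>z. z \<in> K \<Longrightarrow> 0 \<le> \<tau> z" "\<And>z. z \<in> K \<Longrightarrow> \<tau> z \<le> 1" "\<And>z. z \<in> K \<Longrightarrow> p (\<tau> z) = z"
    using p(2) by metis
  have "\<forall>n. \<exists>q. finite (fst q) \<and> fst q \<subseteq> K \<and> (\<forall>z\<in>fst q. 0 \<le> snd q z) \<and> sum (snd q) (fst q) = 1 \<and>
    (\<forall>f \<eta>. continuous_on K f \<longrightarrow> (\<forall>x\<in>K. \<forall>y\<in>K. dist x y < inverse (real (Suc n)) \<longrightarrow> \<bar>f x - f y\<bar> \<le> \<eta>) \<longrightarrow>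
      \<bar>L f - (\<Sum>z\<in>fst q. snd q z * f z)\<bar> \<le> \<eta>)"
  proof
    fix n
    show "\<exists>q. finite (fst q) \<and> fst q \<subseteq> K \<and> (\<forall>z\<in>fst q. 0 \<le> snd q z) \<and> sum (snd q) (fst q) = 1 \<and>
      (\<forall>f \<eta>. continuous_on K f \<longrightarrow> (\<forall>x\<in>K. \<forall>y\<in>K. dist x y < inverse (real (Suc n)) \<longrightarrow> \<bar>f x - f y\<bar> \<le> \<eta>) \<longrightarrow>
        \<bar>L f - (\<Sum>z\<in>fst q. snd q z * f z)\<bar> \<le> \<eta>)"
    proof (rule finite_approximation)
      show "0 < inverse (real (Suc n))" by simp
      fix Z :: "complex set" and w
      assume Zw: "finite Z" "Z \<subseteq> K" "\<And>z. z \<in> Z \<Longrightarrow> 0 \<le> w z" "sum w Z = 1"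
        "\<And>f \<eta>. continuous_on K f \<Longrightarrow> (\<And>x y. x \<in> K \<Longrightarrow> y \<in> K \<Longrightarrow> dist x y < inverse (real (Suc n)) \<Longrightarrow> \<bar>f x - f y\<bar> \<le> \<eta>) \<Longrightarrow>
          \<bar>L f - (\<Sum>z\<in>Z. w z * f z)\<bar> \<le> \<eta>"
      show ?thesis
        by (rule exI[of _ "(Z, w)"]) (simp only: fst_conv snd_conv, intro conjI ballI allI impI Zw; blast)
    qed
  qed
  from choice[OF this] obtain q where q: "\<forall>n. finite (fst (q n)) \<and> fst (q n) \<subseteq> K \<and> (\<forall>z\<in>fst (q n). 0 \<le> snd (q n) z) \<and> sum (snd (q n)) (fst (q n)) = 1 \<and>
    (\<forall>f \<eta>. continuous_on K f \<longrightarrow> (\<forall>x\<in>K. \<forall>y\<in>K. dist x y < inverse (real (Suc n)) \<longrightarrow> \<bar>f x - f y\<bar> \<le> \<eta>) \<longrightarrow>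
      \<bar>L f - (\<Sum>z\<in>fst (q n). snd (q n) z * f z)\<bar> \<le> \<eta>)" ..
  define Z w where "Z n = fst (q n)" and "w n = snd (q n)" for n
  have Zw: "finite (Z n)" "Z n \<subseteq> K" "\<And>z. z \<in> Z n \<Longrightarrow> 0 \<le> w n z" "sum (w n) (Z n) = 1"
    "\<And>f \<eta>. continuous_on K f \<Longrightarrow> \<forall>x\<in>K. \<forall>y\<in>K. dist x y < inverse (real (Suc n)) \<longrightarrow> \<bar>f x - f y\<bar> \<le> \<eta> \<Longrightarrow>
      \<bar>L f - (\<Sum>z\<in>Z n. w n z * f z)\<bar> \<le> \<eta>" for n
    using spec[OF q, of n] unfolding Z_def w_def by blast+
  define P where "P n = point_measure (Z n) (\<lambda>z. ennreal (w n z))" for n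
  have P_space: "space (P n) = Z n" for n by (simp add: P_def space_point_measure)
  have P_prob: "prob_space (P n)" for n
  proof (rule prob_spaceI)
    have "emeasure (P n) (Z n) = (\<Sum>z\<in>Z n. ennreal (w n z))"
      unfolding P_def by (rule emeasure_point_measure_finite) (use Zw in auto)
    also have "\<dots> = ennreal (sum (w n) (Z n))"
      by (rule sum_ennreal) (use Zw in auto)
    finally show "emeasure (P n) (space (P n)) = 1" by (simp add: P_space Zw(4))
  qed
  have \<tau>m [measurable]: "\<tau> \<in> borel_measurable (P n)" for n
    by (simp add: P_def measurable_point_measure_eq1)
  define \<mu> where "\<mu> n = distr (P n) borel \<tau>" for n
  have \<mu>_dist: "real_distribution (\<mu> n)" for n
    unfolding \<mu>_def by (rule prob_space.real_distribution_distr[OF P_prob \<tau>m])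
  have \<mu>_int: "(\<integral>t. h (p t) \<partial>\<mu> n) = (\<Sum>z\<in>Z n. w n z * h z)" if "continuous_on UNIV h" for h :: "complex \<Rightarrow> real" and n
  proof -
    have [measurable]: "h \<in> borel_measurable borel"
      using that by (rule borel_measurable_continuous_onI)
    have "(\<integral>t. h (p t) \<partial>\<mu> n) = (\<integral>z. h (p (\<tau> z)) \<partial>P n)"
      unfolding \<mu>_def by (rule integral_distr) measurable
    also have "\<dots> = (\<Sum>z\<in>Z n. w n z *\<^sub>R h (p (\<tau> z)))"
      unfolding P_def by (rule lebesgue_integral_point_measure_finite) (use Zw in auto)
    also have "\<dots> = (\<Sum>z\<in>Z n. w n z * h z)"
      using Zw(2)[of n] \<tau>(3) by (intro sum.cong) auto
    finally show ?thesis .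
  qed
  \<comment> \<open>Every measure is carried by [0, 1], which lies in the half-open interval (-1,
    1].\<close>
  have "tight \<mu>"
    unfolding tight_def
  proof (intro conjI allI impI \<mu>_dist)
    fix \<epsilon> :: real assume \<epsilon>: "0 < \<epsilon>"
    have "measure (\<mu> n) {-1<..1} = 1" for n
    proof -
      have "measure (\<mu> n) {-1<..1} = measure (P n) (\<tau> -` {-1<..1} \<inter> space (P n))"
        unfolding \<mu>_def by (rule measure_distr) measurable
      also have "\<tau> -` {-1<..1} \<inter> space (P n) = space (P n)"
        using \<tau>(1,2) Zw(2)[of n] by (force simp: P_space)
      finally show ?thesis using prob_space.prob_space[OF P_prob] by simp
    qed
    then show "\<exists>a b. a < b \<and> (\<forall>n. 1 - \<epsilon> < measure (\<mu> n) {a<..b})"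
      using \<epsilon> by (intro exI[of _ "-1"] exI[of _ "1"]) simp
  qed
  then have "\<exists>r M. strict_mono (r :: nat \<Rightarrow> nat) \<and> real_distribution M \<and> weak_conv_m (\<mu> \<circ> id \<circ> r) M"
    by (rule tight_imp_convergent_subsubsequence) (simp add: strict_mono_def)
  then obtain r M where r: "strict_mono (r :: nat \<Rightarrow> nat)" and M: "real_distribution M" and "weak_conv_m (\<mu> \<circ> id \<circ> r) M"
    by blast
  then have weak: "weak_conv_m (\<lambda>n. \<mu> (r n)) M" by (simp add: o_def)
  have sets_M [measurable_cong]: "sets M = sets borel" by (rule real_distribution.events_eq_borel[OF M])
  have prob_M: "prob_space M" using M by (simp add: real_distribution_def)
  have int_M: "(\<integral>t. h (p t) \<partial>M) = L h"
    if h: "continuous_on UNIV h" and B: "\<And>x. \<bar>h x\<bar> \<le> B" for h :: "complex \<Rightarrow> real" and B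
  proof -
    have chp: "continuous_on UNIV (\<lambda>t. h (p t))"
      by (rule continuous_on_compose2[OF h p(1)]) auto
    have "(\<lambda>n. \<integral>t. h (p t) \<partial>\<mu> (r n)) \<longlonglongrightarrow> (\<integral>t. h (p t) \<partial>M)"
    proof (rule weak_conv_imp_integral_bdd_continuous_conv[OF \<mu>_dist M weak])
      show "isCont (\<lambda>t. h (p t)) x" for x
        using chp continuous_on_eq_continuous_at[OF open_UNIV] by blast
      show "norm (h (p x)) \<le> B" for x using B by simp
    qed
    moreover have "(\<lambda>n. \<integral>t. h (p t) \<partial>\<mu> n) \<longlonglongrightarrow> L h"
      unfolding \<mu>_int[OF h]
    proof (rule LIMSEQ_I)
      fix e :: real assume e: "0 < e"
      have hK: "continuous_on K h" by (rule continuous_on_subset[OF h]) simp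
      have "uniformly_continuous_on K h" by (rule compact_uniformly_continuous[OF hK compact])
      then obtain d where d: "d > 0" "\<And>x y. x \<in> K \<Longrightarrow> y \<in> K \<Longrightarrow> dist y x < d \<Longrightarrow> dist (h y) (h x) < e / 2"
        using e unfolding uniformly_continuous_on_def by (metis half_gt_zero)
      obtain N where N: "inverse (real (Suc N)) < d" using reals_Archimedean[OF d(1)] by blast
      have "norm ((\<Sum>z\<in>Z n. w n z * h z) - L h) < e" if "n \<ge> N" for n
      proof -
        have "inverse (real (Suc n)) \<le> inverse (real (Suc N))" using that by (intro le_imp_inverse_le) auto
        then have "\<bar>h x - h y\<bar> \<le> e / 2" if "x \<in> K" "y \<in> K" "dist x y < inverse (real (Suc n))" for x y
          using d(2)[of y x] that N unfolding dist_real_def by linarith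
        then have "\<forall>x\<in>K. \<forall>y\<in>K. dist x y < inverse (real (Suc n)) \<longrightarrow> \<bar>h x - h y\<bar> \<le> e / 2" by blast
        from Zw(5)[OF hK this] show ?thesis using e by (simp add: abs_minus_commute)
      qed
      then show "\<exists>N. \<forall>n\<ge>N. norm ((\<Sum>z\<in>Z n. w n z * h z) - L h) < e" by blast
    qed
    then have "(\<lambda>n. \<integral>t. h (p t) \<partial>\<mu> (r n)) \<longlonglongrightarrow> L h"
      using LIMSEQ_subseq_LIMSEQ[OF _ r] by (fastforce simp: o_def)
    ultimately show ?thesis by (rule LIMSEQ_unique)
  qed
  interpret M: prob_space M by fact
  \<comment> \<open>The limit might charge parameters at which the curve is outside K. The truncated
    distance to K vanishes on K, so its integral is 0, which excludes this.\<close>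
  have "AE t in M. p t \<in> K"
  proof -
    let ?h = "\<lambda>x. min 1 (infdist x K)"
    have ch: "continuous_on UNIV ?h" by (intro continuous_intros)
    have [measurable]: "?h \<in> borel_measurable borel" using ch by (rule borel_measurable_continuous_onI)
    have hb: "\<bar>?h x\<bar> \<le> 1" for x using infdist_nonneg[of x K] by auto
    have "L ?h = L (\<lambda>x. 0)"
      by (rule L_cong) (auto intro: continuous_on_subset[OF ch])
    then have "(\<integral>t. ?h (p t) \<partial>M) = 0"
      using int_M[OF ch hb] const[of 0] by simp
    moreover have "integrable M (\<lambda>t. ?h (p t))"
      by (rule M.integrable_const_bound[of _ 1]) (use hb in auto)
    ultimately have "AE t in M. ?h (p t) = 0"
      using infdist_nonneg by (subst (asm) integral_nonneg_eq_0_iff_AE) auto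
    then show ?thesis
    proof eventually_elim
      case (elim t)
      then have "infdist (p t) K = 0" by (simp add: min_def split: if_splits)
      then show ?case using in_closed_iff_infdist_zero[OF closed nonempty] by blast
    qed
  qed
  define N where "N = distr M borel p"
  have sets_N [measurable_cong, simp]: "sets N = sets borel" by (simp add: N_def)
  interpret N: prob_space N unfolding N_def by (rule M.prob_space_distr) measurable
  have K_borel [measurable]: "K \<in> sets borel" using closed by (rule borel_closed)
  have AE_N: "AE x in N. x \<in> K"
    unfolding N_def using \<open>AE t in M. p t \<in> K\<close> by (subst AE_distr_iff) (auto simp: measurable_cong_sets[OF sets_M refl])
  have 1: "prob_space (restrict_space N K)"
    using N.emeasure_eq_1_AE[OF _ AE_N] by (intro prob_space_restrict_space) auto
  have 2: "sets (restrict_space N K) = sets (restrict_space borel K)"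
    by (rule sets_restrict_space_cong) simp
  have 3: "L f = (\<integral>x. f x \<partial>restrict_space N K)" if f: "continuous_on K f" for f
  proof -
    have "bounded (f ` K)" by (intro compact_imp_bounded compact_continuous_image f compact)
    then obtain B where B: "B > 0" "\<And>x. x \<in> K \<Longrightarrow> norm (f x) \<le> B" unfolding bounded_pos by auto
    \<comment> \<open>The limit identity is available for bounded continuous functions on the plane,
      so f is extended from K with the same bound.\<close>
    have "closedin (top_of_set UNIV) K" using closed by simp
    then obtain g where g: "continuous_on UNIV g" "\<And>x. x \<in> K \<Longrightarrow> g x = f x" "\<And>x. norm (g x) \<le> B"
      using Tietze[OF f _ less_imp_le[OF B(1)] B(2)] by (metis UNIV_I)
    have gm [measurable]: "g \<in> borel_measurable borel" using g(1) by (rule borel_measurable_continuous_onI)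
    have "(\<integral>x. f x \<partial>restrict_space N K) = (\<integral>x. indicator K x *\<^sub>R f x \<partial>N)"
      by (rule integral_restrict_space) simp
    also have "\<dots> = (\<integral>x. indicator K x *\<^sub>R g x \<partial>N)"
      by (intro Bochner_Integration.integral_cong) (auto simp: g(2) indicator_def)
    also have "\<dots> = (\<integral>x. g x \<partial>N)"
      by (intro integral_cong_AE) (use AE_N in \<open>auto elim!: eventually_mono\<close>)
    also have "\<dots> = (\<integral>t. g (p t) \<partial>M)"
      unfolding N_def by (rule integral_distr) measurable
    also have "\<dots> = L g" using int_M[OF g(1), of B] g(3) by simp
    also have "\<dots> = L f" by (rule L_cong) (use g(2) f continuous_on_subset[OF g(1)] in auto)
    finally show ?thesis by simp
  qed
  show ?thesis by (rule that[OF 1 2 3])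
qed

end

text \<open>Indicators of closed sets C are dominated limits of max 0 (1 - n * infdist x C), and
  closed sets are stable under intersection and generate the Borel sets. Pushing both measures to
  the plane along the identity makes this generator available.\<close>

lemma measure_eq_if_continuous_integrals_eq:
  fixes K :: "complex set" and M N :: "complex measure"
  assumes K: "closed K"
    and M: "prob_space M" "sets M = sets (restrict_space borel K)"
    and N: "prob_space N" "sets N = sets (restrict_space borel K)"
    and eq: "\<And>f :: complex \<Rightarrow> real. continuous_on K f \<Longrightarrow> (\<integral>x. f x \<partial>M) = (\<integral>x. f x \<partial>N)"
  shows "M = N"
proof -
  have cf: "continuous_on A (\<lambda>x. max 0 (1 - real n * infdist x C))" for A :: "complex set" and C n
    by (intro continuous_intros)
  have lim: "(\<lambda>n. \<integral>x. max 0 (1 - real n * infdist x C) \<partial>Q) \<longlonglongrightarrow> measure Q (C \<inter> K)"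
    if Q: "prob_space Q" "sets Q = sets (restrict_space borel K)" and C: "closed C" "C \<noteq> {}" for Q and C :: "complex set"
  proof -
    interpret Q: prob_space Q by fact
    have sp: "space Q = K" using sets_eq_imp_space_eq[OF Q(2)] by (simp add: space_restrict_space)
    have mono_m: "f \<in> borel_measurable borel \<Longrightarrow> f \<in> borel_measurable Q" for f :: "complex \<Rightarrow> real"
      using measurable_restrict_space1[of f borel borel K] measurable_cong_sets[OF Q(2) refl] by blast
    have Cm: "C \<inter> K \<in> sets Q"
      using Q(2) C(1) K by (simp add: sets_restrict_space) (metis borel_closed image_eqI inf_commute)
    have "(\<lambda>n. \<integral>x. max 0 (1 - real n * infdist x C) \<partial>Q) \<longlonglongrightarrow> (\<integral>x. indicator (C \<inter> K) x \<partial>Q)"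
    proof (rule integral_dominated_convergence[where w = "\<lambda>_. 1"])
      show "(\<lambda>x. max 0 (1 - real n * infdist x C)) \<in> borel_measurable Q" for n
        by (intro mono_m borel_measurable_continuous_onI cf)
      show "(indicator (C \<inter> K) :: complex \<Rightarrow> real) \<in> borel_measurable Q"
        using Cm by simp
      show "AE x in Q. norm (max 0 (1 - real n * infdist x C)) \<le> 1" for n
        using infdist_nonneg[of _ C] by (intro AE_I2) (simp add: max_def)
      show "AE x in Q. (\<lambda>n. max 0 (1 - real n * infdist x C)) \<longlonglongrightarrow> indicator (C \<inter> K) x"
      proof (rule AE_I2)
        fix x assume "x \<in> space Q"
        then have xK: "x \<in> K" by (simp add: sp)
        show "(\<lambda>n. max 0 (1 - real n * infdist x C)) \<longlonglongrightarrow> indicator (C \<inter> K) x"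
        proof (cases "x \<in> C")
          case True then show ?thesis using xK by simp
        next
          case False
          then have pos: "infdist x C > 0" using infdist_pos_not_in_closed[OF C] by blast
          then obtain k where k: "1 < real k * infdist x C" using reals_Archimedean3[OF pos] by blast
          have "max 0 (1 - real n * infdist x C) = 0" if "n \<ge> k" for n
          proof -
            have "real k * infdist x C \<le> real n * infdist x C" using that pos by (intro mult_right_mono) auto
            then show ?thesis using k by simp
          qed
          then have "\<forall>\<^sub>F n in sequentially. max 0 (1 - real n * infdist x C) = 0"
            unfolding eventually_sequentially by blast
          then show ?thesis using False by (simp add: tendsto_eventually)
        qed
      qed
    qed simp
    then show ?thesis using Cm sets.sets_into_space[OF Cm] by (simp add: sp)
  qed
  have spM: "space M = K" and spN: "space N = K"
    using sets_eq_imp_space_eq[OF M(2)] sets_eq_imp_space_eq[OF N(2)] by (simp_all add: space_restrict_space)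
  have idM [measurable]: "(\<lambda>x. x) \<in> measurable M borel" and idN [measurable]: "(\<lambda>x. x) \<in> measurable N borel"
    using measurable_restrict_space1[of "\<lambda>x::complex. x" borel borel K] measurable_cong_sets[OF M(2) refl] measurable_cong_sets[OF N(2) refl] by auto
  interpret M: prob_space M by fact
  interpret N: prob_space N by fact
  have em: "emeasure (distr M borel (\<lambda>x. x)) A = emeasure M (A \<inter> K)"
     "emeasure (distr N borel (\<lambda>x. x)) A = emeasure N (A \<inter> K)" if "A \<in> sets borel" for A
    using that by (simp_all add: emeasure_distr spM spN)
  have "distr M borel (\<lambda>x. x) = distr N borel (\<lambda>x. x)"
  proof (rule measure_eqI_generator_eq[where \<Omega> = UNIV and E = "Collect closed" and A = "\<lambda>_. UNIV"])
    fix C :: "complex set" assume "C \<in> Collect closed"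
    then have C: "closed C" by simp
    show "emeasure (distr M borel (\<lambda>x. x)) C = emeasure (distr N borel (\<lambda>x. x)) C"
    proof (cases "C = {}")
      case False
      have "(\<lambda>n. \<integral>x. max 0 (1 - real n * infdist x C) \<partial>M) \<longlonglongrightarrow> measure N (C \<inter> K)"
        using lim[OF N C False] by (simp only: eq[OF cf])
      then have "measure M (C \<inter> K) = measure N (C \<inter> K)"
        by (rule LIMSEQ_unique[OF lim[OF M C False]])
      then show ?thesis using C by (simp add: em M.emeasure_eq_measure N.emeasure_eq_measure)
    qed simp
  next
    show "emeasure (distr M borel (\<lambda>x. x)) UNIV \<noteq> \<infinity>" by (simp add: em M.emeasure_eq_measure)
  qed (auto simp: Int_stable_def borel_eq_closed)
  note D = this
  show ?thesis
  proof (rule measure_eqI)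
    show "sets M = sets N" using M N by simp
    fix A assume "A \<in> sets M"
    then have "A \<in> sets borel" "A \<subseteq> K"
      using M(2) K sets_restrict_space_iff[of K borel A] by auto
    then show "emeasure M A = emeasure N A"
      using em[of A] D by (simp add: Int_absorb2)
  qed
qed

section \<open>Pseudohyperbolic geometry\<close>

lemma pseudohyp_denominator:
  assumes "cmod z < 1" "cmod w < 1"
  shows "1 - w * cnj z \<noteq> 0"
proof
  assume "1 - w * cnj z = 0"
  then have "cmod (w * cnj z) = 1" by (metis eq_iff_diff_eq_0 norm_one)
  moreover have "cmod w * cmod z \<le> cmod w * 1" using assms by (intro mult_left_mono) auto
  ultimately show False using assms by (simp add: norm_mult)
qed

lemma pseudohyp_dist_nonneg: "0 \<le> pseudohyp_dist z w"
  by (simp add: pseudohyp_dist_def)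

lemma pseudohyp_dist_commute: "pseudohyp_dist z w = pseudohyp_dist w z"
proof -
  have "cmod (1 - w * cnj z) = cmod (cnj (1 - w * cnj z))" by (rule complex_mod_cnj[symmetric])
  then show ?thesis by (simp add: pseudohyp_dist_def norm_divide norm_minus_commute mult.commute)
qed

lemma pseudohyp_dist_0: "pseudohyp_dist z 0 = cmod z"
  by (simp add: pseudohyp_dist_def)

lemma pseudohyp_identity:
  "(cmod (1 - w * cnj z))\<^sup>2 - (cmod (z - w))\<^sup>2 = (1 - (cmod z)\<^sup>2) * (1 - (cmod w)\<^sup>2)"
  unfolding cmod_power2 by (simp add: power2_eq_square algebra_simps)

lemma pseudohyp_dist_less_1:
  assumes "cmod z < 1" "cmod w < 1"
  shows "pseudohyp_dist z w < 1"
proof -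
  have "0 < (1 - (cmod z)\<^sup>2) * (1 - (cmod w)\<^sup>2)"
    using assms by (intro mult_pos_pos) (simp_all add: power_less_one_iff abs_square_less_1)
  then have "(cmod (z - w))\<^sup>2 < (cmod (1 - w * cnj z))\<^sup>2"
    using pseudohyp_identity[of w z] by linarith
  then have "cmod (z - w) < cmod (1 - w * cnj z)" by (rule power_less_imp_less_base) simp
  then show ?thesis using pseudohyp_denominator[OF assms] by (simp add: pseudohyp_dist_def norm_divide)
qed

text \<open>With \<rho> the pseudohyperbolic distance, 1 - \<rho>^2 = (1 - |z|^2) (1 - |w|^2) / |1 -
  w cnj z|^2, and |1 - w cnj z| >= 1 - |z|; the 4 bounds (1 + |z|) (1 + |w|). Points at bounded
  pseudohyperbolic distance are thus comparably far from the unit circle, which fixes the geometric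
  scales later on.\<close>

lemma pseudohyp_dist_le_imp:
  assumes z: "cmod z < 1" and w: "cmod w < 1" and s: "pseudohyp_dist z w \<le> s" "s \<le> 1"
  shows "(1 - s\<^sup>2) / 4 * (1 - cmod z) \<le> 1 - cmod w"
proof -
  let ?d = "cmod (1 - w * cnj z)"
  have d: "?d > 0" using pseudohyp_denominator[OF z w] by simp
  have "pseudohyp_dist z w * ?d = cmod (z - w)" using d by (simp add: pseudohyp_dist_def norm_divide)
  then have "cmod (z - w) \<le> s * ?d" using s(1) d by (metis mult_right_mono less_imp_le)
  then have "(cmod (z - w))\<^sup>2 \<le> (s * ?d)\<^sup>2" by (intro power_mono) auto
  then have 1: "(1 - s\<^sup>2) * ?d\<^sup>2 \<le> (1 - (cmod z)\<^sup>2) * (1 - (cmod w)\<^sup>2)"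
    using pseudohyp_identity[of w z] by (simp add: power_mult_distrib algebra_simps)
  have s0: "0 \<le> s" using s(1) pseudohyp_dist_nonneg order_trans by blast
  have "cmod (w * cnj z) \<le> cmod z" using z w by (simp add: norm_mult mult_left_le_one_le)
  then have "1 - cmod z \<le> ?d" using norm_triangle_ineq2[of 1 "w * cnj z"] by simp
  then have "(1 - cmod z)\<^sup>2 \<le> ?d\<^sup>2" using z by (intro power_mono) auto
  then have "(1 - s\<^sup>2) * (1 - cmod z)\<^sup>2 \<le> (1 - s\<^sup>2) * ?d\<^sup>2"
    using s s0 by (intro mult_left_mono) (auto simp: power_le_one)
  also note 1
  also have "(1 - (cmod z)\<^sup>2) * (1 - (cmod w)\<^sup>2) = (1 - cmod z) * ((1 + cmod z) * (1 + cmod w) * (1 - cmod w))"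
    by (simp add: power2_eq_square algebra_simps)
  finally have "(1 - s\<^sup>2) * (1 - cmod z) \<le> (1 + cmod z) * (1 + cmod w) * (1 - cmod w)"
    using z by (simp add: power2_eq_square mult.assoc mult.left_commute[of "1 - s * s"])
  also have "\<dots> \<le> 4 * (1 - cmod w)"
  proof -
    have "(1 + cmod z) * (1 + cmod w) \<le> 2 * 2" using z w by (intro mult_mono) auto
    then show ?thesis using w by (intro mult_right_mono) auto
  qed
  finally show ?thesis by simp
qed

text \<open>Completing the square gives |l - z|^2 - r^2 |1 - z cnj l|^2 = D (|z - c|^2 - s^2) with D
  = 1 - r^2 |l|^2 > 0, so a pseudohyperbolic disk is a Euclidean one with another centre.\<close>

lemma pseudohyp_disk_cball:
  assumes l: "cmod l < 1" and r: "0 < r" "r < 1"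
  defines "c \<equiv> of_real ((1 - r\<^sup>2) / (1 - r\<^sup>2 * (cmod l)\<^sup>2)) * l"
    and "s \<equiv> r * (1 - (cmod l)\<^sup>2) / (1 - r\<^sup>2 * (cmod l)\<^sup>2)"
  shows "0 < s" "cball c s \<subseteq> ball 0 1"
    "\<And>z. cmod z < 1 \<Longrightarrow> pseudohyp_dist l z \<le> r \<longleftrightarrow> cmod (z - c) \<le> s"
    "\<And>z. cmod z < 1 \<Longrightarrow> pseudohyp_dist l z < r \<longleftrightarrow> cmod (z - c) < s"
    "cmod (l - c) < s"
proof -
  define a where "a = cmod l"
  define D where "D = 1 - r\<^sup>2 * a\<^sup>2"
  define k where "k = (1 - r\<^sup>2) / D"
  have a: "0 \<le> a" "a < 1" "a\<^sup>2 < 1" "r\<^sup>2 < 1" using l r by (auto simp: a_def abs_square_less_1 power_less_one_iff)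
  have "r\<^sup>2 * a\<^sup>2 \<le> a\<^sup>2" using a r by (intro mult_left_le_one_le) (auto simp: power_le_one)
  then have D: "D > 0" using a unfolding D_def by linarith
  have c_eq: "c = of_real k * l" and s_eq: "s = r * (1 - a\<^sup>2) / D"
    by (simp_all add: c_def s_def k_def D_def a_def)
  show s: "0 < s" unfolding s_eq using r a D by simp
  have Dk: "D * k = 1 - r\<^sup>2" and Ds: "D * s = r * (1 - a\<^sup>2)" using D by (simp_all add: k_def s_eq)
  have k0: "0 \<le> k" unfolding k_def using D a by simp
  \<comment> \<open>The identity D (k a + s) = D - (1 - a) (1 - r) (1 - r a) shows |c| + s <
    1.\<close>
  have "D * (k * a + s) = (1 - r\<^sup>2) * a + r * (1 - a\<^sup>2)"
    unfolding distrib_left using Dk Ds by (simp flip: mult.assoc)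
  also have "\<dots> = D - (1 - a) * (1 - r) * (1 - r * a)"
    unfolding D_def by (simp add: power2_eq_square algebra_simps)
  also have "\<dots> < D * 1"
  proof -
    have "r * a < 1" using a r by (metis mult_le_one order_le_less_trans mult_left_le less_imp_le mult.commute)
    then show ?thesis using a r by (simp add: mult_pos_pos)
  qed
  finally have "k * a + s < 1" using D by (simp only: mult_less_cancel_left_pos)
  then have ks: "cmod c + s < 1" using k0 by (simp add: c_eq norm_mult a_def)
  show "cball c s \<subseteq> ball 0 1"
  proof
    fix z assume "z \<in> cball c s"
    then have "cmod z \<le> cmod c + s" using norm_triangle_ineq2[of z c] by (simp add: dist_norm norm_minus_commute)
    then show "z \<in> ball 0 1" using ks by simp
  qed
  have "D * (D * (k\<^sup>2 * a\<^sup>2 - s\<^sup>2)) = (D * k)\<^sup>2 * a\<^sup>2 - (D * s)\<^sup>2"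
    by (simp add: power2_eq_square algebra_simps)
  also have "\<dots> = D * (a\<^sup>2 - r\<^sup>2)"
    unfolding Dk Ds unfolding D_def by (simp add: power2_eq_square algebra_simps)
  finally have ks2: "D * (k\<^sup>2 * a\<^sup>2 - s\<^sup>2) = a\<^sup>2 - r\<^sup>2" using D by simp
  have id: "(cmod (l - z))\<^sup>2 - r\<^sup>2 * (cmod (1 - z * cnj l))\<^sup>2 = D * ((cmod (z - c))\<^sup>2 - s\<^sup>2)" for z
  proof -
    let ?p = "Re z * Re l + Im z * Im l"
    have "D * ((cmod (z - c))\<^sup>2 - s\<^sup>2) = D * (cmod z)\<^sup>2 - 2 * (D * k) * ?p + D * (k\<^sup>2 * a\<^sup>2 - s\<^sup>2)"
      unfolding cmod_power2 a_def c_eq by (simp add: power2_eq_square algebra_simps)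
    also have "\<dots> = (cmod (l - z))\<^sup>2 - r\<^sup>2 * (cmod (1 - z * cnj l))\<^sup>2"
      unfolding Dk ks2 unfolding D_def a_def cmod_power2 by (simp add: power2_eq_square algebra_simps)
    finally show ?thesis by simp
  qed
  have sgn: "pseudohyp_dist l z \<le> r \<longleftrightarrow> cmod (z - c) \<le> s" "pseudohyp_dist l z < r \<longleftrightarrow> cmod (z - c) < s" if z: "cmod z < 1" for z
  proof -
    let ?d = "cmod (1 - z * cnj l)"
    have d: "?d > 0" using pseudohyp_denominator[OF l z] by simp
    have p: "pseudohyp_dist l z = cmod (l - z) / ?d" by (simp add: pseudohyp_dist_def norm_divide)
    have "pseudohyp_dist l z \<le> r \<longleftrightarrow> cmod (l - z) \<le> r * ?d" unfolding p using d by (simp add: divide_le_eq)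
    also have "\<dots> \<longleftrightarrow> (cmod (l - z))\<^sup>2 \<le> (r * ?d)\<^sup>2" using r d by (subst power_mono_iff) auto
    also have "\<dots> \<longleftrightarrow> D * ((cmod (z - c))\<^sup>2 - s\<^sup>2) \<le> 0" by (subst id[symmetric]) (simp add: power_mult_distrib)
    also have "\<dots> \<longleftrightarrow> (cmod (z - c))\<^sup>2 \<le> s\<^sup>2" using D by (simp add: mult_le_0_iff)
    also have "\<dots> \<longleftrightarrow> cmod (z - c) \<le> s" using s by (subst power_mono_iff) auto
    finally show "pseudohyp_dist l z \<le> r \<longleftrightarrow> cmod (z - c) \<le> s" .
    have "pseudohyp_dist l z < r \<longleftrightarrow> cmod (l - z) < r * ?d" unfolding p using d by (simp add: divide_less_eq)
    also have "\<dots> \<longleftrightarrow> (cmod (l - z))\<^sup>2 < (r * ?d)\<^sup>2" using power_mono_iff[of "r * ?d" "cmod (l - z)" 2] r d by (simp flip: not_le)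
    also have "\<dots> \<longleftrightarrow> D * ((cmod (z - c))\<^sup>2 - s\<^sup>2) < 0" by (subst id[symmetric]) (simp add: power_mult_distrib)
    also have "\<dots> \<longleftrightarrow> (cmod (z - c))\<^sup>2 < s\<^sup>2" using D by (simp add: mult_less_0_iff)
    also have "\<dots> \<longleftrightarrow> cmod (z - c) < s" using power_mono_iff[of s "cmod (z - c)" 2] s by (simp flip: not_le)
    finally show "pseudohyp_dist l z < r \<longleftrightarrow> cmod (z - c) < s" .
  qed
  then show "\<And>z. cmod z < 1 \<Longrightarrow> pseudohyp_dist l z \<le> r \<longleftrightarrow> cmod (z - c) \<le> s"
    "\<And>z. cmod z < 1 \<Longrightarrow> pseudohyp_dist l z < r \<longleftrightarrow> cmod (z - c) < s" by blast+
  show "cmod (l - c) < s"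
    using sgn(2)[OF l] r by (simp add: pseudohyp_dist_def)
qed

text \<open>Up to sign this is the Green function of the unit disk with pole l.\<close>

lemma harm_ln_pseudohyp:
  assumes "cmod l < 1"
  shows "harm (\<lambda>z. ln (pseudohyp_dist l z)) (ball 0 1 - {l})"
proof -
  have "harm (\<lambda>z. ln (cmod ((l - z) / (1 - z * cnj l)))) (ball 0 1 - {l})"
    using pseudohyp_denominator[OF assms]
    by (intro harm_ln_norm holomorphic_intros) auto
  then show ?thesis by (simp add: pseudohyp_dist_def)
qed

lemma continuous_on_pseudohyp:
  assumes "cmod l < 1"
  shows "continuous_on (cball 0 1) (\<lambda>z. pseudohyp_dist l z)"
proof -
  have "1 - z * cnj l \<noteq> 0" if "cmod z \<le> 1" for z
  proof
    assume "1 - z * cnj l = 0"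
    then have "cmod (z * cnj l) = 1" by (metis eq_iff_diff_eq_0 norm_one)
    moreover have "cmod z * cmod l \<le> 1 * cmod l" using that by (intro mult_right_mono) auto
    ultimately show False using assms by (simp add: norm_mult)
  qed
  then show ?thesis unfolding pseudohyp_dist_def by (intro continuous_intros) auto
qed

lemma pseudohyp_dist_boundary:
  assumes "cmod l < 1" "cmod z = 1"
  shows "pseudohyp_dist l z = 1"
proof -
  have "cmod (1 - z * cnj l) = cmod (z - l)"
    using norm_unit_diff[OF assms(2), of l] by (simp add: mult.commute)
  moreover have "z \<noteq> l" using assms by auto
  ultimately show ?thesis by (simp add: pseudohyp_dist_def norm_divide norm_minus_commute)
qed

text \<open>Area comparison: the balls of radius d / 2 about the points are disjoint and lie between
  the circles of radius R0 and R1, and the area there is O(h) because d <= 2 * h.\<close>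

lemma packing_annulus:
  fixes f :: "'a \<Rightarrow> complex"
  assumes F: "finite F" and d: "0 < d" "d \<le> 2 * h" and h: "0 < h" "h \<le> 1"
    and ann: "\<And>n. n \<in> F \<Longrightarrow> 1 - h \<le> cmod (f n) \<and> cmod (f n) < 1"
    and sep: "\<And>m n. m \<in> F \<Longrightarrow> n \<in> F \<Longrightarrow> m \<noteq> n \<Longrightarrow> d \<le> cmod (f m - f n)"
  shows "real (card F) * (d / 2)\<^sup>2 \<le> 8 * h"
proof -
  let ?V = "unit_ball_vol (real DIM(complex))"
  have V: "?V > 0" by simp
  define R0 R1 where "R0 = max 0 (1 - h - d / 2)" and "R1 = 1 + d / 2"
  have R: "0 \<le> R0" "R0 \<le> R1" using d h by (auto simp: R0_def R1_def)
  have disj: "disjoint_family_on (\<lambda>n. ball (f n) (d / 2)) F"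
    unfolding disjoint_family_on_def
  proof (intro ballI impI)
    fix m n assume mn: "m \<in> F" "n \<in> F" "m \<noteq> n"
    have False if "x \<in> ball (f m) (d / 2)" "x \<in> ball (f n) (d / 2)" for x
    proof -
      have "dist (f m) (f n) \<le> dist (f m) x + dist x (f n)" by (rule dist_triangle)
      then show False using sep[OF mn] that by (simp add: dist_norm norm_minus_commute)
    qed
    then show "ball (f m) (d / 2) \<inter> ball (f n) (d / 2) = {}" by blast
  qed
  have sub: "(\<Union>n\<in>F. ball (f n) (d / 2)) \<subseteq> cball 0 R1 - ball 0 R0"
  proof
    fix x assume "x \<in> (\<Union>n\<in>F. ball (f n) (d / 2))"
    then obtain n where n: "n \<in> F" "cmod (f n - x) < d / 2" by (auto simp: dist_norm)
    have "cmod x \<le> cmod (f n) + cmod (f n - x)" "cmod (f n) \<le> cmod x + cmod (f n - x)"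
      using norm_triangle_ineq[of "f n" "x - f n"] norm_triangle_ineq[of x "f n - x"] by (simp_all add: norm_minus_commute)
    then have "R0 \<le> cmod x" "cmod x \<le> R1"
      using ann[OF n(1)] n(2) norm_ge_zero[of x] unfolding R0_def R1_def max_def by (auto split: if_splits)
    then show "x \<in> cball 0 R1 - ball 0 R0" by simp
  qed
  have "real (card F) * (?V * (d / 2)\<^sup>2) = (\<Sum>n\<in>F. measure lborel (ball (f n) (d / 2)))"
    using d(1) by (simp add: content_ball)
  also have "\<dots> = measure lborel (\<Union>n\<in>F. ball (f n) (d / 2))"
    using F disj by (intro measure_finite_Union[symmetric]) (auto simp: emeasure_ball d(1) less_imp_le)
  also have "\<dots> \<le> measure lborel (cball (0::complex) R1 - ball 0 R0)"
    using sub by (intro measure_mono_fmeasurable fmeasurable_Diff fmeasurable_compact) (auto intro!: borel_open)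
  also have "\<dots> = measure lborel (cball (0::complex) R1) - measure lborel (ball (0::complex) R0)"
  proof (rule measure_Diff)
    show "ball (0::complex) R0 \<subseteq> cball 0 R1" using R by (auto simp: subset_eq)
  qed (use R in \<open>auto simp: emeasure_cball\<close>)
  also have "\<dots> = ?V * (R1\<^sup>2 - R0\<^sup>2)"
    using R by (simp add: content_cball content_ball right_diff_distrib)
  finally have "?V * (real (card F) * (d / 2)\<^sup>2) \<le> ?V * (R1\<^sup>2 - R0\<^sup>2)" by (simp add: mult_ac)
  then have "real (card F) * (d / 2)\<^sup>2 \<le> R1\<^sup>2 - R0\<^sup>2" using V by (simp only: mult_le_cancel_left_pos)
  also have "\<dots> \<le> 8 * h"
  proof (cases "1 - h - d / 2 \<ge> 0")
    case True
    then have "R1\<^sup>2 - R0\<^sup>2 = (2 - h) * (h + d)"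
      by (simp add: R0_def R1_def power2_eq_square field_simps)
    also have "\<dots> \<le> 2 * (3 * h)" using d h by (intro mult_mono) auto
    finally show ?thesis using h by simp
  next
    case False
    \<comment> \<open>Here the inner circle has shrunk to the centre, which forces h >= 1/2, and the
      crude bound R1^2 <= 4 suffices.\<close>
    then have "h \<ge> 1 / 2" using d by linarith
    moreover have "R1\<^sup>2 \<le> 2\<^sup>2" unfolding R1_def using d h by (intro power_mono) auto
    then have "R1\<^sup>2 \<le> 4" by simp
    moreover have "0 \<le> R0\<^sup>2" by simp
    ultimately show ?thesis by linarith
  qed
  finally show ?thesis .
qed

text \<open>The linear function Re (z * cnj p) attains its maximum over the closed disk at p
  only.\<close>

lemma barrier_sphere:
  assumes S: "open S" "S \<subseteq> ball 0 1" and p: "cmod p = 1"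
  shows "barrier S p (\<lambda>z. 1 - Re (z * cnj p))"
proof -
  have "harm (\<lambda>z. Re (z * cnj p - 1)) S"
    using S(1) by (intro harm_Re holomorphic_intros)
  then have "submean (\<lambda>z. Re (z * cnj p - 1)) S" by (rule harm_submean(1)[OF _ S(1)])
  moreover have "closure S \<subseteq> cball 0 1"
    using closure_mono[OF S(2)] by simp
  moreover have "0 < 1 - Re (z * cnj p)" if "cmod z \<le> 1" "z \<noteq> p" for z
  proof -
    have "(cmod (z - p))\<^sup>2 = (cmod z)\<^sup>2 + (cmod p)\<^sup>2 - 2 * Re (z * cnj p)"
      unfolding cmod_power2 by (simp add: power2_eq_square algebra_simps)
    moreover have "(cmod (z - p))\<^sup>2 > 0" using that by simp
    moreover have "(cmod z)\<^sup>2 \<le> 1" using that by (simp add: power_le_one)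
    ultimately show ?thesis using p by simp
  qed
  moreover have "p * cnj p = 1" using p complex_norm_square[of p] by simp
  ultimately show ?thesis
    unfolding barrier_def by (auto intro!: continuous_intros simp: algebra_simps)
qed

text \<open>The map taking z to (p - c) / s / (z - c) sends the outside of the disk into the closed
  disk of radius 1 / s and p to its point 1 / s, so the linear barrier can be used in the
  image.\<close>

lemma barrier_exterior_disk:
  assumes S: "open S" "S \<inter> cball c s = {}" and s: "0 < s" and p: "cmod (p - c) = s"
  shows "barrier S p (\<lambda>z. 1 / s - Re ((p - c) / of_real s / (z - c)))"
proof -
  have "S \<subseteq> - ball c s" using S(2) ball_subset_cball[of c s] by blast
  then have "closure S \<subseteq> - ball c s" by (rule closure_minimal) auto
  then have cl: "s \<le> cmod (z - c)" if "z \<in> closure S" for z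
    using that by (force simp: dist_norm norm_minus_commute)
  have nz: "z - c \<noteq> 0" if "z \<in> closure S" for z using cl[OF that] s by auto
  have "harm (\<lambda>z. Re ((p - c) / of_real s / (z - c) - of_real (1 / s))) S"
    using S(1) nz closure_subset[of S] s by (intro harm_Re holomorphic_intros) auto
  then have 1: "submean (\<lambda>z. Re ((p - c) / of_real s / (z - c) - of_real (1 / s))) S"
    by (rule harm_submean(1)[OF _ S(1)])
  have 2: "0 < 1 / s - Re ((p - c) / of_real s / (z - c))" if z: "z \<in> closure S" "z \<noteq> p" for z
  proof -
    let ?q = "(p - c) / of_real s / (z - c)"
    have n: "cmod ?q = 1 / cmod (z - c)" using s by (simp only: norm_divide p norm_of_real) simp
    have le: "1 / cmod (z - c) \<le> 1 / s" using cl[OF z(1)] s by (simp add: frac_le)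
    have "Re ?q \<noteq> 1 / s"
    proof
      assume eq: "Re ?q = 1 / s"
      then have "1 / s \<le> cmod ?q" by (metis complex_Re_le_cmod)
      then have nq: "cmod ?q = 1 / s" using n le by linarith
      have "(Im ?q)\<^sup>2 = 0" using cmod_power2[of ?q] unfolding nq eq by simp
      then have "?q = of_real (1 / s)" using eq by (simp add: complex_eq_iff)
      then have "p - c = z - c" using nz[OF z(1)] s by (simp add: field_simps)
      then show False using z(2) by simp
    qed
    moreover have "Re ?q \<le> 1 / s" using complex_Re_le_cmod[of ?q] n le by linarith
    ultimately show ?thesis by simp
  qed
  have "p \<noteq> c" using p s by auto
  have c: "continuous_on (closure S) (\<lambda>z. 1 / s - Re ((p - c) / of_real s / (z - c)))"
    using nz s by (intro continuous_intros) auto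
  have 3: "1 / s - Re ((p - c) / of_real s / (p - c)) = 0"
    using \<open>p \<noteq> c\<close> s by (simp add: Re_divide_of_real[symmetric])
  have eq: "(\<lambda>x. - (1 / s - Re ((p - c) / of_real s / (x - c)))) = (\<lambda>z. Re ((p - c) / of_real s / (z - c) - of_real (1 / s)))"
    by simp
  show ?thesis
    unfolding barrier_def eq using c 1 2 3 by blast
qed

section \<open>Harmonic measure of champagne regions\<close>

lemma harm_extension_unique:
  assumes "harm_extension S f u" "harm_extension S f v" "open S" "bounded S" "x \<in> closure S"
  shows "u x = v x"
proof -
  have "u x - v x \<le> 0" "v x - u x \<le> 0"
    by (rule harm_extension_le[OF harm_extension_diff[OF assms(1,2)] assms(3,4) _ assms(5)], simp)
       (rule harm_extension_le[OF harm_extension_diff[OF assms(2,1)] assms(3,4) _ assms(5)], simp)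
  then show ?thesis by simp
qed

lemma harm_extension_const: "harm_extension S (\<lambda>x. c) (\<lambda>x. c)"
  by (simp add: harm_extension_def harm_const)

text \<open>The value at z of the solution is a positive normalised linear functional of the
  boundary data, hence integration against a measure. Uniqueness of that measure is what gives the
  \<open>THE\<close> in \<open>harmonic_measure\<close> its value.\<close>

theorem harmonic_measure_representation:
  assumes S: "open S" "bounded S" "z \<in> S"
    and ex: "\<And>f. continuous_on (frontier S) f \<Longrightarrow> \<exists>u. harm_extension S f u"
  obtains M where "prob_space M" "sets M = sets (restrict_space borel (frontier S))"
    "\<And>f u. continuous_on (frontier S) f \<Longrightarrow> harm_extension S f u \<Longrightarrow> u z = (\<integral>x. f x \<partial>M)"
    "\<And>A. harmonic_measure z A S = measure M A"
proof -
  have zc: "z \<in> closure S" using S(3) closure_subset by blast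
  define L where "L f = (SOME u. harm_extension S f u) z" for f
  have L: "L f = u z" if "harm_extension S f u" for f u
    unfolding L_def using someI[of "harm_extension S f", OF that] that harm_extension_unique[OF _ _ S(1,2) zc] by blast
  interpret positive_functional "frontier S" L
  proof
    show "compact (frontier S)" using S(2) by (rule compact_frontier_bounded)
    show "L (\<lambda>x. f x + g x) = L f + L g" if f: "continuous_on (frontier S) f" and g: "continuous_on (frontier S) g" for f g
    proof -
      obtain u v where "harm_extension S f u" "harm_extension S g v" using ex[OF f] ex[OF g] by blast
      then show ?thesis using L harm_extension_add by metis
    qed
    show "L (\<lambda>x. c * f x) = c * L f" if f: "continuous_on (frontier S) f" for c f
    proof -
      obtain u where "harm_extension S f u" using ex[OF f] by blast
      then show ?thesis using L harm_extension_cmult by metis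
    qed
    show "L f \<le> L g" if f: "continuous_on (frontier S) f" and g: "continuous_on (frontier S) g" and le: "\<And>x. x \<in> frontier S \<Longrightarrow> f x \<le> g x" for f g
    proof -
      obtain u v where uv: "harm_extension S f u" "harm_extension S g v" using ex[OF f] ex[OF g] by blast
      have "u z - v z \<le> 0"
        by (rule harm_extension_le[OF harm_extension_diff[OF uv] S(1,2) _ zc]) (use le in simp)
      then show ?thesis using L[OF uv(1)] L[OF uv(2)] by simp
    qed
    show "L (\<lambda>x. 1) = 1" by (rule L[OF harm_extension_const])
  qed
  have "\<exists>M. prob_space M \<and> sets M = sets (restrict_space borel (frontier S)) \<and>
    (\<forall>f. continuous_on (frontier S) f \<longrightarrow> L f = (\<integral>x. f x \<partial>M))"
    by (rule representation) blast
  then obtain M where M: "prob_space M" "sets M = sets (restrict_space borel (frontier S))"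
    "\<And>f. continuous_on (frontier S) f \<Longrightarrow> L f = (\<integral>x. f x \<partial>M)"
    by blast
  have dir: "dirichlet_solution S f u" if "harm_extension S f u" for f u :: "complex \<Rightarrow> real"
    using that harm_imp_harmonic_on[OF _ S(1)] by (simp add: harm_extension_def dirichlet_solution_def)
  have hm: "is_harmonic_measure S z M"
    unfolding is_harmonic_measure_def
  proof (intro conjI allI impI M(1,2))
    fix f :: "complex \<Rightarrow> real" assume f: "continuous_on (frontier S) f"
    then obtain u where "harm_extension S f u" using ex by blast
    then show "\<exists>u. dirichlet_solution S f u \<and> u z = (\<integral>x. f x \<partial>M)"
      using dir L M(3)[OF f] by metis
  qed
  have uniq: "N = M" if N: "is_harmonic_measure S z N" for N
  proof (rule measure_eq_if_continuous_integrals_eq[OF frontier_closed _ _ M(1,2)])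
    show "prob_space N" "sets N = sets (restrict_space borel (frontier S))"
      using N by (simp_all add: is_harmonic_measure_def)
    fix f :: "complex \<Rightarrow> real" assume f: "continuous_on (frontier S) f"
    then obtain u where u: "harm_extension S f u" using ex by blast
    obtain v where v: "dirichlet_solution S f v" "v z = (\<integral>x. f x \<partial>N)"
      using N f unfolding is_harmonic_measure_def by blast
    have "v z = u z" by (rule dirichlet_solution_unique[OF S(2) v(1) dir[OF u] zc])
    then show "(\<integral>x. f x \<partial>N) = (\<integral>x. f x \<partial>M)"
      using v(2) L[OF u] M(3)[OF f] by simp
  qed
  have the: "(THE M. is_harmonic_measure S z M) = M"
    by (rule the_equality[where P = "is_harmonic_measure S z", OF hm uniq])
  show ?thesis
  proof (rule that[OF M(1,2)])
    show "u z = (\<integral>x. f x \<partial>M)" if "continuous_on (frontier S) f" "harm_extension S f u" for f u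
      using L[OF that(2)] M(3)[OF that(1)] by simp
    show "harmonic_measure z A S = measure M A" for A
      by (simp add: harmonic_measure_def the)
  qed
qed

text \<open>\<open>nz\<close> keeps every \<open>cmod (\<Lambda> n)\<close> inside the interval
  (0,1) on which \<phi> is controlled.\<close>

locale champagne =
  fixes \<Lambda> :: "nat \<Rightarrow> complex" and \<phi> :: "real \<Rightarrow> real"
  assumes ud: "uniformly_dense \<Lambda>"
    and phi: "\<phi> \<in> {0<..<1} \<rightarrow> {0<..<1}"
    and anti: "antimono_on {0<..<1} \<phi>"
    and bound: "\<exists>c<1. \<forall>t\<in>{0<..<1}. \<phi> t \<le> c"
    and nz: "\<forall>n. \<Lambda> n \<noteq> 0"
    and disj: "disjoint_family (\<lambda>n. pseudohyp_disk (\<Lambda> n) (\<phi> (cmod (\<Lambda> n))))"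
    and zero: "0 \<in> champagne_region \<Lambda> \<phi>"
begin

section \<open>Geometry and topology of the champagne region\<close>

lemma Lam: "cmod (\<Lambda> n) < 1" "0 < cmod (\<Lambda> n)"
proof -
  have "range \<Lambda> \<subseteq> ball 0 1" using ud unfolding uniformly_dense_def by blast
  then have "\<Lambda> n \<in> ball 0 1" by blast
  then show "cmod (\<Lambda> n) < 1" by simp
  show "0 < cmod (\<Lambda> n)" using nz by simp
qed

definition r where "r n = \<phi> (cmod (\<Lambda> n))"

lemma r: "0 < r n" "r n < 1"
  using phi Lam[of n] unfolding r_def by auto

definition cen where "cen n = of_real ((1 - (r n)\<^sup>2) / (1 - (r n)\<^sup>2 * (cmod (\<Lambda> n))\<^sup>2)) * \<Lambda> n"
definition rad where "rad n = r n * (1 - (cmod (\<Lambda> n))\<^sup>2) / (1 - (r n)\<^sup>2 * (cmod (\<Lambda> n))\<^sup>2)"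

lemmas disk = pseudohyp_disk_cball[OF Lam(1)[of n] r(1)[of n] r(2)[of n], folded cen_def rad_def] for n

abbreviation "D n \<equiv> cball (cen n) (rad n)"
abbreviation "\<Omega> \<equiv> champagne_region \<Lambda> \<phi>"

lemma pseudohyp_disk_eq: "pseudohyp_disk (\<Lambda> n) (r n) = D n"
proof -
  have "z \<in> pseudohyp_disk (\<Lambda> n) (r n) \<longleftrightarrow> z \<in> D n" for z
  proof (cases "cmod z < 1")
    case True
    then show ?thesis using disk(3)[OF True, of n] by (simp add: pseudohyp_disk_def dist_norm norm_minus_commute)
  next
    case False
    then have "z \<notin> ball 0 1" by simp
    then show ?thesis using disk(2)[of n] by (auto simp: pseudohyp_disk_def)
  qed
  then show ?thesis by blast
qed

lemma Omega_eq: "\<Omega> = ball 0 1 - (\<Union>n. D n)"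
  unfolding champagne_region_def by (simp add: pseudohyp_disk_eq[unfolded r_def])

lemma D_disjoint: "m \<noteq> n \<Longrightarrow> D m \<inter> D n = {}"
  using disj unfolding disjoint_family_on_def by (simp add: pseudohyp_disk_eq[unfolded r_def])

lemma separated: "\<exists>\<delta>>0. \<delta> \<le> 1 \<and> (\<forall>m n. m \<noteq> n \<longrightarrow> \<delta> \<le> pseudohyp_dist (\<Lambda> m) (\<Lambda> n))"
proof -
  define \<delta> where "\<delta> = (INF (m, n) \<in> {(m, n). m \<noteq> n}. pseudohyp_dist (\<Lambda> m) (\<Lambda> n))"
  have pos: "\<delta> > 0" using ud by (simp add: uniformly_dense_def \<delta>_def)
  have le: "\<delta> \<le> pseudohyp_dist (\<Lambda> m) (\<Lambda> n)" if "m \<noteq> n" for m n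
  proof -
    have "\<delta> \<le> (case (m, n) of (m, n) \<Rightarrow> pseudohyp_dist (\<Lambda> m) (\<Lambda> n))"
      unfolding \<delta>_def using that pseudohyp_dist_nonneg by (intro cINF_lower bdd_belowI2[of _ 0]) auto
    then show ?thesis by simp
  qed
  have "\<delta> \<le> pseudohyp_dist (\<Lambda> 0) (\<Lambda> 1)" by (rule le) simp
  then have "\<delta> \<le> 1" using pseudohyp_dist_less_1[OF Lam(1)[of 0] Lam(1)[of 1]] by linarith
  then show ?thesis using pos le by blast
qed

lemma separated_euclidean:
  assumes "\<forall>m n. m \<noteq> n \<longrightarrow> \<delta> \<le> pseudohyp_dist (\<Lambda> m) (\<Lambda> n)" "m \<noteq> n" "0 \<le> \<delta>"
  shows "\<delta> * (1 - cmod (\<Lambda> m)) \<le> cmod (\<Lambda> m - \<Lambda> n)"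
proof -
  let ?d = "cmod (1 - \<Lambda> n * cnj (\<Lambda> m))"
  have d: "?d > 0" using pseudohyp_denominator[OF Lam(1) Lam(1)] by simp
  have "cmod (\<Lambda> n * cnj (\<Lambda> m)) \<le> cmod (\<Lambda> m)"
    using Lam(1)[of n] by (simp add: norm_mult mult_left_le_one_le)
  then have "1 - cmod (\<Lambda> m) \<le> ?d" using norm_triangle_ineq2[of 1 "\<Lambda> n * cnj (\<Lambda> m)"] by simp
  then have "\<delta> * (1 - cmod (\<Lambda> m)) \<le> \<delta> * ?d" using assms(3) by (rule mult_left_mono)
  also have "\<dots> \<le> pseudohyp_dist (\<Lambda> m) (\<Lambda> n) * ?d" using assms(1,2) d by (intro mult_right_mono) auto
  also have "\<dots> = cmod (\<Lambda> m - \<Lambda> n)" using d by (simp add: pseudohyp_dist_def norm_divide)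
  finally show ?thesis .
qed

lemma covered: "\<exists>s. 0 < s \<and> s < 1 \<and> (\<forall>z. cmod z < 1 \<longrightarrow> (\<exists>n. pseudohyp_dist (\<Lambda> n) z \<le> s))"
proof -
  obtain s where s: "0 < s" "s < 1" "ball 0 1 = (\<Union>n. pseudohyp_disk (\<Lambda> n) s)"
    using ud unfolding uniformly_dense_def by blast
  have "\<exists>n. pseudohyp_dist (\<Lambda> n) z \<le> s" if "cmod z < 1" for z
  proof -
    have "z \<in> (\<Union>n. pseudohyp_disk (\<Lambda> n) s)" using that s(3) by auto
    then show ?thesis by (auto simp: pseudohyp_disk_def)
  qed
  then show ?thesis using s by blast
qed

text \<open>The packing bound with h = 1 limits the size of every finite subset, its points being at
  mutual distance at least d = \<delta> * (1 - max R 0).\<close>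

lemma finite_Lam:
  assumes "R < 1"
  shows "finite {n. cmod (\<Lambda> n) \<le> R}"
proof -
  obtain \<delta> where \<delta>: "\<delta> > 0" "\<delta> \<le> 1" "\<forall>m n. m \<noteq> n \<longrightarrow> \<delta> \<le> pseudohyp_dist (\<Lambda> m) (\<Lambda> n)" using separated by blast
  define d where "d = \<delta> * (1 - max R 0)"
  have d: "0 < d" "d \<le> 2 * 1"
    using \<delta> assms mult_mono[of \<delta> 1 "1 - max R 0" 1] by (auto simp: d_def)
  have "finite {n. cmod (\<Lambda> n) \<le> R} \<and> card {n. cmod (\<Lambda> n) \<le> R} \<le> nat \<lfloor>8 / (d / 2)\<^sup>2\<rfloor>"
  proof (rule finite_if_finite_subsets_card_bdd)
    fix G assume G: "G \<subseteq> {n. cmod (\<Lambda> n) \<le> R}" "finite G"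
    have "real (card G) * (d / 2)\<^sup>2 \<le> 8 * 1"
    proof (rule packing_annulus[OF G(2) d])
      fix m n assume mn: "m \<in> G" "n \<in> G" "m \<noteq> n"
      have "d \<le> \<delta> * (1 - cmod (\<Lambda> m))"
        unfolding d_def using \<delta>(1) G(1) mn(1) by (intro mult_left_mono) auto
      then show "d \<le> cmod (\<Lambda> m - \<Lambda> n)" using separated_euclidean[OF \<delta>(3) mn(3)] \<delta>(1) by linarith
    qed (use Lam in auto)
    then have "real (card G) \<le> 8 / (d / 2)\<^sup>2" using d by (simp add: le_divide_eq)
    then show "card G \<le> nat \<lfloor>8 / (d / 2)\<^sup>2\<rfloor>" by (simp add: le_nat_floor)
  qed
  then show ?thesis by blast
qed

lemma bound_c: "\<exists>c. 0 < c \<and> c < 1 \<and> (\<forall>t\<in>{0<..<1}. \<phi> t \<le> c)"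
proof -
  obtain c where c: "c < 1" "\<forall>t\<in>{0<..<1}. \<phi> t \<le> c" using bound by blast
  have "0 < \<phi> (1 / 2)" "\<phi> (1 / 2) \<le> c" using phi c by auto
  then have "0 < c" by linarith
  then show ?thesis using c by blast
qed

text \<open>As the radii stay below a constant c < 1, a removed disk that meets |z| <= R has its
  point \<Lambda> n at distance at least a * (1 - R) from the unit circle, and only finitely many
  points do.\<close>

lemma locally_finite:
  assumes "R < 1"
  shows "finite {n. D n \<inter> cball 0 R \<noteq> {}}"
proof -
  obtain c where c: "0 < c" "c < 1" "\<forall>t\<in>{0<..<1}. \<phi> t \<le> c" using bound_c by blast
  define a where "a = (1 - c\<^sup>2) / 4"
  have a: "a > 0" using c by (simp add: a_def power_less_one_iff abs_square_less_1)
  have "cmod (\<Lambda> n) \<le> 1 - a * (1 - R)" if "D n \<inter> cball 0 R \<noteq> {}" for n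
  proof -
    obtain z where "z \<in> D n \<inter> cball 0 R" using \<open>D n \<inter> cball 0 R \<noteq> {}\<close> by blast
    then have z: "z \<in> D n" "cmod z \<le> R" by auto
    have z1: "cmod z < 1" using z(2) assms by simp
    have "pseudohyp_dist (\<Lambda> n) z \<le> r n" using disk(3)[OF z1, of n] z(1) by (simp add: dist_norm norm_minus_commute)
    also have "r n \<le> c" unfolding r_def using c(3) Lam[of n] by auto
    finally have "pseudohyp_dist z (\<Lambda> n) \<le> c" by (simp add: pseudohyp_dist_commute)
    from pseudohyp_dist_le_imp[OF z1 Lam(1) this] c(2) have "a * (1 - cmod z) \<le> 1 - cmod (\<Lambda> n)" by (simp add: a_def)
    moreover have "a * (1 - R) \<le> a * (1 - cmod z)" using a z by (intro mult_left_mono) auto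
    ultimately show ?thesis by linarith
  qed
  then have "{n. D n \<inter> cball 0 R \<noteq> {}} \<subseteq> {n. cmod (\<Lambda> n) \<le> 1 - a * (1 - R)}" by blast
  moreover have "finite {n. cmod (\<Lambda> n) \<le> 1 - a * (1 - R)}"
    using a assms by (intro finite_Lam) (simp add: mult_pos_pos)
  ultimately show ?thesis by (rule finite_subset)
qed

text \<open>The removed disks accumulate at the unit circle, so their union need not be closed in
  the plane; inside each smaller disk only finitely many matter. The index set I lets one disk be
  left out in \<open>enlarged_disk\<close>.\<close>

lemma open_minus_disks: "open (ball 0 1 - (\<Union>n\<in>I. D n))"
proof (subst open_subopen, intro ballI)
  fix x assume x: "x \<in> ball 0 1 - (\<Union>n\<in>I. D n)"
  define R where "R = (1 + cmod x) / 2"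
  have R: "R < 1" "cmod x < R" using x by (auto simp: R_def)
  define N where "N = {n \<in> I. D n \<inter> cball 0 R \<noteq> {}}"
  have "finite N" using finite_subset[OF _ locally_finite[OF R(1)]] by (auto simp: N_def)
  then have "closed (\<Union>n\<in>N. D n)" by (intro closed_UN) auto
  then have "open (ball 0 R - (\<Union>n\<in>N. D n))" by (intro open_Diff) auto
  moreover have "x \<in> ball 0 R - (\<Union>n\<in>N. D n)" using x R by (auto simp: N_def)
  moreover have "ball 0 R - (\<Union>n\<in>N. D n) \<subseteq> ball 0 1 - (\<Union>n\<in>I. D n)"
  proof
    fix y assume y: "y \<in> ball 0 R - (\<Union>n\<in>N. D n)"
    then have "y \<in> cball 0 R" by auto
    then have "y \<notin> D n" if "n \<in> I" for n using y that unfolding N_def by blast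
    then show "y \<in> ball 0 1 - (\<Union>n\<in>I. D n)" using y R by auto
  qed
  ultimately show "\<exists>T. open T \<and> x \<in> T \<and> T \<subseteq> ball 0 1 - (\<Union>n\<in>I. D n)" by blast
qed

lemma open_Omega: "open \<Omega>"
  unfolding Omega_eq by (rule open_minus_disks)

lemma Omega_subset: "\<Omega> \<subseteq> ball 0 1" "closure \<Omega> \<subseteq> cball 0 1"
proof -
  show "\<Omega> \<subseteq> ball 0 1" by (auto simp: Omega_eq)
  from closure_mono[OF this] show "closure \<Omega> \<subseteq> cball 0 1" by simp
qed

lemma bounded_Omega: "bounded \<Omega>"
  using Omega_subset(1) bounded_ball bounded_subset by blast

text \<open>A compact disk has positive distance to the closed set formed by the other disks and the
  outside. The resulting free annulus serves both for approaching the unit circle and for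
  connectedness.\<close>

lemma enlarged_disk: "\<exists>s. rad n < s \<and> cball (cen n) s \<subseteq> ball 0 1 \<and> (\<forall>m. m \<noteq> n \<longrightarrow> D m \<inter> cball (cen n) s = {})"
proof -
  define T where "T = - (ball 0 1 - (\<Union>m\<in>-{n}. D m))"
  have "closed T" unfolding T_def using open_minus_disks[of "-{n}"] by (simp only: closed_Compl)
  moreover have "D n \<inter> T = {}" unfolding T_def using disk(2)[of n] D_disjoint[of _ n] by blast
  ultimately obtain d where d: "d > 0" "\<And>x y. x \<in> D n \<Longrightarrow> y \<in> T \<Longrightarrow> d \<le> dist x y"
    using separate_compact_closed[of "D n" T] by auto
  define s where "s = rad n + d / 2"
  have notT: "x \<notin> T" if x: "x \<in> cball (cen n) s" for x
  proof
    assume xT: "x \<in> T"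
    have rp: "rad n > 0" by (rule disk(1))
    have far: "rad n < cmod (x - cen n)"
      using d(2)[of x x] xT d(1) by (force simp: dist_norm norm_minus_commute)
    define k where "k = rad n / cmod (x - cen n)"
    have pos: "0 < cmod (x - cen n)" using far rp by linarith
    have k: "0 < k" "k < 1"
      unfolding k_def using far rp pos by (auto intro: divide_pos_pos simp: divide_less_eq)
    define y where "y = cen n + of_real k * (x - cen n)"
    have "cmod (y - cen n) = k * cmod (x - cen n)" using k by (simp add: y_def norm_mult)
    also have "\<dots> = rad n" using pos by (simp add: k_def)
    finally have "cmod (y - cen n) = rad n" .
    then have "y \<in> D n" by (simp add: dist_norm norm_minus_commute)
    have "y - x = - (of_real (1 - k) * (x - cen n))" by (simp add: y_def algebra_simps)
    then have "dist y x = (1 - k) * cmod (x - cen n)"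
      using k by (simp only: dist_norm norm_minus_cancel norm_mult norm_of_real)
    also have "\<dots> = cmod (x - cen n) - rad n" using pos by (simp add: k_def left_diff_distrib)
    also have "\<dots> \<le> d / 2" using x by (simp add: s_def dist_norm norm_minus_commute)
    finally show False using d(2)[OF \<open>y \<in> D n\<close> xT] d(1) by linarith
  qed
  then have "cball (cen n) s \<subseteq> ball 0 1 - (\<Union>m\<in>-{n}. D m)" unfolding T_def by blast
  then show ?thesis using d(1) by (intro exI[of _ s]) (auto simp: s_def)
qed

lemma frontier_cases:
  assumes "x \<in> frontier \<Omega>"
  shows "cmod x = 1 \<or> (\<exists>n. cmod (x - cen n) = rad n \<and> cmod x < 1 \<and> pseudohyp_dist (\<Lambda> n) x = r n)"
proof (cases "cmod x = 1")
  case False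
  have xc: "x \<in> closure \<Omega>" "x \<notin> \<Omega>" using assms open_Omega by (auto simp: frontier_def interior_open)
  then have x1: "cmod x < 1" using Omega_subset(2) False by fastforce
  then obtain n where n: "x \<in> D n" using xc(2) by (auto simp: Omega_eq)
  have "\<Omega> \<subseteq> - ball (cen n) (rad n)" using ball_subset_cball by (fastforce simp: Omega_eq)
  then have "closure \<Omega> \<subseteq> - ball (cen n) (rad n)" by (rule closure_minimal) auto
  then have "x \<notin> ball (cen n) (rad n)" using xc(1) by blast
  then have "cmod (x - cen n) = rad n" using n by (simp add: dist_norm norm_minus_commute)
  moreover from this have "pseudohyp_dist (\<Lambda> n) x = r n"
    using disk(3)[OF x1, of n] disk(4)[OF x1, of n] by simp
  ultimately show ?thesis using x1 by blast
qed simp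

lemma frontier_in_closure: "x \<in> frontier \<Omega> \<Longrightarrow> x \<in> closure \<Omega>"
  by (simp add: frontier_def)

lemma closure_pseudohyp:
  assumes "x \<in> closure \<Omega>" "cmod x < 1"
  shows "r n \<le> pseudohyp_dist (\<Lambda> n) x"
proof -
  have "\<Omega> \<subseteq> - ball (cen n) (rad n)" using ball_subset_cball by (fastforce simp: Omega_eq)
  then have "closure \<Omega> \<subseteq> - ball (cen n) (rad n)" by (rule closure_minimal) auto
  then have "rad n \<le> cmod (x - cen n)" using assms(1) by (force simp: dist_norm norm_minus_commute)
  then show ?thesis using disk(4)[OF assms(2), of n] by simp
qed

lemma barrier_Omega:
  assumes "p \<in> frontier \<Omega>"
  shows "\<exists>b. barrier \<Omega> p b"
proof (cases "cmod p = 1")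
  case True
  then show ?thesis using barrier_sphere[OF open_Omega Omega_subset(1)] by blast
next
  case False
  then obtain n where "cmod (p - cen n) = rad n" using frontier_cases[OF assms] by blast
  moreover have "\<Omega> \<inter> D n = {}" by (auto simp: Omega_eq)
  ultimately show ?thesis using barrier_exterior_disk[OF open_Omega _ disk(1)] by blast
qed

lemma extension_exists:
  "continuous_on (frontier \<Omega>) f \<Longrightarrow> \<exists>u. harm_extension \<Omega> f u"
  using harm_extension_exists[OF open_Omega bounded_Omega _ barrier_Omega] zero by blast

text \<open>Approach p radially. If t0 * p lies in a removed disk, moving outwards crosses the free
  annulus around that disk, by the intermediate value theorem, and meets \<Omega> at least as close
  to p.\<close>

lemma sphere_frontier: "sphere 0 1 \<subseteq> frontier \<Omega>"
proof
  fix p :: complex assume "p \<in> sphere 0 1"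
  then have p: "cmod p = 1" by simp
  have "p \<in> closure \<Omega>"
    unfolding closure_approachable
  proof (intro allI impI)
    fix e :: real assume e: "e > 0"
    define t0 where "t0 = max 0 (1 - e / 2)"
    have t0: "0 \<le> t0" "t0 < 1" using e by (auto simp: t0_def)
    have near: "dist (of_real t * p) p < e" if "t0 \<le> t" "t \<le> 1" for t
    proof -
      have "of_real t * p - p = of_real (t - 1) * p" by (simp add: algebra_simps)
      then have "dist (of_real t * p) p = \<bar>t - 1\<bar>" using p by (simp only: dist_norm norm_mult norm_of_real) simp
      then show ?thesis using that e by (simp add: t0_def)
    qed
    have inball: "cmod (of_real t * p) < 1" if "0 \<le> t" "t < 1" for t using that p by (simp add: norm_mult)
    show "\<exists>y\<in>\<Omega>. dist y p < e"
    proof (cases "of_real t0 * p \<in> \<Omega>")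
      case True
      then show ?thesis using near[of t0] t0 by auto
    next
      case False
      then obtain n where n: "of_real t0 * p \<in> D n" using inball[OF t0] by (auto simp: Omega_eq)
      obtain s where s: "rad n < s" "cball (cen n) s \<subseteq> ball 0 1" "\<forall>m. m \<noteq> n \<longrightarrow> D m \<inter> cball (cen n) s = {}"
        using enlarged_disk by blast
      define g where "g t = cmod (of_real t * p - cen n)" for t
      have "g 1 > s"
      proof (rule ccontr)
        assume "\<not> g 1 > s"
        then have "p \<in> cball (cen n) s" by (simp add: g_def dist_norm norm_minus_commute)
        then show False using s(2) p by auto
      qed
      moreover have "g t0 \<le> rad n" using n by (simp add: g_def dist_norm norm_minus_commute)
      moreover have "continuous_on {t0..1} g" unfolding g_def by (intro continuous_intros)
      ultimately have "\<exists>t. t0 \<le> t \<and> t \<le> 1 \<and> g t = (rad n + s) / 2"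
        using s(1) t0 by (intro IVT') auto
      then obtain t where t: "t0 \<le> t" "t \<le> 1" "g t = (rad n + s) / 2" by blast
      have *: "of_real t * p \<in> cball (cen n) s" "of_real t * p \<notin> D n"
        using t(3) s(1) by (simp_all add: g_def dist_norm norm_minus_commute)
      have "of_real t * p \<notin> D m" for m using * s(3) by (cases "m = n") blast+
      then have "of_real t * p \<in> \<Omega>" using *(1) s(2) unfolding Omega_eq by blast
      then show ?thesis using near[OF t(1,2)] by blast
    qed
  qed
  moreover have "p \<notin> \<Omega>" using p Omega_subset(1) by auto
  ultimately show "p \<in> frontier \<Omega>" using open_Omega by (simp add: frontier_def interior_open)
qed

text \<open>A separation of \<Omega> would extend to one of the unit disk: the connected annulus
  around each removed disk lies wholly on one side, and the disk is assigned to that side.\<close>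

lemma connected_Omega: "connected \<Omega>"
proof (rule connectedI)
  fix A B :: "complex set"
  assume A: "open A" and B: "open B" and ne: "A \<inter> \<Omega> \<noteq> {}" "B \<inter> \<Omega> \<noteq> {}" and dis: "A \<inter> B \<inter> \<Omega> = {}" and cov: "\<Omega> \<subseteq> A \<union> B"
  have "\<forall>n. \<exists>s. rad n < s \<and> cball (cen n) s \<subseteq> ball 0 1 \<and> (\<forall>m. m \<noteq> n \<longrightarrow> D m \<inter> cball (cen n) s = {})"
    using enlarged_disk by blast
  from choice[OF this] obtain s where s: "\<And>n. rad n < s n" "\<And>n. cball (cen n) (s n) \<subseteq> ball 0 1"
    "\<And>n m. m \<noteq> n \<Longrightarrow> D m \<inter> cball (cen n) (s n) = {}" by blast
  define E where "E n = {x. rad n < norm (x - cen n) \<and> norm (x - cen n) < s n}" for n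
  have E_conn: "connected (E n)" for n
    unfolding E_def by (rule connected_annulus) simp
  have E_sub: "E n \<subseteq> \<Omega>" for n
  proof
    fix x assume "x \<in> E n"
    then have *: "x \<in> cball (cen n) (s n)" "x \<notin> D n" by (auto simp: E_def dist_norm norm_minus_commute)
    have "x \<notin> D m" for m using * s(3)[of m n] by (cases "m = n") blast+
    then show "x \<in> \<Omega>" using *(1) s(2)[of n] unfolding Omega_eq by blast
  qed
  have E_ne: "E n \<noteq> {}" for n
  proof -
    have "cen n + of_real ((rad n + s n) / 2) \<in> E n"
      using s(1)[of n] disk(1)[of n] by (simp add: E_def norm_of_real del: of_real_divide of_real_add)
    then show ?thesis by blast
  qed
  have E_AB: "E n \<subseteq> A \<or> E n \<subseteq> B" for n
    using connectedD[OF E_conn A B, of n] E_sub[of n] dis cov by blast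
  define B' where "B' n = ball (cen n) (s n)" for n
  have B'_eq: "x \<in> B' n \<Longrightarrow> x \<in> D n \<or> x \<in> E n" for x n
    by (auto simp: B'_def E_def dist_norm norm_minus_commute)
  have B'_D: "D n \<subseteq> B' n" for n using s(1)[of n] by (auto simp: B'_def)
  have B'_other: "m \<noteq> n \<Longrightarrow> x \<in> B' n \<Longrightarrow> x \<notin> D m" for x m n
    using s(3)[of m n] ball_subset_cball[of "cen n" "s n"] unfolding B'_def by blast
  define A1 where "A1 = (A \<inter> \<Omega>) \<union> (\<Union>n\<in>{n. E n \<subseteq> A}. B' n)"
  define B1 where "B1 = (B \<inter> \<Omega>) \<union> (\<Union>n\<in>{n. E n \<subseteq> B}. B' n)"
  have o: "open A1" "open B1" unfolding A1_def B1_def B'_def using A B open_Omega by auto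
  have cv: "ball 0 1 \<subseteq> A1 \<union> B1"
  proof
    fix x :: complex assume x: "x \<in> ball 0 1"
    show "x \<in> A1 \<union> B1"
    proof (cases "x \<in> \<Omega>")
      case True then show ?thesis using cov by (auto simp: A1_def B1_def)
    next
      case False
      then obtain n where "x \<in> D n" using x by (auto simp: Omega_eq)
      then have "x \<in> B' n" using B'_D by blast
      then show ?thesis using E_AB[of n] unfolding A1_def B1_def by blast
    qed
  qed
  have ds: "A1 \<inter> B1 \<inter> ball 0 1 = {}"
  proof (rule ccontr)
    assume "A1 \<inter> B1 \<inter> ball 0 1 \<noteq> {}"
    then obtain x where x: "x \<in> A1" "x \<in> B1" by blast
    show False
    proof (cases "x \<in> \<Omega>")
      case True
      then have "x \<notin> D n" for n by (auto simp: Omega_eq)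
      then have "x \<in> A" "x \<in> B" using x B'_eq unfolding A1_def B1_def by blast+
      then show False using True dis by blast
    next
      case False
      then obtain n m where nm: "x \<in> B' n" "E n \<subseteq> A" "x \<in> B' m" "E m \<subseteq> B" using x unfolding A1_def B1_def by blast
      have "x \<notin> E k" for k using E_sub[of k] False by blast
      then have "x \<in> D m" using B'_eq[OF nm(3)] by blast
      then have "n = m" using B'_other[OF _ nm(1), of m] by blast
      then have "E n \<subseteq> A \<inter> B \<inter> \<Omega>" using nm(2,4) E_sub[of n] by blast
      then show False using E_ne dis by blast
    qed
  qed
  have "A1 \<inter> ball 0 1 \<noteq> {}" "B1 \<inter> ball 0 1 \<noteq> {}"
  proof -
    obtain x y where "x \<in> A \<inter> \<Omega>" "y \<in> B \<inter> \<Omega>" using ne by blast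
    moreover from this have "x \<in> ball 0 1" "y \<in> ball 0 1" using Omega_subset(1) by blast+
    ultimately show "A1 \<inter> ball 0 1 \<noteq> {}" "B1 \<inter> ball 0 1 \<noteq> {}" unfolding A1_def B1_def by blast+
  qed
  then show False using connectedD[OF connected_ball o ds cv] by blast
qed

end

section \<open>Decay of the harmonic measure\<close>

text \<open>The points reachable from a with some constant form a set that is open and closed
  relative to S, since neighbouring values differ at most by the factor 3 of
  \<open>harnack_half\<close>. The constant depends on a and b, not on u.\<close>

lemma harnack_chain:
  assumes S: "open S" "connected S" and a: "a \<in> S" and b: "b \<in> S"
  shows "\<exists>C>0. \<forall>u. harm u S \<longrightarrow> (\<forall>x\<in>S. 0 \<le> u x) \<longrightarrow> u b \<le> C * u a"
proof -
  define P where "P z \<longleftrightarrow> (\<exists>C>0. \<forall>u. harm u S \<longrightarrow> (\<forall>x\<in>S. 0 \<le> u x) \<longrightarrow> u z \<le> C * u a)" for z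
  have step: "\<exists>e>0. ball z e \<subseteq> S \<and> (\<forall>w\<in>ball z e. P w \<longleftrightarrow> P z)" if z: "z \<in> S" for z
  proof -
    obtain e where e: "e > 0" "cball z e \<subseteq> S" using S(1) z open_contains_cball by blast
    have *: "u w \<le> 3 * u z \<and> u z \<le> 3 * u w" if "w \<in> ball z (e / 2)" "harm u S" "\<forall>x\<in>S. 0 \<le> u x" for u w
      using harnack_half[OF that(2) e(2,1)] that(1,3) by (simp add: dist_norm norm_minus_commute)
    have tr: "P y" if "P x" and le: "\<And>u. harm u S \<Longrightarrow> \<forall>x\<in>S. 0 \<le> u x \<Longrightarrow> u y \<le> 3 * u x" for x y
    proof -
      obtain C where C: "C > 0" "\<And>u. harm u S \<Longrightarrow> \<forall>x\<in>S. 0 \<le> u x \<Longrightarrow> u x \<le> C * u a" using \<open>P x\<close> unfolding P_def by blast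
      have "u y \<le> (3 * C) * u a" if "harm u S" "\<forall>x\<in>S. 0 \<le> u x" for u
        using le[OF that] C(2)[OF that] by simp
      then show ?thesis unfolding P_def using C(1) by (intro exI[of _ "3 * C"]) simp
    qed
    have "P w \<longleftrightarrow> P z" if "w \<in> ball z (e / 2)" for w
      using tr[of w z] tr[of z w] *[OF that] by blast
    moreover have "ball z (e / 2) \<subseteq> S" using e by (auto simp: subset_eq)
    moreover have "0 < e / 2" using e(1) by simp
    ultimately show ?thesis by blast
  qed
  define A where "A = {z \<in> S. P z}"
  define B where "B = {z \<in> S. \<not> P z}"
  have "\<exists>e>0. ball z e \<subseteq> A" if "z \<in> A" for z
    using step[of z] that unfolding A_def by blast
  then have oA: "open A" by (simp add: open_contains_ball)
  have "\<exists>e>0. ball z e \<subseteq> B" if "z \<in> B" for z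
    using step[of z] that unfolding B_def by blast
  then have oB: "open B" by (simp add: open_contains_ball)
  have "A \<inter> B \<inter> S = {}" "S \<subseteq> A \<union> B" by (auto simp: A_def B_def)
  then have "A \<inter> S = {} \<or> B \<inter> S = {}"
    by (rule connectedD[OF S(2) oA oB])
  moreover have "P a" unfolding P_def by (intro exI[of _ 1]) simp
  ultimately have "P b" using a b by (auto simp: A_def B_def)
  then show ?thesis by (simp add: P_def)
qed

text \<open>Continuous approximation to the indicator of the unit circle: for 0 < q < 1 it rises
  from 0 at modulus 1 - q ^ N to 1 at the circle, and on the closed disk it decreases to the
  indicator as N grows.\<close>

definition annulus_test :: "real \<Rightarrow> nat \<Rightarrow> complex \<Rightarrow> real" where
  "annulus_test q N x = max 0 ((cmod x - (1 - q ^ N)) / q ^ N)"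

lemma annulus_test:
  assumes "0 < q"
  shows "continuous_on A (annulus_test q N)" "0 \<le> annulus_test q N x"
    "cmod x \<le> 1 \<Longrightarrow> annulus_test q N x \<le> 1" "cmod x = 1 \<Longrightarrow> annulus_test q N x = 1"
    "cmod x \<le> 1 - q ^ N \<Longrightarrow> annulus_test q N x = 0"
    "1 - e * q ^ N \<le> cmod x \<Longrightarrow> 1 - e \<le> annulus_test q N x"
proof -
  have p: "q ^ N > 0" using assms by simp
  show "continuous_on A (annulus_test q N)" unfolding annulus_test_def by (intro continuous_intros) (use assms in auto)
  show "0 \<le> annulus_test q N x" by (simp add: annulus_test_def)
  show "annulus_test q N x \<le> 1" if "cmod x \<le> 1" using that p by (simp add: annulus_test_def divide_le_eq)
  show "annulus_test q N x = 1" if "cmod x = 1" using that assms by (simp add: annulus_test_def)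
  show "annulus_test q N x = 0" if "cmod x \<le> 1 - q ^ N" 
  proof -
    have "(cmod x - (1 - q ^ N)) / q ^ N \<le> 0" using that p by (intro divide_nonpos_pos) auto
    then show ?thesis unfolding annulus_test_def by simp
  qed
  show "1 - e \<le> annulus_test q N x" if "1 - e * q ^ N \<le> cmod x"
  proof -
    have "1 - e \<le> (cmod x - (1 - q ^ N)) / q ^ N" using that p by (simp add: le_divide_eq algebra_simps)
    then show ?thesis unfolding annulus_test_def by simp
  qed
qed

context champagne
begin

lemma measure_setup:
  obtains M where "prob_space M" "sets M = sets (restrict_space borel (frontier \<Omega>))"
    "\<And>f u. continuous_on (frontier \<Omega>) f \<Longrightarrow> harm_extension \<Omega> f u \<Longrightarrow> u 0 = (\<integral>x. f x \<partial>M)"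
    "\<And>A. harmonic_measure 0 A \<Omega> = measure M A"
  using harmonic_measure_representation[OF open_Omega bounded_Omega zero extension_exists] by blast

text \<open>Compare u with S (1 - w) on the part of \<Omega> inside the pseudohyperbolic disk of
  radius s, where w is the multiple of ln (s / \<rho>) that equals 1 at \<rho> = r n. On the rim w =
  0 and u <= S; on every removed circle u = 0 and w <= 1. Further removed disks in the region
  therefore do no harm.\<close>

lemma disk_decay:
  assumes u: "harm_extension \<Omega> f u" and f0: "\<And>x. x \<in> frontier \<Omega> \<Longrightarrow> cmod x \<le> R \<Longrightarrow> f x = 0"
    and S: "0 \<le> S" and rc: "r n \<le> rc" "0 < rc" "rc < s" "s < 1"
    and inside: "\<And>x. cmod x < 1 \<Longrightarrow> pseudohyp_dist (\<Lambda> n) x \<le> s \<Longrightarrow> cmod x \<le> R"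
    and le: "\<And>x. x \<in> closure \<Omega> \<Longrightarrow> cmod x \<le> R \<Longrightarrow> u x \<le> S"
    and z: "z \<in> \<Omega>" "pseudohyp_dist (\<Lambda> n) z \<le> rc"
  shows "u z \<le> S * (1 - ln (s / rc) / ln (1 / r n))"
proof -
  have s: "0 < s" using rc by linarith
  define c where "c = of_real ((1 - s\<^sup>2) / (1 - s\<^sup>2 * (cmod (\<Lambda> n))\<^sup>2)) * \<Lambda> n"
  define t where "t = s * (1 - (cmod (\<Lambda> n))\<^sup>2) / (1 - s\<^sup>2 * (cmod (\<Lambda> n))\<^sup>2)"
  note B = pseudohyp_disk_cball[OF Lam(1)[of n] s rc(4), folded c_def t_def]
  define V where "V = \<Omega> \<inter> ball c t"
  have V: "open V" "bounded V" unfolding V_def using open_Omega bounded_Omega by auto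
  have "closure V \<subseteq> closure \<Omega> \<inter> cball c t"
    unfolding V_def by (meson closed_cball closure_minimal closure_mono inf.boundedI inf.cobounded1 inf.cobounded2 ball_subset_cball order_trans)
  then have cV: "x \<in> closure \<Omega>" "cmod (x - c) \<le> t" "cmod x < 1" if "x \<in> closure V" for x
    using that B(2) by (auto simp: dist_norm norm_minus_commute)
  have lower: "r n \<le> pseudohyp_dist (\<Lambda> n) x" if "x \<in> closure V" for x
    by (rule closure_pseudohyp) (use cV[OF that] in auto)
  define L where "L = ln s - ln (r n)"
  have L: "L > 0" unfolding L_def using rc r(1)[of n] by simp
  define w where "w x = (ln s - ln (pseudohyp_dist (\<Lambda> n) x)) / L" for x
  have hw: "harm w V"
  proof -
    have "\<Lambda> n \<notin> V"
    proof
      assume "\<Lambda> n \<in> V"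
      then have "r n \<le> pseudohyp_dist (\<Lambda> n) (\<Lambda> n)" using lower closure_subset by blast
      then show False using r(1)[of n] by (simp add: pseudohyp_dist_def)
    qed
    then have "V \<subseteq> ball 0 1 - {\<Lambda> n}" unfolding V_def using Omega_subset(1) by blast
    then have "harm (\<lambda>x. ln (pseudohyp_dist (\<Lambda> n) x)) V"
      using harm_subset[OF harm_ln_pseudohyp[OF Lam(1)[of n]]] by blast
    then have "harm (\<lambda>x. (1 / L) * (ln s - ln (pseudohyp_dist (\<Lambda> n) x))) V"
      by (intro harm_cmult harm_diff harm_const)
    then show ?thesis by (simp add: w_def[abs_def])
  qed
  have cw: "continuous_on (closure V) w"
  proof -
    have "continuous_on (closure V) (pseudohyp_dist (\<Lambda> n))"
      using cV(3) by (intro continuous_on_subset[OF continuous_on_pseudohyp[OF Lam(1)]]) (force intro: less_imp_le)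
    then show ?thesis
      unfolding w_def using lower r(1)[of n] L by (intro continuous_intros) force+
  qed
  have hu: "harm u V" "continuous_on (closure V) u"
    using u harm_subset[of u \<Omega> V] continuous_on_subset[of "closure \<Omega>" u "closure V"] cV(1)
    unfolding harm_extension_def V_def by blast+
  have hv: "harm (\<lambda>x. u x - S * (1 - w x)) V"
    by (intro harm_diff harm_cmult harm_const hu hw)
  have main: "u x - S * (1 - w x) \<le> 0" if "x \<in> closure V" for x
  proof (rule submean_max_principle[OF V _ harm_submean(1)[OF hv V(1)] _ that])
    show "continuous_on (closure V) (\<lambda>x. u x - S * (1 - w x))"
      by (intro continuous_intros hu cw)
    fix y assume "y \<in> frontier V"
    then have y: "y \<in> closure V" "y \<notin> V" using V(1) by (auto simp: frontier_def interior_open)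
    note cy = cV[OF y(1)]
    have ys: "pseudohyp_dist (\<Lambda> n) y \<le> s" using B(3)[OF cy(3)] cy(2) by simp
    have yR: "cmod y \<le> R" by (rule inside[OF cy(3) ys])
    show "u y - S * (1 - w y) \<le> 0"
    proof (cases "y \<in> \<Omega>")
      case True
      then have "\<not> cmod (y - c) < t" using y(2) by (auto simp: V_def dist_norm norm_minus_commute)
      then have "pseudohyp_dist (\<Lambda> n) y = s" using B(4)[OF cy(3)] ys by simp
      then have "w y = 0" by (simp add: w_def)
      then show ?thesis using le[OF cy(1) yR] by simp
    next
      case False
      then have yf: "y \<in> frontier \<Omega>" using cy(1) open_Omega by (simp add: frontier_def interior_open)
      then have "u y = 0" using u f0[OF yf yR] by (simp add: harm_extension_def)
      moreover have "ln (r n) \<le> ln (pseudohyp_dist (\<Lambda> n) y)" using lower[OF y(1)] r(1)[of n] by (subst ln_le_cancel_iff) auto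
      then have "w y \<le> 1" unfolding w_def using L by (simp add: divide_le_eq L_def)
      ultimately show ?thesis using S by simp
    qed
  qed
  have z1: "cmod z < 1" using z(1) Omega_subset(1) by auto
  have "pseudohyp_dist (\<Lambda> n) z < s" using z(2) rc by linarith
  then have "z \<in> V" using B(4)[OF z1] z(1) by (auto simp: V_def dist_norm norm_minus_commute)
  then have zV: "z \<in> closure V" using closure_subset by blast
  have rz: "0 < pseudohyp_dist (\<Lambda> n) z" using lower[OF zV] r(1)[of n] by linarith
  \<comment> \<open>As s < 1, ln (s / r n) may be enlarged to ln (1 / r n), the quantity that occurs
    in the integral.\<close>
  have "ln (s / rc) / ln (1 / r n) \<le> ln (s / rc) / L"
  proof (rule divide_left_mono)
    show "L \<le> ln (1 / r n)" unfolding L_def using s rc r(1)[of n] by (simp add: ln_div)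
    show "0 \<le> ln (s / rc)" using rc by simp
    show "0 < ln (1 / r n) * L" using L r[of n] by (intro mult_pos_pos) (auto simp: ln_div)
  qed
  also have "\<dots> \<le> w z"
  proof -
    have "ln (pseudohyp_dist (\<Lambda> n) z) \<le> ln rc" using z(2) rz rc by simp
    then show ?thesis unfolding w_def using L s rc by (intro divide_right_mono) (auto simp: ln_div)
  qed
  finally have "S * (1 - w z) \<le> S * (1 - ln (s / rc) / ln (1 / r n))"
    using S by (intro mult_left_mono) auto
  then show ?thesis using main[OF zV] by linarith
qed

text \<open>One application of \<open>disk_decay\<close> per scale, by downward induction from
  modulus 1 - q ^ N, where u <= 1, to modulus 0. The condition \<kappa> <= ln (1 / \<phi> t) keeps
  the factors nonnegative, so that they can be multiplied.\<close>

lemma harmonic_decay: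
  obtains q \<kappa> where "0 < q" "q < 1" "0 < \<kappa>" "\<And>t. t \<in> {0<..<1} \<Longrightarrow> \<kappa> \<le> ln (1 / \<phi> t)"
    "\<And>N u. harm_extension \<Omega> (annulus_test q N) u \<Longrightarrow> u 0 \<le> (\<Prod>k=0..<N. 1 - \<kappa> / ln (1 / \<phi> (1 - q ^ Suc k)))"
proof -
  obtain c where c: "0 < c" "c < 1" "\<forall>t\<in>{0<..<1}. \<phi> t \<le> c" using bound_c by blast
  obtain s0 where s0: "0 < s0" "s0 < 1" "\<forall>z. cmod z < 1 \<longrightarrow> (\<exists>n. pseudohyp_dist (\<Lambda> n) z \<le> s0)" using covered by blast
  \<comment> \<open>\<open>rc\<close> is at least the covering radius and at least every value of
    \<phi>, so the disk of radius rc about a suitable centre contains both the given point and the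
    hole; s lies midway between rc and 1, leaving the fixed ratio s / rc.\<close>
  define rc s where "rc = max c s0" and "s = (1 + max c s0) / 2"
  have rc: "0 < rc" "rc < 1" "rc < s" "s < 1" "0 < s" using c s0 by (auto simp: rc_def s_def)
  define \<kappa> where "\<kappa> = ln (s / rc)"
  have \<kappa>: "0 < \<kappa>" using rc by (simp add: \<kappa>_def)
  define a1 a2 where "a1 = (1 - rc\<^sup>2) / 4" and "a2 = (1 - s\<^sup>2) / 4"
  have "0 < a1" "0 < a2"
    using rc by (simp_all add: a1_def a2_def power_less_one_iff abs_square_less_1)
  moreover have "a1 \<le> 1 / 4" "a2 \<le> 1 / 4" by (simp_all add: a1_def a2_def)
  ultimately have a: "0 < a1" "a1 < 1" "0 < a2" "a2 < 1" by auto
  \<comment> \<open>a1 pays for going from x to a centre within rc of it, a2 for going from that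
    centre to the disk of radius s around it: if x has modulus at most 1 - q ^ k, everything stays
    within modulus 1 - q ^ Suc k.\<close>
  define q where "q = a1 * a2"
  have q3: "q \<le> a1" unfolding q_def using a by (intro mult_left_le) auto
  have "0 < q" using a by (simp add: q_def)
  then have q: "0 < q" "q < 1" "q \<le> a1" using a q3 by auto
  have \<phi>: "0 < \<phi> t" "\<phi> t \<le> rc" if "t \<in> {0<..<1}" for t
    using that phi c(3) by (auto simp: rc_def le_max_iff_disj)
  have \<kappa>\<phi>: "\<kappa> \<le> ln (1 / \<phi> t)" if "t \<in> {0<..<1}" for t
  proof -
    have "s / rc \<le> 1 / \<phi> t" using \<phi>[OF that] rc by (intro frac_le) auto
    then show ?thesis unfolding \<kappa>_def using rc \<phi>[OF that] by (subst ln_le_cancel_iff) auto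
  qed
  have R01: "1 - q ^ Suc k \<in> {0<..<1}" for k
    using q by (simp add: power_less_one_iff del: power_Suc)
  define \<epsilon> where "\<epsilon> k = \<kappa> / ln (1 / \<phi> (1 - q ^ Suc k))" for k
  have \<epsilon>: "0 \<le> 1 - \<epsilon> k" for k
    using \<kappa>\<phi>[OF R01[of k]] \<kappa> unfolding \<epsilon>_def by (simp add: divide_le_eq)
  have "u 0 \<le> (\<Prod>k=0..<N. 1 - \<epsilon> k)" if u: "harm_extension \<Omega> (annulus_test q N) u" for N u
  proof -
    have "\<forall>x\<in>closure \<Omega>. cmod x \<le> 1 - q ^ k \<longrightarrow> u x \<le> (\<Prod>j=k..<N. 1 - \<epsilon> j)" if "k \<le> N" for k
      using that
    proof (induction k rule: inc_induct)
      case base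
      have "u x \<le> 1" if "x \<in> closure \<Omega>" for x
      proof (rule harm_extension_le[OF u open_Omega bounded_Omega _ that])
        fix y assume "y \<in> frontier \<Omega>"
        then have "cmod y \<le> 1" using frontier_in_closure Omega_subset(2) by fastforce
        then show "annulus_test q N y \<le> 1" by (rule annulus_test(3)[OF q(1)])
      qed
      then show ?case by simp
    next
      case (step k)
      define S where "S = (\<Prod>j=Suc k..<N. 1 - \<epsilon> j)"
      have S: "0 \<le> S" unfolding S_def by (intro prod_nonneg \<epsilon>)
      have Seq: "(\<Prod>j=k..<N. 1 - \<epsilon> j) = (1 - \<epsilon> k) * S"
        unfolding S_def using step by (subst prod.atLeast_Suc_lessThan) auto
      show ?case
      proof (intro ballI impI)
        fix x assume x: "x \<in> closure \<Omega>" "cmod x \<le> 1 - q ^ k"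
        have qk: "0 < q ^ k" "q ^ N \<le> q ^ Suc k" using q step by (auto intro!: power_decreasing simp del: power_Suc)
        have x1: "cmod x < 1" using x qk by linarith
        show "u x \<le> (\<Prod>j=k..<N. 1 - \<epsilon> j)"
        proof (cases "x \<in> \<Omega>")
          case False
          then have xf: "x \<in> frontier \<Omega>" using x(1) open_Omega by (simp add: frontier_def interior_open)
          have "q ^ N \<le> q ^ k" using q step by (intro power_decreasing) auto
          then have "cmod x \<le> 1 - q ^ N" using x(2) by linarith
          then have "u x = 0" using u xf annulus_test(5)[OF q(1), of x N] by (simp add: harm_extension_def)
          then show ?thesis unfolding Seq using S \<epsilon>[of k] by simp
        next
          case True
          obtain n where n: "pseudohyp_dist (\<Lambda> n) x \<le> s0" using s0(3) x1 by blast
          then have nrc: "pseudohyp_dist (\<Lambda> n) x \<le> rc" by (simp add: rc_def)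
          have nn: "a1 * (1 - cmod x) \<le> 1 - cmod (\<Lambda> n)"
            unfolding a1_def using nrc rc by (intro pseudohyp_dist_le_imp x1 Lam(1)) (auto simp: pseudohyp_dist_commute)
          have qk1: "a1 * q ^ k \<le> 1 - cmod (\<Lambda> n)"
          proof -
            have "a1 * q ^ k \<le> a1 * (1 - cmod x)" using x(2) a by (intro mult_left_mono) auto
            then show ?thesis using nn by linarith
          qed
          have in1: "cmod (\<Lambda> n) \<le> 1 - q ^ Suc k"
          proof -
            have "q * q ^ k \<le> a1 * q ^ k" using q(3) qk by (intro mult_right_mono) auto
            then show ?thesis using qk1 by simp
          qed
          have rn: "r n \<le> rc" unfolding r_def using \<phi>(2)[of "cmod (\<Lambda> n)"] Lam[of n] by simp
          have ux: "u x \<le> S * (1 - ln (s / rc) / ln (1 / r n))"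
          proof (rule disk_decay[OF u _ S rn rc(1,3,4) _ _ True nrc])
            show "annulus_test q N y = 0" if "cmod y \<le> 1 - q ^ Suc k" for y
              using that qk(2) by (intro annulus_test(5)[OF q(1)]) linarith
            show "cmod y \<le> 1 - q ^ Suc k" if y: "cmod y < 1" "pseudohyp_dist (\<Lambda> n) y \<le> s" for y
            proof -
              have "a2 * (1 - cmod (\<Lambda> n)) \<le> 1 - cmod y"
                unfolding a2_def using y rc by (intro pseudohyp_dist_le_imp Lam(1)) auto
              moreover have "a2 * (a1 * q ^ k) \<le> a2 * (1 - cmod (\<Lambda> n))" using qk1 a by (intro mult_left_mono) auto
              ultimately show ?thesis by (simp add: q_def mult_ac)
            qed
            show "u y \<le> S" if "y \<in> closure \<Omega>" "cmod y \<le> 1 - q ^ Suc k" for y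
              using step.IH that unfolding S_def by blast
          qed
          \<comment> \<open>\<phi> is nonincreasing and the centre has modulus at most 1 - q ^ Suc
            k, so its hole is at least as large as prescribed at that modulus.\<close>
          have "\<phi> (1 - q ^ Suc k) \<le> r n"
            unfolding r_def using in1 Lam[of n] R01[of k] anti by (auto simp: monotone_on_def)
          then have "ln (1 / r n) \<le> ln (1 / \<phi> (1 - q ^ Suc k))"
            using \<phi>(1)[OF R01[of k]] r(1)[of n] by (subst ln_le_cancel_iff) (auto intro!: frac_le)
          moreover have "0 < ln (1 / r n)" using r[of n] by (simp add: ln_div)
          ultimately have "\<epsilon> k \<le> ln (s / rc) / ln (1 / r n)"
            unfolding \<epsilon>_def \<kappa>_def[symmetric] using \<kappa> by (intro divide_left_mono) auto
          then have "S * (1 - ln (s / rc) / ln (1 / r n)) \<le> S * (1 - \<epsilon> k)"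
            using S by (intro mult_left_mono) auto
          then show ?thesis using ux unfolding Seq by (simp add: mult.commute)
        qed
      qed
    qed
    from this[of 0] show ?thesis using zero closure_subset by auto
  qed
  then show ?thesis using that[OF q(1,2) \<kappa> \<kappa>\<phi>] unfolding \<epsilon>_def by blast
qed

lemma harmonic_measure_le_extension:
  assumes "0 < q" "harm_extension \<Omega> (annulus_test q N) u"
  shows "harmonic_measure 0 (sphere 0 1) \<Omega> \<le> u 0"
proof -
  obtain M where M: "prob_space M" "sets M = sets (restrict_space borel (frontier \<Omega>))"
    "\<And>f u. continuous_on (frontier \<Omega>) f \<Longrightarrow> harm_extension \<Omega> f u \<Longrightarrow> u 0 = (\<integral>x. f x \<partial>M)"
    "\<And>A. harmonic_measure 0 A \<Omega> = measure M A" using measure_setup by blast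
  interpret prob_space M by fact
  have sp: "space M = frontier \<Omega>" using sets_eq_imp_space_eq[OF M(2)] by (simp add: space_restrict_space)
  have sm: "sphere 0 1 \<in> sets M"
    using M(2) sphere_frontier by (simp add: sets_restrict_space_iff)
  have mt: "annulus_test q N \<in> borel_measurable M"
    using measurable_restrict_space1[of "annulus_test q N" borel borel "frontier \<Omega>", OF borel_measurable_continuous_onI[OF annulus_test(1)[OF assms(1)]]]
      measurable_cong_sets[OF M(2) refl] by blast
  have le1: "annulus_test q N x \<le> 1" if "x \<in> space M" for x
    using that frontier_in_closure Omega_subset(2) annulus_test(3)[OF assms(1)] unfolding sp by force
  have "measure M (sphere 0 1) = (\<integral>x. indicator (sphere 0 1) x \<partial>M)"
    using sm sets.sets_into_space[OF sm] by (simp add: Int_absorb2)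
  also have "\<dots> \<le> (\<integral>x. annulus_test q N x \<partial>M)"
  proof (rule integral_mono)
    show "integrable M (indicator (sphere 0 1) :: complex \<Rightarrow> real)" using sm by (simp add: emeasure_eq_measure)
    show "integrable M (annulus_test q N)"
      by (rule integrable_const_bound[of _ 1]) (use mt le1 annulus_test(2)[OF assms(1)] in auto)
    show "indicator (sphere 0 1) x \<le> annulus_test q N x" for x
      using annulus_test(2)[OF assms(1), of N x] annulus_test(4)[OF assms(1), of x N] by (simp add: indicator_def)
  qed
  also have "\<dots> = u 0" using M(3)[OF annulus_test(1)[OF assms(1)] assms(2)] by simp
  finally show ?thesis by (simp add: M(4))
qed

lemma extension_tendsto_harmonic_measure:
  assumes "0 < q" "q < 1" "\<And>N. harm_extension \<Omega> (annulus_test q N) (u N)"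
  shows "(\<lambda>N. u N 0) \<longlonglongrightarrow> harmonic_measure 0 (sphere 0 1) \<Omega>"
proof -
  obtain M where M: "prob_space M" "sets M = sets (restrict_space borel (frontier \<Omega>))"
    "\<And>f u. continuous_on (frontier \<Omega>) f \<Longrightarrow> harm_extension \<Omega> f u \<Longrightarrow> u 0 = (\<integral>x. f x \<partial>M)"
    "\<And>A. harmonic_measure 0 A \<Omega> = measure M A" using measure_setup by blast
  interpret prob_space M by fact
  have sp: "space M = frontier \<Omega>" using sets_eq_imp_space_eq[OF M(2)] by (simp add: space_restrict_space)
  have sm: "sphere 0 1 \<in> sets M"
    using M(2) sphere_frontier by (simp add: sets_restrict_space_iff)
  have mt: "annulus_test q N \<in> borel_measurable M" for N
    using measurable_restrict_space1[of "annulus_test q N" borel borel "frontier \<Omega>", OF borel_measurable_continuous_onI[OF annulus_test(1)[OF assms(1)]]]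
      measurable_cong_sets[OF M(2) refl] by blast
  have c1: "cmod x \<le> 1" if "x \<in> space M" for x
    using that frontier_in_closure Omega_subset(2) unfolding sp by force
  have "(\<lambda>N. \<integral>x. annulus_test q N x \<partial>M) \<longlonglongrightarrow> (\<integral>x. indicator (sphere 0 1) x \<partial>M)"
  proof (rule integral_dominated_convergence[where w = "\<lambda>_. 1"])
    show "(indicator (sphere 0 1) :: complex \<Rightarrow> real) \<in> borel_measurable M" using sm by simp
    show "AE x in M. norm (annulus_test q N x) \<le> 1" for N
      using c1 annulus_test(2,3)[OF assms(1)] by (intro AE_I2) simp
    show "AE x in M. (\<lambda>N. annulus_test q N x) \<longlonglongrightarrow> indicator (sphere 0 1) x"
    proof (rule AE_I2)
      fix x assume x: "x \<in> space M"
      show "(\<lambda>N. annulus_test q N x) \<longlonglongrightarrow> indicator (sphere 0 1) x"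
      proof (cases "cmod x = 1")
        case True
        then show ?thesis using annulus_test(4)[OF assms(1) True] by simp
      next
        case False
        then have "0 < 1 - cmod x" using c1[OF x] by simp
        moreover have "(\<lambda>N. q ^ N) \<longlonglongrightarrow> 0" using assms by (intro LIMSEQ_power_zero) simp
        ultimately have "\<forall>\<^sub>F N in sequentially. q ^ N < 1 - cmod x" by (rule order_tendstoD(2)[rotated])
        then have "\<forall>\<^sub>F N in sequentially. annulus_test q N x = 0"
          by eventually_elim (rule annulus_test(5)[OF assms(1)], linarith)
        then show ?thesis using False by (simp add: tendsto_eventually)
      qed
    qed
  qed (use mt in auto)
  moreover have "(\<integral>x. indicator (sphere 0 1) x \<partial>M) = measure M (sphere 0 1)"
    using sm sets.sets_into_space[OF sm] by (simp add: Int_absorb2)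
  moreover have "(\<integral>x. annulus_test q N x \<partial>M) = u N 0" for N
    using M(3)[OF annulus_test(1)[OF assms(1)] assms(3)] by simp
  ultimately show ?thesis by (simp add: M(4))
qed

text \<open>1 - x <= exp (-x) turns the product into exp (-\<kappa> * sum), which falls below any e.
  Divergence is assumed for all q because \<open>harmonic_decay\<close> chooses its own.\<close>

theorem harmonic_measure_zero:
  assumes "\<And>q. 0 < q \<Longrightarrow> q < 1 \<Longrightarrow> \<not> summable (\<lambda>k. 1 / ln (1 / \<phi> (1 - q ^ Suc k)))"
  shows "harmonic_measure 0 (sphere 0 1) \<Omega> \<le> 0"
proof -
  obtain q \<kappa> where q: "0 < q" "q < 1" "0 < \<kappa>" "\<And>t. t \<in> {0<..<1} \<Longrightarrow> \<kappa> \<le> ln (1 / \<phi> t)"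
    "\<And>N u. harm_extension \<Omega> (annulus_test q N) u \<Longrightarrow> u 0 \<le> (\<Prod>k=0..<N. 1 - \<kappa> / ln (1 / \<phi> (1 - q ^ Suc k)))"
    by (rule harmonic_decay) blast
  define a where "a k = 1 / ln (1 / \<phi> (1 - q ^ Suc k))" for k
  have R01: "1 - q ^ Suc k \<in> {0<..<1}" for k
    using q by (simp add: power_less_one_iff del: power_Suc)
  have a: "0 \<le> a k" "\<kappa> * a k \<le> 1" for k
    using q(4)[OF R01[of k]] q(3) by (auto simp: a_def divide_le_eq)
  have ns: "\<not> summable a" using assms[OF q(1,2)] by (simp add: a_def[abs_def])
  have "harmonic_measure 0 (sphere 0 1) \<Omega> \<le> 0 + e" if e: "e > 0" for e
  proof -
    have "\<exists>N. - ln e / \<kappa> < sum a {..<N}"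
    proof (rule ccontr)
      assume "\<not> ?thesis"
      then have "sum a {..<N} \<le> - ln e / \<kappa>" for N by (simp add: not_less)
      then have "summable a" using a(1) by (intro summableI_nonneg_bounded[of a "- ln e / \<kappa>"]) auto
      then show False using ns by simp
    qed
    then obtain N where N: "- ln e / \<kappa> < sum a {..<N}" by blast
    obtain u where u: "harm_extension \<Omega> (annulus_test q N) u"
      using extension_exists[OF annulus_test(1)[OF q(1)]] by blast
    have "u 0 \<le> (\<Prod>k=0..<N. 1 - \<kappa> * a k)" using q(5)[OF u] by (simp add: a_def)
    also have "\<dots> \<le> (\<Prod>k=0..<N. exp (- (\<kappa> * a k)))"
    proof (rule prod_mono)
      fix k
      show "0 \<le> 1 - \<kappa> * a k \<and> 1 - \<kappa> * a k \<le> exp (- (\<kappa> * a k))"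
        using a(2)[of k] exp_ge_add_one_self[of "- (\<kappa> * a k)"] by simp
    qed
    also have "\<dots> = exp (- (\<kappa> * sum a {..<N}))"
    proof -
      have "(\<Prod>k=0..<N. exp (- (\<kappa> * a k))) = exp (\<Sum>k=0..<N. - (\<kappa> * a k))"
        by (rule exp_sum[symmetric]) simp
      also have "(\<Sum>k=0..<N. - (\<kappa> * a k)) = - (\<kappa> * sum a {..<N})"
        by (simp add: sum_negf sum_distrib_left atLeast0LessThan)
      finally show ?thesis .
    qed
    also have "\<dots> \<le> exp (ln e)"
    proof -
      have "- ln e < \<kappa> * sum a {..<N}" using mult_strict_left_mono[OF N q(3)] q(3) by simp
      then show ?thesis by simp
    qed
    finally show ?thesis using harmonic_measure_le_extension[OF q(1) u] e by simp
  qed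
  then show ?thesis by (rule field_le_epsilon)
qed

end

section \<open>Lower bound by Green functions\<close>

context champagne
begin

text \<open>A Green function of the disk, normalised on the boundary of the n-th disk and truncated there;
  the truncation also removes the pole, where the logarithm would take the junk value of ln 0.\<close>

definition green :: "nat \<Rightarrow> complex \<Rightarrow> real" where
  "green n x = ln (1 / max (pseudohyp_dist (\<Lambda> n) x) (r n)) / ln (1 / r n)"

lemma ln_r_pos: "0 < ln (1 / r n)"
  using r[of n] by (simp add: ln_div)

lemma green_nonneg:
  assumes "cmod x \<le> 1"
  shows "0 \<le> green n x"
proof -
  have "pseudohyp_dist (\<Lambda> n) x \<le> 1"
    using pseudohyp_dist_less_1[OF Lam(1)[of n], of x] pseudohyp_dist_boundary[OF Lam(1)[of n], of x] assms by fastforce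
  then have "0 \<le> ln (1 / max (pseudohyp_dist (\<Lambda> n) x) (r n))"
    using r[of n] by (intro ln_ge_zero) (auto simp: le_divide_eq max_def)
  then show ?thesis unfolding green_def using ln_r_pos[of n] by simp
qed

lemma green_eq_1:
  assumes "x \<in> D n"
  shows "green n x = 1"
proof -
  have x1: "cmod x < 1" using assms disk(2)[of n] by auto
  have "pseudohyp_dist (\<Lambda> n) x \<le> r n" using disk(3)[OF x1, of n] assms by (simp add: dist_norm norm_minus_commute)
  then show ?thesis unfolding green_def using ln_r_pos[of n] by (simp add: max_absorb2)
qed

lemma green_sphere: "cmod x = 1 \<Longrightarrow> green n x = 0"
  using r[of n] by (simp add: green_def pseudohyp_dist_boundary[OF Lam(1)])

lemma green_continuous: "continuous_on (cball 0 1) (green n)"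
proof -
  have "max (pseudohyp_dist (\<Lambda> n) x) (r n) \<noteq> 0" for x using r(1)[of n] by (simp add: max_def)
  moreover have "0 < 1 / max (pseudohyp_dist (\<Lambda> n) x) (r n)" for x using r(1)[of n] by (simp add: max_def)
  ultimately show ?thesis
    unfolding green_def using continuous_on_pseudohyp[OF Lam(1)[of n]] ln_r_pos[of n]
    by (intro continuous_intros) (auto simp: less_imp_neq[symmetric])
qed

lemma green_harm:
  assumes "S \<subseteq> ball 0 1 - D n"
  shows "harm (green n) S"
proof -
  have "\<Lambda> n \<in> D n" using disk(5)[of n] by (simp add: dist_norm norm_minus_commute)
  then have "S \<subseteq> ball 0 1 - {\<Lambda> n}" using assms by blast
  then have "harm (\<lambda>x. ln (pseudohyp_dist (\<Lambda> n) x)) S" by (rule harm_subset[OF harm_ln_pseudohyp[OF Lam(1)]])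
  then have "harm (\<lambda>x. (- 1 / ln (1 / r n)) * ln (pseudohyp_dist (\<Lambda> n) x)) S" by (rule harm_cmult)
  then show ?thesis
  proof (rule harm_cong)
    fix x assume "x \<in> S"
    then have x: "cmod x < 1" "x \<notin> D n" using assms by auto
    then have "r n < pseudohyp_dist (\<Lambda> n) x" using disk(3)[OF x(1), of n] by (simp add: dist_norm norm_minus_commute)
    then show "green n x = (- 1 / ln (1 / r n)) * ln (pseudohyp_dist (\<Lambda> n) x)"
      unfolding green_def using r[of n] by (simp add: max_absorb1 ln_div)
  qed
qed

lemma green_0: "green n 0 = ln (1 / cmod (\<Lambda> n)) / ln (1 / r n)"
proof -
  have "0 \<notin> D n" using zero by (auto simp: Omega_eq)
  then have "r n < pseudohyp_dist (\<Lambda> n) 0" using disk(3)[of 0 n] by (simp add: dist_norm)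
  then show ?thesis by (simp add: green_def max_absorb1 pseudohyp_dist_0)
qed

text \<open>At frontier points with |x| >= 1 - e * q ^ N the value of u is already at least 1 - e,
  so only removed disks reaching inside that circle need a Green function. They are finitely many,
  and no infinite sum of harmonic functions arises.\<close>

lemma extension_ge_green:
  assumes q: "0 < q" "q < 1" and u: "harm_extension \<Omega> (annulus_test q N) u" and e: "0 < e"
  obtains F where "finite F" "\<And>z. z \<in> \<Omega> \<Longrightarrow> 1 - e - (\<Sum>n\<in>F. green n z) \<le> u z"
proof -
  define R where "R = 1 - e * q ^ N"
  define F where "F = {n. D n \<inter> cball 0 R \<noteq> {}}"
  have F: "finite F" unfolding F_def R_def using q e by (intro locally_finite) simp
  have "1 - e - (\<Sum>n\<in>F. green n z) \<le> u z" if z: "z \<in> \<Omega>" for z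
  proof -
    have "(1 - e) - (\<Sum>n\<in>F. green n z) - u z \<le> 0"
    proof (rule submean_max_principle[OF open_Omega bounded_Omega])
      have hu: "harm u \<Omega>" "continuous_on (closure \<Omega>) u" using u by (auto simp: harm_extension_def)
      show "continuous_on (closure \<Omega>) (\<lambda>z. (1 - e) - (\<Sum>n\<in>F. green n z) - u z)"
        by (intro continuous_intros hu continuous_on_subset[OF green_continuous Omega_subset(2)])
      have "harm (green n) \<Omega>" for n by (rule green_harm) (auto simp: Omega_eq)
      then show "submean (\<lambda>z. (1 - e) - (\<Sum>n\<in>F. green n z) - u z) \<Omega>"
        by (intro harm_submean(1)[OF _ open_Omega] harm_diff harm_const harm_sum F hu)
      show "z \<in> closure \<Omega>" using z closure_subset by blast
      fix x assume x: "x \<in> frontier \<Omega>"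
      then have x1: "cmod x \<le> 1" using frontier_in_closure Omega_subset(2) by fastforce
      have ux: "u x = annulus_test q N x" using u x by (simp add: harm_extension_def)
      have G: "0 \<le> (\<Sum>n\<in>F. green n x)" by (intro sum_nonneg green_nonneg x1)
      show "(1 - e) - (\<Sum>n\<in>F. green n x) - u x \<le> 0"
      proof (cases "R \<le> cmod x")
        case True
        then have "1 - e \<le> u x" unfolding ux R_def by (intro annulus_test(6)[OF q(1)])
        then show ?thesis using G by linarith
      next
        case False
        then have "cmod x \<noteq> 1" using e q by (auto simp: R_def)
        then obtain n where "cmod (x - cen n) = rad n" using frontier_cases[OF x] by blast
        then have xn: "x \<in> D n" by (simp add: dist_norm norm_minus_commute)
        moreover have "x \<in> cball 0 R" using False by simp
        ultimately have "n \<in> F" unfolding F_def by blast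
        then have "green n x \<le> (\<Sum>n\<in>F. green n x)"
          by (intro member_le_sum F green_nonneg x1)
        moreover have "0 \<le> u x" unfolding ux by (rule annulus_test(2)[OF q(1)])
        ultimately show ?thesis using green_eq_1[OF xn] e by linarith
      qed
    qed
    then show ?thesis by simp
  qed
  then show ?thesis using that[OF F] by blast
qed

text \<open>If at every point of \<Omega> the partial sums exceeded each number below 1, the tail of
  the series would be at least 1/2 on a circle close to the boundary, where the finite head is
  small. By the minimum principle it would be at least 1/2 at 0, where it is less than 1/4.\<close>

lemma exists_small_green_sum:
  assumes sm: "summable (\<lambda>n. green n 0)"
  obtains z \<eta> where "z \<in> \<Omega>" "\<eta> < 1" "\<And>F. finite F \<Longrightarrow> (\<Sum>n\<in>F. green n z) \<le> \<eta>"
proof (rule ccontr)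
  note witness = that
  assume no: "\<not> thesis"
  have contra: "\<exists>F. finite F \<and> \<eta> < (\<Sum>n\<in>F. green n z)" if zc: "z \<in> \<Omega>" and ec: "\<eta> < 1" for z \<eta>
  proof (rule ccontr)
    assume "\<not> ?thesis"
    then have "(\<Sum>n\<in>F. green n z) \<le> \<eta>" if "finite F" for F using that by (meson not_le)
    then have thesis by (rule witness[OF zc ec])
    then show False using no by contradiction
  qed
  have g0: "0 \<le> green n 0" for n by (rule green_nonneg) simp
  have "\<exists>N. \<forall>n\<ge>N. norm (\<Sum>i. green (i + n) 0) < 1 / 4"
    by (rule suminf_exist_split[OF _ sm]) simp
  then obtain N where "norm (\<Sum>i. green (i + N) 0) < 1 / 4" by blast
  then have N: "(\<Sum>n. green (n + N) 0) < 1 / 4" by simp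
  have tail: "(\<Sum>n=N..<M. green n 0) < 1 / 4" for M
  proof (cases "N \<le> M")
    case True
    have "(\<Sum>n=N..<M. green n 0) = (\<Sum>n<M - N. green (n + N) 0)"
      using sum.shift_bounds_nat_ivl[of "\<lambda>n. green n 0" 0 N "M - N"] True by (simp add: atLeast0LessThan)
    also have "\<dots> \<le> (\<Sum>n. green (n + N) 0)"
      using summable_ignore_initial_segment[OF sm, of N] g0 by (intro sum_le_suminf) auto
    finally show ?thesis using N by linarith
  qed simp
  define h where "h x = (\<Sum>n<N. green n x)" for x
  have ch: "continuous_on (cball 0 1) h" unfolding h_def by (intro continuous_intros green_continuous)
  have "uniformly_continuous_on (cball 0 1) h" by (rule compact_uniformly_continuous[OF ch compact_cball])
  then obtain d where d: "d > 0" "\<And>x y. x \<in> cball 0 1 \<Longrightarrow> y \<in> cball 0 1 \<Longrightarrow> dist y x < d \<Longrightarrow> dist (h y) (h x) < 1 / 4"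
    unfolding uniformly_continuous_on_def by (metis zero_less_divide_1_iff zero_less_numeral)
  \<comment> \<open>The head \<open>h\<close> vanishes on the unit circle, so uniform continuity
    makes it less than 1/4 at distance below d; the minimum with 1 keeps R positive.\<close>
  define R where "R = 1 - min d 1 / 2"
  have R: "0 < R" "R < 1" "1 - R < d" using d(1) by (auto simp: R_def)
  have h4: "h x < 1 / 4" if "cmod x = R" for x
  proof -
    define y where "y = of_real (1 / R) * x"
    have "cmod y = \<bar>1 / R\<bar> * R" unfolding y_def norm_mult norm_of_real that ..
    then have y: "cmod y = 1" using R by simp
    have xy: "x = of_real R * y" using R by (simp add: y_def)
    have "x - y = of_real (R - 1) * y" by (subst xy) (simp add: left_diff_distrib)
    then have "dist x y = 1 - R" using y R by (simp only: dist_norm norm_mult norm_of_real) simp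
    moreover have "h y = 0" unfolding h_def using green_sphere[OF y] by simp
    ultimately show ?thesis using d(2)[of y x] y that R by (simp add: dist_real_def)
  qed
  have pt: "\<exists>M. 1 / 2 < (\<Sum>n=N..<M. green n x)" if x: "cmod x = R" for x
  proof -
    have x1: "cmod x \<le> 1" using x R by simp
    have gx: "0 \<le> green n x" for n by (rule green_nonneg[OF x1])
    show ?thesis
    proof (cases "x \<in> \<Omega>")
      case True
      obtain F where F: "finite F" "3 / 4 < (\<Sum>n\<in>F. green n x)" using contra[OF True, of "3/4"] by auto
      obtain M where M: "F \<subseteq> {..<M}" using F(1) finite_nat_iff_bounded by blast
      have "(\<Sum>n\<in>F. green n x) \<le> (\<Sum>n<max N M. green n x)"
        using M gx by (intro sum_mono2) auto
      also have "\<dots> = h x + (\<Sum>n=N..<max N M. green n x)"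
        unfolding h_def using sum.atLeastLessThan_concat[of 0 N "max N M" "\<lambda>n. green n x"] by (simp add: atLeast0LessThan)
      finally have "1 / 2 < (\<Sum>n=N..<max N M. green n x)" using F(2) h4[OF x] by linarith
      then show ?thesis by blast
    next
      case False
      then obtain m where m: "x \<in> D m" using x R by (auto simp: Omega_eq)
      \<comment> \<open>In a removed disk its Green function is 1, too much for the head, so the
        disk belongs to the tail.\<close>
      have "N \<le> m"
      proof (rule ccontr)
        assume "\<not> N \<le> m"
        then have "green m x \<le> h x" unfolding h_def by (intro member_le_sum gx) auto
        then show False using h4[OF x] green_eq_1[OF m] by simp
      qed
      then have "green m x \<le> (\<Sum>n=N..<Suc m. green n x)" by (intro member_le_sum gx) auto
      then show ?thesis using green_eq_1[OF m] by (intro exI[of _ "Suc m"]) simp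
    qed
  qed
  \<comment> \<open>A Dini argument: the partial sums increase with M, and a limit of points
    violating the bound for larger and larger M would contradict \<open>pt\<close>.\<close>
  have "\<exists>M. \<forall>x\<in>sphere 0 R. 1 / 2 \<le> (\<Sum>n=N..<M. green n x)"
  proof (rule ccontr)
    assume "\<not> ?thesis"
    then have "\<forall>M. \<exists>x. x \<in> sphere 0 R \<and> (\<Sum>n=N..<M. green n x) < 1 / 2" by (meson not_le)
    from choice[OF this] obtain X where X: "\<And>M. X M \<in> sphere 0 R" "\<And>M. (\<Sum>n=N..<M. green n (X M)) < 1 / 2" by blast
    have "seq_compact (sphere (0::complex) R)" by (intro compact_imp_seq_compact compact_sphere)
    then obtain x \<rho> where x: "x \<in> sphere 0 R" "strict_mono \<rho>" "(X \<circ> \<rho>) \<longlonglongrightarrow> x"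
      using X(1) unfolding seq_compact_def by metis
    have Xb: "cmod (X M) \<le> 1" for M using X(1)[of M] R by simp
    have "(\<Sum>n=N..<M. green n x) \<le> 1 / 2" for M
    proof (rule LIMSEQ_le_const2)
      have "(\<lambda>j. green n (X (\<rho> j))) \<longlonglongrightarrow> green n x" for n
        using continuous_on_tendsto_compose[OF green_continuous x(3)] x(1) R Xb by (simp add: o_def)
      then show "(\<lambda>j. \<Sum>n=N..<M. green n (X (\<rho> j))) \<longlonglongrightarrow> (\<Sum>n=N..<M. green n x)"
        by (intro tendsto_sum)
      have "(\<Sum>n=N..<M. green n (X (\<rho> j))) \<le> 1 / 2" if "M \<le> j" for j
      proof -
        have "M \<le> \<rho> j" using that seq_suble[OF x(2), of j] by linarith
        then have "(\<Sum>n=N..<M. green n (X (\<rho> j))) \<le> (\<Sum>n=N..<\<rho> j. green n (X (\<rho> j)))"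
          using green_nonneg[OF Xb] by (intro sum_mono2) auto
        then show ?thesis using X(2)[of "\<rho> j"] by linarith
      qed
      then show "\<exists>K. \<forall>j\<ge>K. (\<Sum>n=N..<M. green n (X (\<rho> j))) \<le> 1 / 2" by blast
    qed
    moreover obtain M where "1 / 2 < (\<Sum>n=N..<M. green n x)" using pt[of x] x(1) by auto
    ultimately show False by (meson not_le)
  qed
  then obtain M where M: "\<And>x. x \<in> sphere 0 R \<Longrightarrow> 1 / 2 \<le> (\<Sum>n=N..<M. green n x)" by blast
  \<comment> \<open>Only the disks of the tail piece are removed: its Green functions are harmonic
    off their own disks and equal to 1 on them.\<close>
  define W where "W = ball 0 R - (\<Union>n\<in>{N..<M}. D n)"
  have W: "open W" "bounded W" "0 \<in> W" "closure W \<subseteq> cball 0 R"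
  proof -
    have "closed (\<Union>n\<in>{N..<M}. D n)" by (intro closed_UN) auto
    then show "open W" unfolding W_def by (intro open_Diff) auto
    have "W \<subseteq> ball 0 R" by (auto simp: W_def)
    then show "bounded W" using bounded_ball bounded_subset by blast
    show "0 \<in> W" using zero R by (auto simp: W_def Omega_eq)
    show "closure W \<subseteq> cball 0 R"
      using closure_mono[OF \<open>W \<subseteq> ball 0 R\<close>] R by simp
  qed
  have "- (\<Sum>n=N..<M. green n 0) \<le> - (1 / 2)"
  proof (rule submean_max_principle[OF W(1,2)])
    have cl: "closure W \<subseteq> cball 0 1" using W(4) R by (meson less_imp_le order_trans subset_cball)
    show "continuous_on (closure W) (\<lambda>x. - (\<Sum>n=N..<M. green n x))"
      by (intro continuous_intros continuous_on_subset[OF green_continuous cl])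
    have "harm (green n) W" if "n \<in> {N..<M}" for n
      using that R by (intro green_harm) (auto simp: W_def)
    then show "submean (\<lambda>x. - (\<Sum>n=N..<M. green n x)) W"
      by (intro harm_submean(1)[OF _ W(1)] harm_minus harm_sum) auto
    show "0 \<in> closure W" using W(3) closure_subset by blast
    fix x assume "x \<in> frontier W"
    then have x: "x \<in> closure W" "x \<notin> W" using W(1) by (auto simp: frontier_def interior_open)
    have x1: "cmod x \<le> 1" using x(1) cl by auto
    show "- (\<Sum>n=N..<M. green n x) \<le> - (1 / 2)"
    proof (cases "cmod x = R")
      case True
      then show ?thesis using M[of x] by simp
    next
      case False
      then have "x \<in> ball 0 R" using x(1) W(4) by force
      then obtain n where n: "n \<in> {N..<M}" "x \<in> D n" using x(2) by (auto simp: W_def)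
      have "green n x \<le> (\<Sum>n=N..<M. green n x)"
        using n(1) by (intro member_le_sum green_nonneg x1) auto
      then show ?thesis using green_eq_1[OF n(2)] by simp
    qed
  qed
  then show False using tail[of M] by linarith
qed

text \<open>At the point z the extensions are at least 1 - \<eta> for every N; Harnack's constant
  between 0 and z is independent of N, so a positive lower bound survives the limit.\<close>

theorem harmonic_measure_pos:
  assumes "summable (\<lambda>n. green n 0)"
  shows "0 < harmonic_measure 0 (sphere 0 1) \<Omega>"
proof -
  obtain z \<eta> where z: "z \<in> \<Omega>" "\<eta> < 1" "\<And>F. finite F \<Longrightarrow> (\<Sum>n\<in>F. green n z) \<le> \<eta>"
    by (rule exists_small_green_sum[OF assms]) blast
  obtain C where C: "C > 0" "\<forall>u. harm u \<Omega> \<longrightarrow> (\<forall>x\<in>\<Omega>. 0 \<le> u x) \<longrightarrow> u z \<le> C * u 0"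
    using harnack_chain[OF open_Omega connected_Omega zero z(1)] by blast
  define q :: real where "q = 1 / 2"
  have q: "0 < q" "q < 1" by (auto simp: q_def)
  have "\<exists>u. harm_extension \<Omega> (annulus_test q N) u" for N
    by (rule extension_exists[OF annulus_test(1)[OF q(1)]])
  then obtain u where u: "\<And>N. harm_extension \<Omega> (annulus_test q N) (u N)" by metis
  have "(1 - \<eta>) / C \<le> u N 0" for N
  proof -
    have "1 - \<eta> \<le> u N z + e" if e: "e > 0" for e
    proof -
      obtain F where "finite F" "\<And>z. z \<in> \<Omega> \<Longrightarrow> 1 - e - (\<Sum>n\<in>F. green n z) \<le> u N z"
        using extension_ge_green[OF q u e] by blast
      then show ?thesis using z(1) z(3)[of F] by fastforce
    qed
    then have "1 - \<eta> \<le> u N z" by (rule field_le_epsilon)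
    moreover have "0 \<le> u N x" if "x \<in> \<Omega>" for x
    proof -
      have "- u N x \<le> 0"
      proof (rule harm_extension_le[OF harm_extension_cmult[OF u, of "-1" N, simplified] open_Omega bounded_Omega])
        show "- annulus_test q N y \<le> 0" for y using annulus_test(2)[OF q(1)] by simp
        show "x \<in> closure \<Omega>" using that closure_subset by blast
      qed
      then show ?thesis by simp
    qed
    ultimately have "1 - \<eta> \<le> C * u N 0"
      using C(2) u[of N] unfolding harm_extension_def by force
    then show ?thesis using C(1) by (simp add: divide_le_eq mult.commute)
  qed
  then have "(1 - \<eta>) / C \<le> harmonic_measure 0 (sphere 0 1) \<Omega>"
    by (intro LIMSEQ_le_const[OF extension_tendsto_harmonic_measure[OF q u]]) blast
  moreover have "0 < (1 - \<eta>) / C" using z(2) C(1) by simp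
  ultimately show ?thesis by linarith
qed

end

section \<open>The integral test\<close>

lemma unit_interval_geometric:
  assumes q: "0 < q" "q < (1::real)" and t: "0 \<le> t" "t < 1"
  obtains k where "1 - q ^ k \<le> t" "t < 1 - q ^ Suc k"
proof -
  have "(\<lambda>n. q ^ n) \<longlonglongrightarrow> 0" using q by (intro LIMSEQ_power_zero) simp
  then have "\<forall>\<^sub>F n in sequentially. q ^ n < 1 - t" using t by (intro order_tendstoD) auto
  then obtain n where n: "q ^ n < 1 - t" unfolding eventually_sequentially by blast
  define m where "m = (LEAST n. q ^ n < 1 - t)"
  have m: "q ^ m < 1 - t" unfolding m_def using n by (rule LeastI)
  have "m \<noteq> 0" using m t by (intro notI) simp
  then obtain k where k: "m = Suc k" by (cases m) auto
  have "\<not> q ^ k < 1 - t" using not_less_Least[of k "\<lambda>n. q ^ n < 1 - t"] k unfolding m_def by simp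
  then show ?thesis using that[of k] m k by simp
qed

context champagne
begin

section \<open>Comparison of the integral with sums along geometric scales\<close>

lemma phi_weight:
  assumes "t \<in> {0<..<1}"
  shows "0 < \<phi> t" "\<phi> t < 1" "0 < ln (1 / \<phi> t)"
proof -
  show "0 < \<phi> t" "\<phi> t < 1" using phi assms by auto
  then show "0 < ln (1 / \<phi> t)" by (simp add: ln_div)
qed

lemma phi_weight_mono:
  assumes "s \<in> {0<..<1}" "t \<in> {0<..<1}" "s \<le> t"
  shows "ln (1 / \<phi> s) \<le> ln (1 / \<phi> t)"
proof -
  have "\<phi> t \<le> \<phi> s" using anti assms by (auto simp: monotone_on_def)
  then show ?thesis
    using phi_weight[OF assms(1)] phi_weight[OF assms(2)] by (subst ln_le_cancel_iff) (auto intro!: frac_le)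
qed

lemma one_minus_power: "0 < q \<Longrightarrow> q < 1 \<Longrightarrow> 1 - q ^ Suc k \<in> {0<..<1}" for q :: real
  by (simp add: power_less_one_iff del: power_Suc)

text \<open>On (1 - q ^ k, 1 - q ^ Suc k] the integrand is at least a k / q ^ k, by the value of
  \<phi> at the right end, and the interval has length (1 - q) q ^ k.\<close>

lemma integral_finite_imp_summable:
  assumes fin: "(\<integral>\<^sup>+t\<in>{0<..<1}. ennreal (1 / ((1 - t) * ln (1 / \<phi> t))) \<partial>lborel) < \<infinity>"
    and q: "0 < q" "q < 1"
  shows "summable (\<lambda>k. 1 / ln (1 / \<phi> (1 - q ^ Suc k)))"
proof -
  define a where "a k = 1 / ln (1 / \<phi> (1 - q ^ Suc k))" for k
  note R01 = one_minus_power[OF q]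
  have a: "0 < a k" for k unfolding a_def using phi_weight(3)[OF R01[of k]] by simp
  define J where "J k = {1 - q ^ k <.. 1 - q ^ Suc k}" for k
  let ?I = "\<integral>\<^sup>+t\<in>{0<..<1}. ennreal (1 / ((1 - t) * ln (1 / \<phi> t))) \<partial>lborel"
  have qs: "q ^ Suc k < q ^ k" for k using q by simp
  have J_disj: "m = k" if "t \<in> J m" "t \<in> J k" for t m k
  proof (rule ccontr)
    assume "m \<noteq> k"
    then consider "Suc m \<le> k" | "Suc k \<le> m" by linarith
    then show False
    proof cases
      case 1
      then have "q ^ k \<le> q ^ Suc m" using q by (intro power_decreasing) auto
      then show False using that by (auto simp: J_def)
    next
      case 2
      then have "q ^ m \<le> q ^ Suc k" using q by (intro power_decreasing) auto
      then show False using that by (auto simp: J_def)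
    qed
  qed
  have bound: "ennreal ((1 - q) * (\<Sum>k<K. a k)) \<le> ?I" for K
  proof -
    have "ennreal ((1 - q) * (\<Sum>k<K. a k)) = (\<Sum>k<K. ennreal ((1 - q) * a k))"
      using a q unfolding sum_distrib_left by (subst sum_ennreal) (auto simp: less_imp_le)
    also have "\<dots> = (\<Sum>k<K. \<integral>\<^sup>+t. ennreal (a k / q ^ k) * indicator (J k) t \<partial>lborel)"
    proof (rule sum.cong[OF refl])
      fix k
      have "(\<integral>\<^sup>+t. ennreal (a k / q ^ k) * indicator (J k) t \<partial>lborel) = ennreal (a k / q ^ k) * emeasure lborel (J k)"
        unfolding J_def by (subst nn_integral_cmult_indicator) auto
      also have "emeasure lborel (J k) = ennreal (q ^ k - q ^ Suc k)"
        unfolding J_def using qs[of k] by (subst emeasure_lborel_Ioc) auto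
      also have "ennreal (a k / q ^ k) * ennreal (q ^ k - q ^ Suc k) = ennreal (a k / q ^ k * (q ^ k - q ^ Suc k))"
        using a[of k] q qs[of k] by (subst ennreal_mult) auto
      also have "a k / q ^ k * (q ^ k - q ^ Suc k) = (1 - q) * a k" using q by (simp add: field_simps)
      finally show "ennreal ((1 - q) * a k) = (\<integral>\<^sup>+t. ennreal (a k / q ^ k) * indicator (J k) t \<partial>lborel)" by simp
    qed
    also have "\<dots> = (\<integral>\<^sup>+t. (\<Sum>k<K. ennreal (a k / q ^ k) * indicator (J k) t) \<partial>lborel)"
      unfolding J_def by (rule nn_integral_sum[symmetric]) auto
    also have "\<dots> \<le> ?I"
    proof (rule nn_integral_mono)
      fix t :: real
      show "(\<Sum>k<K. ennreal (a k / q ^ k) * indicator (J k) t) \<le> ennreal (1 / ((1 - t) * ln (1 / \<phi> t))) * indicator {0<..<1} t"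
      proof (cases "\<exists>k<K. t \<in> J k")
        case False
        then have "(\<Sum>k<K. ennreal (a k / q ^ k) * indicator (J k) t) = 0" by (intro sum.neutral) (auto simp: indicator_def)
        then show ?thesis by simp
      next
        case True
        then obtain k where k: "k < K" "t \<in> J k" by blast
        have "(\<Sum>j<K. ennreal (a j / q ^ j) * indicator (J j) t) = (\<Sum>j<K. if j = k then ennreal (a k / q ^ k) else 0)"
        proof (rule sum.cong[OF refl])
          fix j
          have "t \<notin> J j" if "j \<noteq> k" using J_disj[of t j k] k(2) that by blast
          then show "ennreal (a j / q ^ j) * indicator (J j) t = (if j = k then ennreal (a k / q ^ k) else 0)"
            using k(2) by (cases "j = k") simp_all
        qed
        also have "\<dots> = ennreal (a k / q ^ k)" using k(1) by simp
        also have "\<dots> \<le> ennreal (1 / ((1 - t) * ln (1 / \<phi> t)))"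
        proof (rule ennreal_leI)
          have qk: "q ^ k \<le> 1" "0 < q ^ Suc k" using q by (auto simp: power_le_one)
          then have t: "t \<in> {0<..<1}" using k(2) unfolding J_def by auto
          have "ln (1 / \<phi> t) \<le> ln (1 / \<phi> (1 - q ^ Suc k))"
            using k(2) by (intro phi_weight_mono t R01) (auto simp: J_def)
          moreover have "1 - t \<le> q ^ k" using k(2) by (auto simp: J_def)
          ultimately have "(1 - t) * ln (1 / \<phi> t) \<le> q ^ k * ln (1 / \<phi> (1 - q ^ Suc k))"
            using phi_weight(3)[OF t] q by (intro mult_mono) auto
          moreover have "0 < (1 - t) * ln (1 / \<phi> t)" using t phi_weight(3)[OF t] by simp
          ultimately have "1 / (q ^ k * ln (1 / \<phi> (1 - q ^ Suc k))) \<le> 1 / ((1 - t) * ln (1 / \<phi> t))"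
            by (intro frac_le) auto
          then show "a k / q ^ k \<le> 1 / ((1 - t) * ln (1 / \<phi> t))" by (simp add: a_def mult.commute)
        qed
        also have "\<dots> = ennreal (1 / ((1 - t) * ln (1 / \<phi> t))) * indicator {0<..<1} t"
        proof -
          have "q ^ k \<le> 1" "0 < q ^ Suc k" using q by (auto simp: power_le_one)
          then have "t \<in> {0<..<1}" using k(2) unfolding J_def by auto
          then show ?thesis by simp
        qed
        finally show ?thesis .
      qed
    qed
    finally show ?thesis .
  qed
  obtain B where B: "0 \<le> B" "?I = ennreal B"
    using fin by (cases ?I) (auto simp: top_unique)
  have "(\<Sum>k<K. a k) \<le> B / (1 - q)" for K
    using bound[of K] B q by (simp add: le_divide_eq mult.commute)
  then have "summable a" using a by (intro summableI_nonneg_bounded[of a "B / (1 - q)"]) (auto simp: less_imp_le)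
  then show ?thesis by (simp add: a_def[abs_def])
qed

text \<open>The upper estimate on [1 - q ^ k, 1 - q ^ Suc k) uses \<phi> at the left end, so the
  series is shifted by one place. For k = 0 the left end is 0, outside the domain of \<phi>, and the
  upper bound c of \<phi> takes over.\<close>

lemma summable_imp_integral_finite:
  assumes sm: "summable (\<lambda>k. 1 / ln (1 / \<phi> (1 - q ^ Suc k)))" and q: "0 < q" "q < 1"
  shows "(\<integral>\<^sup>+t\<in>{0<..<1}. ennreal (1 / ((1 - t) * ln (1 / \<phi> t))) \<partial>lborel) < \<infinity>"
proof -
  obtain c where c: "0 < c" "c < 1" "\<forall>t\<in>{0<..<1}. \<phi> t \<le> c" using bound_c by blast
  define b where "b k = (case k of 0 \<Rightarrow> 1 / ln (1 / c) | Suc j \<Rightarrow> 1 / ln (1 / \<phi> (1 - q ^ Suc j)))" for k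
  note R01 = one_minus_power[OF q]
  have lc: "0 < ln (1 / c)" using c by (simp add: ln_div)
  have b: "0 \<le> b k" for k unfolding b_def using lc phi_weight(3)[OF R01] by (cases k) (auto simp: less_imp_le)
  have sb: "summable b" using sm by (subst summable_Suc_iff[symmetric]) (simp add: b_def)
  define J where "J k = {1 - q ^ k ..< 1 - q ^ Suc k}" for k
  define d where "d k = b k / q ^ Suc k" for k
  have d: "0 \<le> d k" for k unfolding d_def using b q by simp
  have qs: "q ^ Suc k < q ^ k" for k using q by simp
  have "(\<integral>\<^sup>+t\<in>{0<..<1}. ennreal (1 / ((1 - t) * ln (1 / \<phi> t))) \<partial>lborel) \<le> (\<integral>\<^sup>+t. (\<Sum>k. ennreal (d k) * indicator (J k) t) \<partial>lborel)"
  proof (rule nn_integral_mono)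
    fix t :: real
    show "ennreal (1 / ((1 - t) * ln (1 / \<phi> t))) * indicator {0<..<1} t \<le> (\<Sum>k. ennreal (d k) * indicator (J k) t)"
    proof (cases "t \<in> {0<..<1}")
      case t: True
      then obtain k where k: "1 - q ^ k \<le> t" "t < 1 - q ^ Suc k"
        using unit_interval_geometric[OF q, of t] by auto
      have "1 / ln (1 / \<phi> t) \<le> b k"
      proof (cases k)
        case 0
        have "ln (1 / c) \<le> ln (1 / \<phi> t)"
          using c t phi_weight[OF t] by (subst ln_le_cancel_iff) (auto intro!: frac_le)
        then show ?thesis unfolding b_def 0 using lc by (simp add: frac_le)
      next
        case (Suc j)
        have "ln (1 / \<phi> (1 - q ^ Suc j)) \<le> ln (1 / \<phi> t)"
          using k(1) by (intro phi_weight_mono t R01) (simp add: Suc)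
        then show ?thesis unfolding b_def Suc using phi_weight(3)[OF R01[of j]] by (simp add: frac_le)
      qed
      moreover have "1 / (1 - t) \<le> 1 / q ^ Suc k" using k(2) q by (intro frac_le) auto
      ultimately have "1 / ln (1 / \<phi> t) * (1 / (1 - t)) \<le> b k * (1 / q ^ Suc k)"
        using b[of k] t by (intro mult_mono) auto
      then have "ennreal (1 / ((1 - t) * ln (1 / \<phi> t))) \<le> ennreal (d k)"
        by (intro ennreal_leI) (simp add: d_def mult.commute)
      also have "\<dots> = (\<Sum>j\<in>{k}. ennreal (d j) * indicator (J j) t)" using k by (simp add: J_def)
      also have "\<dots> \<le> (\<Sum>j. ennreal (d j) * indicator (J j) t)" by (intro sum_le_suminf) auto
      finally show ?thesis using t by simp
    qed simp
  qed
  also have "\<dots> = (\<Sum>k. \<integral>\<^sup>+t. ennreal (d k) * indicator (J k) t \<partial>lborel)"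
    unfolding J_def by (rule nn_integral_suminf) auto
  also have "\<dots> = (\<Sum>k. ennreal ((1 - q) / q * b k))"
  proof (rule suminf_cong)
    fix k
    have "(\<integral>\<^sup>+t. ennreal (d k) * indicator (J k) t \<partial>lborel) = ennreal (d k) * emeasure lborel (J k)"
      unfolding J_def by (subst nn_integral_cmult_indicator) auto
    also have "emeasure lborel (J k) = ennreal (q ^ k - q ^ Suc k)"
      unfolding J_def using qs[of k] by (subst emeasure_lborel_Ico) auto
    also have "ennreal (d k) * ennreal (q ^ k - q ^ Suc k) = ennreal (d k * (q ^ k - q ^ Suc k))"
      using d[of k] qs[of k] by (subst ennreal_mult) auto
    also have "d k * (q ^ k - q ^ Suc k) = (1 - q) / q * b k"
      unfolding d_def using q by (simp add: field_simps)
    finally show "(\<integral>\<^sup>+t. ennreal (d k) * indicator (J k) t \<partial>lborel) = ennreal ((1 - q) / q * b k)" .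
  qed
  also have "\<dots> < \<infinity>"
  proof -
    have "summable (\<lambda>k. (1 - q) / q * b k)" by (intro summable_mult sb)
    then have "(\<Sum>k. ennreal ((1 - q) / q * b k)) \<noteq> top"
      using b q by (intro ennreal_suminf_neq_top) auto
    then show ?thesis by (simp add: less_top)
  qed
  finally show ?thesis .
qed

text \<open>A point with 1 - |\<Lambda> n| comparable to q ^ Suc k contributes O(q ^ Suc k * a k),
  and separation allows O(1 / q ^ Suc k) such points, so each scale contributes O(a k).\<close>

lemma summable_green:
  assumes sm: "summable (\<lambda>k. 1 / ln (1 / \<phi> (1 - (1 / 2) ^ Suc k)))"
  shows "summable (\<lambda>n. green n 0)"
proof -
  define q :: real where "q = 1 / 2"
  have q: "0 < q" "q < 1" by (auto simp: q_def)
  define a where "a k = 1 / ln (1 / \<phi> (1 - q ^ Suc k))" for k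
  note R01 = one_minus_power[OF q]
  have a: "0 < a k" for k unfolding a_def using phi_weight(3)[OF R01[of k]] by simp
  have sa: "summable a" using sm by (simp add: a_def[abs_def] q_def)
  obtain \<delta> where \<delta>: "\<delta> > 0" "\<delta> \<le> 1" "\<forall>m n. m \<noteq> n \<longrightarrow> \<delta> \<le> pseudohyp_dist (\<Lambda> m) (\<Lambda> n)" using separated by blast
  \<comment> \<open>Off this finite set ln (1 / |\<Lambda> n|) is at most 2 (1 - |\<Lambda> n|), and
    the scale index is at least 1, so that \<phi> is evaluated inside (0,1).\<close>
  define E where "E = {n. cmod (\<Lambda> n) \<le> 1 / 2}"
  have E: "finite E" unfolding E_def by (rule finite_Lam) simp
  have "\<forall>n. \<exists>k. n \<notin> E \<longrightarrow> 1 - q ^ Suc k \<le> cmod (\<Lambda> n) \<and> cmod (\<Lambda> n) < 1 - q ^ Suc (Suc k)"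
  proof
    fix n
    show "\<exists>k. n \<notin> E \<longrightarrow> 1 - q ^ Suc k \<le> cmod (\<Lambda> n) \<and> cmod (\<Lambda> n) < 1 - q ^ Suc (Suc k)"
    proof (cases "n \<in> E")
      case False
      obtain k where k: "1 - q ^ k \<le> cmod (\<Lambda> n)" "cmod (\<Lambda> n) < 1 - q ^ Suc k"
        using unit_interval_geometric[OF q _ Lam(1)[of n]] Lam(2)[of n] by (metis less_imp_le)
      have "k \<noteq> 0" using k(2) False by (intro notI) (simp add: E_def q_def)
      then show ?thesis using k by (cases k) auto
    qed simp
  qed
  from choice[OF this] obtain \<kappa> where \<kappa>: "\<And>n. n \<notin> E \<Longrightarrow> 1 - q ^ Suc (\<kappa> n) \<le> cmod (\<Lambda> n)"
    "\<And>n. n \<notin> E \<Longrightarrow> cmod (\<Lambda> n) < 1 - q ^ Suc (Suc (\<kappa> n))" by blast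
  have each: "green n 0 \<le> 2 * q ^ Suc (\<kappa> n) * a (\<kappa> n)" if n: "n \<notin> E" for n
  proof -
    have l: "1 / 2 < cmod (\<Lambda> n)" using n by (simp add: E_def)
    have "ln (1 / cmod (\<Lambda> n)) \<le> 1 / cmod (\<Lambda> n) - 1" using Lam(2)[of n] by (intro ln_le_minus_one) simp
    also have "\<dots> = (1 - cmod (\<Lambda> n)) / cmod (\<Lambda> n)" using Lam(2)[of n] by (simp add: field_simps)
    also have "\<dots> \<le> (1 - cmod (\<Lambda> n)) / (1 / 2)" using l Lam(1)[of n] by (intro divide_left_mono) auto
    also have "\<dots> \<le> 2 * q ^ Suc (\<kappa> n)" using \<kappa>(1)[OF n] by simp
    finally have 1: "ln (1 / cmod (\<Lambda> n)) \<le> 2 * q ^ Suc (\<kappa> n)" .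
    have "ln (1 / \<phi> (1 - q ^ Suc (\<kappa> n))) \<le> ln (1 / r n)"
      unfolding r_def using \<kappa>(1)[OF n] Lam[of n] by (intro phi_weight_mono R01) auto
    then have 2: "1 / ln (1 / r n) \<le> a (\<kappa> n)"
      unfolding a_def using phi_weight(3)[OF R01[of "\<kappa> n"]] by (intro frac_le) auto
    have "ln (1 / cmod (\<Lambda> n)) * (1 / ln (1 / r n)) \<le> 2 * q ^ Suc (\<kappa> n) * a (\<kappa> n)"
      using 1 2 ln_r_pos[of n] q by (intro mult_mono) auto
    then show ?thesis by (simp add: green_0)
  qed
  have count: "real (card {n \<in> G. \<kappa> n = k}) * q ^ Suc k \<le> 128 / \<delta>\<^sup>2" if G: "finite G" "G \<inter> E = {}" for G k
  proof -
    \<comment> \<open>Points at scale k satisfy 1 - |\<Lambda> n| > q ^ Suc (Suc k) and so are d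
      apart. As q = 1/2, (d / 2)^2 is \<delta>^2 q^(2k+2) / 16, and 8 times 16 is the 128 of the
      bound.\<close>
    define d where "d = \<delta> * q ^ Suc (Suc k)"
    have d: "0 < d" unfolding d_def using \<delta> q by simp
    have "q ^ Suc (Suc k) \<le> q ^ Suc k" using q by simp
    then have "\<delta> * q ^ Suc (Suc k) \<le> 1 * q ^ Suc k" using \<delta> q by (intro mult_mono) auto
    moreover have "0 < q ^ Suc k" using q by simp
    ultimately have dh: "d \<le> 2 * q ^ Suc k" unfolding d_def by linarith
    have inE: "n \<notin> E" if "n \<in> {n \<in> G. \<kappa> n = k}" for n using that G by blast
    have "real (card {n \<in> G. \<kappa> n = k}) * (d / 2)\<^sup>2 \<le> 8 * q ^ Suc k"
    proof (rule packing_annulus[OF _ d dh])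
      show "finite {n \<in> G. \<kappa> n = k}" using G by simp
      show "0 < q ^ Suc k" "q ^ Suc k \<le> 1" using q by (auto simp: power_le_one simp del: power_Suc)
      show "1 - q ^ Suc k \<le> cmod (\<Lambda> n) \<and> cmod (\<Lambda> n) < 1" if "n \<in> {n \<in> G. \<kappa> n = k}" for n
        using \<kappa>(1)[OF inE[OF that]] that Lam(1) by auto
      fix m n assume mn: "m \<in> {n \<in> G. \<kappa> n = k}" "n \<in> {n \<in> G. \<kappa> n = k}" "m \<noteq> n"
      have "q ^ Suc (Suc k) \<le> 1 - cmod (\<Lambda> m)" using \<kappa>(2)[OF inE[OF mn(1)]] mn(1) by auto
      then have "d \<le> \<delta> * (1 - cmod (\<Lambda> m))" unfolding d_def using \<delta>(1) by (intro mult_left_mono) auto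
      then show "d \<le> cmod (\<Lambda> m - \<Lambda> n)" using separated_euclidean[OF \<delta>(3) mn(3)] \<delta>(1) by linarith
    qed
    moreover have "(d / 2)\<^sup>2 = q ^ Suc k * (q ^ Suc k * \<delta>\<^sup>2 / 16)"
      unfolding d_def by (simp add: q_def power2_eq_square)
    ultimately have "q ^ Suc k * (real (card {n \<in> G. \<kappa> n = k}) * (q ^ Suc k * \<delta>\<^sup>2 / 16)) \<le> q ^ Suc k * 8"
      by (simp only: mult_ac)
    then have "real (card {n \<in> G. \<kappa> n = k}) * (q ^ Suc k * \<delta>\<^sup>2 / 16) \<le> 8"
      using q by (simp only: mult_le_cancel_left_pos zero_less_power)
    then show ?thesis using \<delta>(1) by (simp add: le_divide_eq mult.assoc)
  qed
  have bound: "(\<Sum>n\<in>G. green n 0) \<le> 256 / \<delta>\<^sup>2 * suminf a" if G: "finite G" "G \<inter> E = {}" for G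
  proof -
    have "(\<Sum>n\<in>G. green n 0) = (\<Sum>k\<in>\<kappa> ` G. \<Sum>n\<in>{n \<in> G. \<kappa> n = k}. green n 0)"
      by (rule sum.image_gen[OF G(1)])
    also have "\<dots> \<le> (\<Sum>k\<in>\<kappa> ` G. 256 / \<delta>\<^sup>2 * a k)"
    proof (rule sum_mono)
      fix k
      have "(\<Sum>n\<in>{n \<in> G. \<kappa> n = k}. green n 0) \<le> (\<Sum>n\<in>{n \<in> G. \<kappa> n = k}. 2 * q ^ Suc k * a k)"
      proof (rule sum_mono)
        fix n assume "n \<in> {n \<in> G. \<kappa> n = k}"
        then have "n \<notin> E" "\<kappa> n = k" using G by auto
        then show "green n 0 \<le> 2 * q ^ Suc k * a k" using each by blast
      qed
      also have "\<dots> = (real (card {n \<in> G. \<kappa> n = k}) * q ^ Suc k) * (2 * a k)" by simp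
      also have "\<dots> \<le> 128 / \<delta>\<^sup>2 * (2 * a k)" using count[OF G, of k] a[of k] by (intro mult_right_mono) auto
      finally show "(\<Sum>n\<in>{n \<in> G. \<kappa> n = k}. green n 0) \<le> 256 / \<delta>\<^sup>2 * a k" by simp
    qed
    also have "\<dots> = 256 / \<delta>\<^sup>2 * sum a (\<kappa> ` G)" by (simp add: sum_distrib_left)
    also have "\<dots> \<le> 256 / \<delta>\<^sup>2 * suminf a"
      using G a \<delta>(1) sa by (intro mult_left_mono sum_le_suminf) (auto simp: less_imp_le)
    finally show ?thesis .
  qed
  show ?thesis
  proof (rule summableI_nonneg_bounded)
    show "0 \<le> green n 0" for n by (rule green_nonneg) simp
    show "(\<Sum>n<m. green n 0) \<le> (\<Sum>n\<in>E. green n 0) + 256 / \<delta>\<^sup>2 * suminf a" for m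
    proof -
      have "(\<Sum>n<m. green n 0) = (\<Sum>n\<in>{..<m} \<inter> E. green n 0) + (\<Sum>n\<in>{..<m} - E. green n 0)"
        by (rule sum.Int_Diff) simp
      moreover have "(\<Sum>n\<in>{..<m} \<inter> E. green n 0) \<le> (\<Sum>n\<in>E. green n 0)"
        using E by (intro sum_mono2) (auto intro: green_nonneg)
      moreover have "(\<Sum>n\<in>{..<m} - E. green n 0) \<le> 256 / \<delta>\<^sup>2 * suminf a" by (intro bound) auto
      ultimately show ?thesis by linarith
    qed
  qed
qed

text \<open>Positivity yields convergence of the series for some unspecified q, by
  \<open>harmonic_measure_zero\<close>, and one q is enough for the integral; conversely the
  integral gives convergence for every q, in particular for 1/2.\<close>

theorem harmonic_measure_pos_iff:
  "0 < harmonic_measure 0 (sphere 0 1) \<Omega> \<longleftrightarrow>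
    (\<integral>\<^sup>+t\<in>{0<..<1}. ennreal (1 / ((1 - t) * ln (1 / \<phi> t))) \<partial>lborel) < \<infinity>"
proof
  assume "0 < harmonic_measure 0 (sphere 0 1) \<Omega>"
  then have "\<not> harmonic_measure 0 (sphere 0 1) \<Omega> \<le> 0" by simp
  then obtain q where "0 < q" "q < 1" "summable (\<lambda>k. 1 / ln (1 / \<phi> (1 - q ^ Suc k)))"
    using harmonic_measure_zero by blast
  then show "(\<integral>\<^sup>+t\<in>{0<..<1}. ennreal (1 / ((1 - t) * ln (1 / \<phi> t))) \<partial>lborel) < \<infinity>"
    by (intro summable_imp_integral_finite)
next
  assume "(\<integral>\<^sup>+t\<in>{0<..<1}. ennreal (1 / ((1 - t) * ln (1 / \<phi> t))) \<partial>lborel) < \<infinity>"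
  then have "summable (\<lambda>k. 1 / ln (1 / \<phi> (1 - (1 / 2) ^ Suc k)))"
    by (rule integral_finite_imp_summable) auto
  then show "0 < harmonic_measure 0 (sphere 0 1) \<Omega>"
    by (intro harmonic_measure_pos summable_green)
qed

end

theorem theorem1:
  fixes \<Lambda> :: "nat \<Rightarrow> complex" and \<phi> :: "real \<Rightarrow> real"
  assumes "uniformly_dense \<Lambda>"
    and "\<phi> \<in> {0<..<1} \<rightarrow> {0<..<1}"
    and "antimono_on {0<..<1} \<phi>"
    and "\<exists>c<1. \<forall>t\<in>{0<..<1}. \<phi> t \<le> c"
    and "\<forall>n. \<Lambda> n \<noteq> 0"
    and "disjoint_family (\<lambda>n. pseudohyp_disk (\<Lambda> n) (\<phi> (cmod (\<Lambda> n))))"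
    and "0 \<in> champagne_region \<Lambda> \<phi>"
  shows "harmonic_measure 0 (sphere 0 1) (champagne_region \<Lambda> \<phi>) > 0 \<longleftrightarrow>
         (\<integral>\<^sup>+t\<in>{0<..<1}. ennreal (1 / ((1 - t) * ln (1 / \<phi> t))) \<partial>lborel) < \<infinity>"
proof -
  interpret champagne \<Lambda> \<phi>
    using assms by (rule champagne.intro)
  show ?thesis by (rule harmonic_measure_pos_iff)
qed

end
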